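(* Let $D\subset\mathbb{C}$ be a domain, let $p>1$, put $\alpha:=\frac{p}{p-1}$, and let $f:D\to\mathbb{C}$ be an open discrete mapping of finite distortion such that $N(f,D)<\infty$. Put $Q(z)=N(f,D)\cdot K_{I,\alpha}^{p-1}(z,f)$. Then for every (finite) $z_0\in\overline{D}$, every $r_0\in(0,d_0)$, where $d_0=\sup_{z\in D}|z-z_0|$, and every $\varepsilon\in(0,r_0)$, $$M_p(f(\Sigma_{\varepsilon}))\geqslant\inf_{\rho\in{\rm ext}_p\,{\rm adm}\,\Sigma_{\varepsilon}}\ \int\limits_{D\cap A(z_0,\varepsilon,r_0)}\frac{\rho^p(z)}{Q(z)}\,dm(z),$$ where $\Sigma_{\varepsilon}$ is the family of all intersections $S(z_0,r)\cap D$ of the circles $S(z_0,r)$, $r\in(\varepsilon,r_0)$, with $D$.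
   Context: Notation: $dm$ is Lebesgue measure in $\mathbb{C}$; $S(z_0,r)=\{z\in\mathbb{C}:|z-z_0|=r\}$; $A(z_0,\varepsilon,r_0)=\{z\in\mathbb{C}:\varepsilon<|z-z_0|<r_0\}$; $\mathcal{H}^1$ is one-dimensional Hausdorff measure. For $z=x+iy$: $f_{\overline z}=(f_x+if_y)/2$, $f_z=(f_x-if_y)/2$, $J(z,f)=|f_z|^2-|f_{\overline z}|^2$, $\|f'(z)\|=|f_z|+|f_{\overline z}|$. Standing conventions: mappings are continuous, sense-preserving, and have partial derivatives almost everywhere. $f$ is discrete if $f^{-1}(y)$ is a discrete set for every $y$, and open if it maps open sets onto open sets. Multiplicity: $N(y,f,E)={\rm card}\{x\in E:f(x)=y\}$, $N(f,E)=\sup_yN(y,f,E)$. Finite distortion: $f\in W^{1,1}_{\rm loc}(D)$ and there is a function $K(z)<\infty$ a.e. such that $\|f'(z)\|^2\leqslant K(z)\,J(z,f)$ for a.e. $z\in D$. Inner dilatation of order $q\geqslant1$: $K_{I,q}(z,f)=\dfrac{|f_z|^2-|f_{\overline z}|^2}{(|f_z|-|f_{\overline z}|)^q}$ if $J(z,f)\neq0$; $K_{I,q}(z,f)=1$ if $f'(z)=0$; $K_{I,q}(z,f)=\infty$ otherwise. Modulus of families of surfaces (in the plane, one-dimensional): a surface $S$ is a continuous map of an open set $D_s\subset\mathbb{R}$ into $\mathbb{R}^2=\mathbb{C}$, with multiplicity $N(y,S)={\rm card}\,S^{-1}(y)$, and $\int_S\rho\,d\mathcal{A}=\int_{\mathbb{C}}\rho(y)N(y,S)\,d\mathcal{H}^1y$.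 The set $S(z_0,r)\cap D$ is viewed as a surface with multiplicity $1$ at each of its points (natural parametrization of the circle), and its image $f(S(z_0,r)\cap D)$ as the surface with multiplicity function $y\mapsto N(y,f,S(z_0,r)\cap D)$; $f(\Sigma_\varepsilon)$ is the family of these images. For a family $\Gamma$ of surfaces, a Borel function $\rho:\mathbb{C}\to[0,\infty]$ is admissible ($\rho\in{\rm adm}\,\Gamma$) if $\int_S\rho\,d\mathcal{A}\geqslant1$ for every $S\in\Gamma$, and $M_p(\Gamma)=\inf_{\rho\in{\rm adm}\,\Gamma}\int_{\mathbb{C}}\rho^p\,dm$. A property holds for $p$-almost all surfaces of $\Gamma$ if it holds for all of them except a subfamily of zero $p$-modulus. A Lebesgue measurable $\rho:\mathbb{C}\to[0,\infty]$ belongs to ${\rm ext}_p\,{\rm adm}\,\Gamma$ if $\int_S\rho\,d\mathcal{A}\geqslant1$ for $p$-almost all $S\in\Gamma$. *)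

theory Defs
  imports "HOL-Complex_Analysis.Complex_Analysis"
begin

section \<open>One-dimensional Hausdorff measure in the plane\<close>

definition hausdorff1_delta :: "real \<Rightarrow> complex set \<Rightarrow> ennreal" where
  "hausdorff1_delta \<delta> A =
     (INF U \<in> {U :: nat \<Rightarrow> complex set. A \<subseteq> (\<Union>i. U i) \<and> (\<forall>i. bounded (U i) \<and> diameter (U i) \<le> \<delta>)}.
        \<Sum>i. ennreal (diameter (U i)))"

definition hausdorff1_outer :: "complex set \<Rightarrow> ennreal" where
  "hausdorff1_outer A = (SUP \<delta>\<in>{0<..}. hausdorff1_delta \<delta> A)"

text \<open>The measure lives on the sigma-algebra of all Caratheodory-measurable sets; in particular it
  is complete. This matters for densities that are only Lebesgue measurable.\<close>

definition hausdorff1 :: "complex measure" where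
  "hausdorff1 = measure_of UNIV (lambda_system UNIV (Pow UNIV) hausdorff1_outer) hausdorff1_outer"

lemma hausdorff1_delta_mono: "A \<subseteq> B \<Longrightarrow> hausdorff1_delta \<delta> A \<le> hausdorff1_delta \<delta> B"
  unfolding hausdorff1_delta_def by (rule INF_superset_mono) auto

lemma hausdorff1_delta_empty:
  assumes "\<delta> > 0"
  shows "hausdorff1_delta \<delta> {} = 0"
proof -
  have "hausdorff1_delta \<delta> {} \<le> (\<Sum>i::nat. ennreal (diameter ({}::complex set)))"
    unfolding hausdorff1_delta_def using assms by (intro INF_lower) auto
  then show ?thesis by simp
qed

lemma hausdorff1_delta_subadditive:
  "hausdorff1_delta \<delta> (\<Union>i. A i) \<le> (\<Sum>i::nat. hausdorff1_delta \<delta> (A i))"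
proof (rule ennreal_le_epsilon)
  fix e :: real
  assume e: "e > 0" and fin: "(\<Sum>i. hausdorff1_delta \<delta> (A i)) < top"
  let ?C = "\<lambda>i. {U :: nat \<Rightarrow> complex set. A i \<subseteq> (\<Union>j. U j) \<and> (\<forall>j. bounded (U j) \<and> diameter (U j) \<le> \<delta>)}"
  have "\<exists>U. U \<in> ?C i \<and> (\<Sum>j. ennreal (diameter (U j))) < hausdorff1_delta \<delta> (A i) + ennreal (e * (1/2)^Suc i)" for i
  proof -
    have "hausdorff1_delta \<delta> (A i) < top"
      using fin ennreal_suminf_lessD by blast
    then have "hausdorff1_delta \<delta> (A i) < hausdorff1_delta \<delta> (A i) + ennreal (e * (1/2)^Suc i)"
      using e by (cases "hausdorff1_delta \<delta> (A i)")
        (simp_all flip: ennreal_plus add: ennreal_less_iff less_top)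
    then have "(INF U\<in>?C i. \<Sum>j. ennreal (diameter (U j))) < hausdorff1_delta \<delta> (A i) + ennreal (e * (1/2)^Suc i)"
      by (simp only: hausdorff1_delta_def)
    then show ?thesis
      by (simp only: INF_less_iff Bex_def)
  qed
  then have "\<forall>i. \<exists>U. U \<in> ?C i \<and> (\<Sum>j. ennreal (diameter (U j))) < hausdorff1_delta \<delta> (A i) + ennreal (e * (1/2)^Suc i)"
    by (rule allI)
  from choice[OF this] obtain U where "\<forall>i. U i \<in> ?C i \<and> (\<Sum>j. ennreal (diameter (U i j))) < hausdorff1_delta \<delta> (A i) + ennreal (e * (1/2)^Suc i)"
    by (elim exE)
  then have U: "U i \<in> ?C i"
    and Us: "(\<Sum>j. ennreal (diameter (U i j))) < hausdorff1_delta \<delta> (A i) + ennreal (e * (1/2)^Suc i)" for i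
    by (simp_all only: simp_thms)
  define V where "V n = (case prod_decode n of (i, j) \<Rightarrow> U i j)" for n
  have "(\<Union>i. A i) \<subseteq> (\<Union>n. V n)"
  proof
    fix x assume "x \<in> (\<Union>i. A i)"
    then obtain i where "x \<in> A i" by blast
    then obtain j where "x \<in> U i j" using U[of i] by blast
    then have "x \<in> V (prod_encode (i, j))" by (simp add: V_def)
    then show "x \<in> (\<Union>n. V n)" by blast
  qed
  moreover have "bounded (V n) \<and> diameter (V n) \<le> \<delta>" for n
    using U by (auto simp: V_def split: prod.split)
  ultimately have "hausdorff1_delta \<delta> (\<Union>i. A i) \<le> (\<Sum>n. ennreal (diameter (V n)))"
    unfolding hausdorff1_delta_def by (intro INF_lower) auto
  also have "\<dots> = (\<Sum>n. (\<lambda>(i, j). ennreal (diameter (U i j))) (prod_decode n))"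
    by (simp add: V_def split_beta)
  also have "\<dots> = (\<Sum>i. \<Sum>j. ennreal (diameter (U i j)))"
    by (subst suminf_ennreal_2dimen[where f = "\<lambda>(i, j). ennreal (diameter (U i j))"]) (auto simp: o_def)
  also have "\<dots> \<le> (\<Sum>i. hausdorff1_delta \<delta> (A i) + ennreal (e * (1/2)^Suc i))"
    by (intro suminf_le less_imp_le[OF Us]) auto
  also have "\<dots> = (\<Sum>i. hausdorff1_delta \<delta> (A i)) + (\<Sum>i. ennreal (e * (1/2)^Suc i))"
    by (rule suminf_add[symmetric]) auto
  also have "(\<Sum>i. ennreal (e * (1/2)^Suc i)) = ennreal e"
    using sums_mult[OF power_half_series, of e] e by (intro sums_unique[symmetric] sums_ennreal[THEN iffD2]) auto
  finally show "hausdorff1_delta \<delta> (\<Union>i. A i) \<le> (\<Sum>i. hausdorff1_delta \<delta> (A i)) + ennreal e" .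
qed

lemma outer_measure_space_hausdorff1: "outer_measure_space (Pow UNIV) hausdorff1_outer"
  unfolding outer_measure_space_def
proof (intro conjI)
  show "positive (Pow UNIV) hausdorff1_outer"
    unfolding positive_def hausdorff1_outer_def
    by (auto simp: hausdorff1_delta_empty intro!: SUP_eqI)
  show "increasing (Pow UNIV) hausdorff1_outer"
    unfolding increasing_def hausdorff1_outer_def
    by (auto intro!: SUP_mono' hausdorff1_delta_mono)
  show "countably_subadditive (Pow UNIV) hausdorff1_outer"
    unfolding countably_subadditive_def
  proof (intro allI impI)
    fix A :: "nat \<Rightarrow> complex set"
    show "hausdorff1_outer (\<Union>i. A i) \<le> (\<Sum>i. hausdorff1_outer (A i))"
      unfolding hausdorff1_outer_def[of "\<Union>i. A i"]
    proof (rule SUP_least)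
      fix \<delta> :: real assume "\<delta> \<in> {0<..}"
      then have "hausdorff1_delta \<delta> (A i) \<le> hausdorff1_outer (A i)" for i
        unfolding hausdorff1_outer_def by (rule SUP_upper)
      then have "(\<Sum>i. hausdorff1_delta \<delta> (A i)) \<le> (\<Sum>i. hausdorff1_outer (A i))"
        by (intro suminf_le) auto
      with hausdorff1_delta_subadditive show "hausdorff1_delta \<delta> (\<Union>i. A i) \<le> (\<Sum>i. hausdorff1_outer (A i))"
        by (rule order_trans)
    qed
  qed
qed

lemma measure_space_hausdorff1:
  "measure_space UNIV (lambda_system UNIV (Pow UNIV) hausdorff1_outer) hausdorff1_outer"
  by (rule sigma_algebra.caratheodory_lemma[OF sigma_algebra_Pow outer_measure_space_hausdorff1])

lemma space_hausdorff1 [simp]: "space hausdorff1 = UNIV"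
  by (simp add: hausdorff1_def space_measure_of_conv)

lemma sets_hausdorff1: "sets hausdorff1 = lambda_system UNIV (Pow UNIV) hausdorff1_outer"
  unfolding hausdorff1_def
  using measure_space_hausdorff1 sigma_algebra.sets_measure_of_eq unfolding measure_space_def by blast

lemma emeasure_hausdorff1:
  "A \<in> sets hausdorff1 \<Longrightarrow> emeasure hausdorff1 A = hausdorff1_outer A"
  using measure_space_hausdorff1 unfolding sets_hausdorff1 unfolding hausdorff1_def measure_space_def
  by (simp add: emeasure_measure_of_sigma)


section \<open>Formal derivatives and dilatations\<close>

definition has_dir_deriv :: "(complex \<Rightarrow> 'b::real_normed_vector) \<Rightarrow> complex \<Rightarrow> complex \<Rightarrow> bool" where
  "has_dir_deriv g v z \<longleftrightarrow> (\<lambda>t::real. g (z + of_real t * v)) differentiable (at 0)"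

text \<open>The partial derivatives with respect to x and y are obtained for v = 1 and v = i.\<close>

definition dir_deriv :: "complex \<Rightarrow> (complex \<Rightarrow> 'b::real_normed_vector) \<Rightarrow> complex \<Rightarrow> 'b" where
  "dir_deriv v g z = vector_derivative (\<lambda>t::real. g (z + of_real t * v)) (at 0)"

definition f_zbar :: "(complex \<Rightarrow> complex) \<Rightarrow> complex \<Rightarrow> complex" where
  "f_zbar f z = (dir_deriv 1 f z + \<i> * dir_deriv \<i> f z) / 2"

definition f_z :: "(complex \<Rightarrow> complex) \<Rightarrow> complex \<Rightarrow> complex" where
  "f_z f z = (dir_deriv 1 f z - \<i> * dir_deriv \<i> f z) / 2"

definition jacobian :: "(complex \<Rightarrow> complex) \<Rightarrow> complex \<Rightarrow> real" where
  "jacobian f z = (cmod (f_z f z))\<^sup>2 - (cmod (f_zbar f z))\<^sup>2"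

definition deriv_norm :: "(complex \<Rightarrow> complex) \<Rightarrow> complex \<Rightarrow> real" where
  "deriv_norm f z = cmod (f_z f z) + cmod (f_zbar f z)"

definition has_partials_ae :: "complex set \<Rightarrow> (complex \<Rightarrow> complex) \<Rightarrow> bool" where
  "has_partials_ae D f \<longleftrightarrow> (AE z in lebesgue. z \<in> D \<longrightarrow> has_dir_deriv f 1 z \<and> has_dir_deriv f \<i> z)"

text \<open>Powers of extended nonnegative reals, used for positive exponents only.\<close>

definition ennpowr :: "ennreal \<Rightarrow> real \<Rightarrow> ennreal" where
  "ennpowr x p = (if x = \<infinity> then \<infinity> else ennreal (enn2real x powr p))"

text \<open>The value at points with negative Jacobian is irrelevant: for mappings of finite distortion
  these points form a null set.\<close>

definition inner_dilatation :: "real \<Rightarrow> (complex \<Rightarrow> complex) \<Rightarrow> complex \<Rightarrow> ennreal" where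
  "inner_dilatation q f z =
     (if jacobian f z \<noteq> 0 then
        ennreal (((cmod (f_z f z))\<^sup>2 - (cmod (f_zbar f z))\<^sup>2) / (cmod (f_z f z) - cmod (f_zbar f z)) powr q)
      else if f_z f z = 0 \<and> f_zbar f z = 0 then 1
      else \<infinity>)"


section \<open>Sobolev mappings and mappings of finite distortion\<close>

primrec Ck_function :: "nat \<Rightarrow> (complex \<Rightarrow> real) \<Rightarrow> bool" where
  "Ck_function 0 \<phi> \<longleftrightarrow> continuous_on UNIV \<phi>"
| "Ck_function (Suc k) \<phi> \<longleftrightarrow>
     (\<forall>v\<in>{1, \<i>}. (\<forall>z. has_dir_deriv \<phi> v z) \<and> Ck_function k (dir_deriv v \<phi>))"

definition test_function :: "complex set \<Rightarrow> (complex \<Rightarrow> real) \<Rightarrow> bool" where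
  "test_function D \<phi> \<longleftrightarrow> (\<forall>k. Ck_function k \<phi>) \<and>
     compact (closure {z. \<phi> z \<noteq> 0}) \<and> closure {z. \<phi> z \<noteq> 0} \<subseteq> D"

definition locally_integrable_on :: "(complex \<Rightarrow> complex) \<Rightarrow> complex set \<Rightarrow> bool" where
  "locally_integrable_on g D \<longleftrightarrow> (\<forall>C. compact C \<and> C \<subseteq> D \<longrightarrow> set_integrable lebesgue C g)"

definition weak_dir_deriv ::
  "complex set \<Rightarrow> complex \<Rightarrow> (complex \<Rightarrow> complex) \<Rightarrow> (complex \<Rightarrow> complex) \<Rightarrow> bool" where
  "weak_dir_deriv D v f g \<longleftrightarrow>
     (\<forall>\<phi>. test_function D \<phi> \<longrightarrow>
        (LINT z:D|lebesgue. dir_deriv v \<phi> z *\<^sub>R f z) = - (LINT z:D|lebesgue. \<phi> z *\<^sub>R g z))"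

definition W11_loc :: "complex set \<Rightarrow> (complex \<Rightarrow> complex) \<Rightarrow> bool" where
  "W11_loc D f \<longleftrightarrow> locally_integrable_on f D \<and>
     (\<forall>v\<in>{1, \<i>}. \<exists>g. locally_integrable_on g D \<and> weak_dir_deriv D v f g)"

text \<open>The coercion of the Jacobian truncates negative values to 0; since K is nonnegative, this does
  not change the inequality: either version forces f' = 0 where the Jacobian is not positive.\<close>

definition finite_distortion :: "complex set \<Rightarrow> (complex \<Rightarrow> complex) \<Rightarrow> bool" where
  "finite_distortion D f \<longleftrightarrow> W11_loc D f \<and>
     (\<exists>K :: complex \<Rightarrow> ennreal.
        (AE z in lebesgue. z \<in> D \<longrightarrow> K z < \<infinity>) \<and>
        (AE z in lebesgue. z \<in> D \<longrightarrow> ennreal ((deriv_norm f z)\<^sup>2) \<le> K z * ennreal (jacobian f z)))"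

text \<open>Positivity of the topological degree: the winding number of the image of a positively oriented
  circle about y is the degree at y of the restriction of f to the disc.\<close>

definition sense_preserving :: "complex set \<Rightarrow> (complex \<Rightarrow> complex) \<Rightarrow> bool" where
  "sense_preserving D f \<longleftrightarrow>
     (\<forall>a r y. 0 < r \<and> cball a r \<subseteq> D \<and> y \<in> f ` ball a r - f ` sphere a r \<longrightarrow>
        0 < Re (winding_number (f \<circ> circlepath a r) y))"


section \<open>Multiplicity, surfaces and their modulus\<close>

definition multiplicity_at :: "'b \<Rightarrow> ('a \<Rightarrow> 'b) \<Rightarrow> 'a set \<Rightarrow> ennreal" where
  "multiplicity_at y f E =
     (if finite {x\<in>E. f x = y} then of_nat (card {x\<in>E. f x = y}) else \<infinity>)"

definition max_multiplicity :: "('a \<Rightarrow> 'b) \<Rightarrow> 'a set \<Rightarrow> ennreal" where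
  "max_multiplicity f E = (SUP y. multiplicity_at y f E)"

text \<open>A surface is a parameter set together with a parametrization; it enters only through its
  multiplicity function. The type of parameters is left open, so that a subset of a circle can
  be parametrized injectively by itself (a full circle is not an injective continuous image of an
  open subset of the line).\<close>

type_synonym 'a surface = "'a set \<times> ('a \<Rightarrow> complex)"

definition surface_mult :: "'a surface \<Rightarrow> complex \<Rightarrow> ennreal" where
  "surface_mult S y = multiplicity_at y (snd S) (fst S)"

definition surface_image :: "(complex \<Rightarrow> complex) \<Rightarrow> 'a surface \<Rightarrow> 'a surface" where
  "surface_image f S = (fst S, f \<circ> snd S)"

definition surface_integral :: "'a surface \<Rightarrow> (complex \<Rightarrow> ennreal) \<Rightarrow> ennreal" where
  "surface_integral S \<rho> = (\<integral>\<^sup>+ y. \<rho> y * surface_mult S y \<partial>hausdorff1)"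

definition adm :: "'a surface set \<Rightarrow> (complex \<Rightarrow> ennreal) set" where
  "adm \<Gamma> = {\<rho>. \<rho> \<in> borel_measurable borel \<and> (\<forall>S\<in>\<Gamma>. surface_integral S \<rho> \<ge> 1)}"

definition modulus :: "real \<Rightarrow> 'a surface set \<Rightarrow> ennreal" where
  "modulus p \<Gamma> = (INF \<rho>\<in>adm \<Gamma>. \<integral>\<^sup>+ z. ennpowr (\<rho> z) p \<partial>lborel)"

definition almost_all_surfaces :: "real \<Rightarrow> 'a surface set \<Rightarrow> ('a surface \<Rightarrow> bool) \<Rightarrow> bool" where
  "almost_all_surfaces p \<Gamma> P \<longleftrightarrow> (\<exists>\<Gamma>\<^sub>0\<subseteq>\<Gamma>. modulus p \<Gamma>\<^sub>0 = 0 \<and> (\<forall>S\<in>\<Gamma> - \<Gamma>\<^sub>0. P S))"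

text \<open>For Lebesgue measurable \<open>\<rho>\<close> the integrand of the surface integral is measurable with
  respect to the Hausdorff measure for almost all surfaces only; the exceptional family is
  negligible.\<close>

definition ext_adm :: "real \<Rightarrow> 'a surface set \<Rightarrow> (complex \<Rightarrow> ennreal) set" where
  "ext_adm p \<Gamma> = {\<rho>. \<rho> \<in> borel_measurable lebesgue \<and>
     almost_all_surfaces p \<Gamma> (\<lambda>S. surface_integral S \<rho> \<ge> 1)}"

definition circle_surface :: "complex set \<Rightarrow> complex \<Rightarrow> real \<Rightarrow> complex surface" where
  "circle_surface D z\<^sub>0 r = (sphere z\<^sub>0 r \<inter> D, id)"

definition circle_family :: "complex set \<Rightarrow> complex \<Rightarrow> real \<Rightarrow> real \<Rightarrow> complex surface set" where
  "circle_family D z\<^sub>0 \<epsilon> r\<^sub>0 = circle_surface D z\<^sub>0 ` {\<epsilon><..<r\<^sub>0}"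

definition annulus :: "complex \<Rightarrow> real \<Rightarrow> real \<Rightarrow> complex set" where
  "annulus z\<^sub>0 \<epsilon> r\<^sub>0 = {z. \<epsilon> < cmod (z - z\<^sub>0) \<and> cmod (z - z\<^sub>0) < r\<^sub>0}"

lemma surface_mult_circle: "surface_mult (circle_surface D z\<^sub>0 r) y = indicator (sphere z\<^sub>0 r \<inter> D) y"
proof -
  have "{x \<in> sphere z\<^sub>0 r \<inter> D. id x = y} = (if y \<in> sphere z\<^sub>0 r \<inter> D then {y} else {})"
    by auto
  then show ?thesis
    by (simp add: surface_mult_def circle_surface_def multiplicity_at_def indicator_def)
qed

lemma surface_mult_image_circle:
  "surface_mult (surface_image f (circle_surface D z\<^sub>0 r)) y = multiplicity_at y f (sphere z\<^sub>0 r \<inter> D)"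
  by (simp add: surface_mult_def surface_image_def circle_surface_def)

end

theory Submission imports Defs begin

text \<open>Let \<open>\<rho>'\<close> be admissible for the images of the circles. The density that competes in the infimum on
  the right is the pullback \<open>\<rho> = \<rho>' \<circ> f \<cdot> (|f_z| + |f_zbar|)\<close>, cut off outside \<open>D\<close>. Two estimates have
  to be shown: \<open>\<rho>\<close> is admissible for almost all circles, and the integral of \<open>\<rho>^p / Q\<close> over \<open>D\<close> is at
  most the integral of \<open>\<rho>'^p\<close> over the plane.

  Length. A Sobolev map, when mollified, satisfies the fundamental theorem of calculus along circles
  (\<open>mollify_curve\<close>), and its mollified gradients converge in the mean. By Fubini in polar coordinates
  they converge on almost every circle, along a subsequence that depends on the circle, and so the oscillation of \<open>f\<close> on an arc of
  almost every circle is at most the integral of \<open>|f_z| + |f_zbar|\<close> over that arc (\<open>circle_AC_AE\<close>). Such a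
  bound turns into an area inequality for curves: the Hausdorff integral of \<open>\<rho>'\<close> over the image,
  counted with multiplicity, is at most the integral of \<open>\<rho>\<close> with respect to arc length
  (\<open>curve_area_inequality\<close>), and arc length on a circle is at most Hausdorff measure
  (\<open>circle_length_le_hausdorff1\<close>). Hence \<open>\<rho>\<close> is admissible for every circle of a good radius. The other
  radii form a null set, and the circles with these radii have modulus zero (\<open>modulus_null_radii\<close>): they fill
  a null set of the plane, on which a density may be infinite free of charge.

  Area. An open map with partial derivatives almost everywhere is differentiable almost everywhere
  (\<open>Gehring_Lehto\<close>), and the partial derivatives agree with the weak ones (\<open>partials_eq_weak_AE\<close>).
  The set where the Jacobian is positive therefore splits into countably many pieces on which \<open>f\<close> is
  injective; the change of variables formula on each piece gives the area inequality
  for the Jacobian \<open>J\<close>, again with multiplicity (\<open>jacobian_area_inequality\<close>). Since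
  \<open>J\<close> is the product of \<open>|f_z| + |f_zbar|\<close> and \<open>|f_z| - |f_zbar|\<close>, and \<open>\<alpha> (p - 1) = p\<close>, the integrand
  \<open>\<rho>^p / Q\<close> is at most \<open>\<rho>'^p \<circ> f \<cdot> J / N\<close> (\<open>dilatation_pointwise\<close>); finite distortion
  enters here, as it forces the differential to vanish almost everywhere on the set where \<open>J\<close> is not positive. The bound \<open>N\<close> for
  the multiplicity cancels.\<close>

section \<open>Change of variables and polar coordinates in the plane\<close>

lemma measurable_Complex [measurable]:
  "(\<lambda>(x, y). Complex x y) \<in> lborel \<Otimes>\<^sub>M lborel \<rightarrow>\<^sub>M borel"
proof -
  have "(\<lambda>p::real\<times>real. Complex (fst p) (snd p)) \<in> borel_measurable borel"
    by (intro borel_measurable_continuous_onI continuous_on_Complex continuous_intros)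
  then show ?thesis by (simp add: lborel_prod case_prod_beta')
qed

lemma lborel_complex_prod:
  "distr (lborel \<Otimes>\<^sub>M lborel) borel (\<lambda>(x, y). Complex x y) = lborel"
proof (rule lborel_eqI[symmetric])
  fix l u :: complex assume le: "\<And>b. b \<in> Basis \<Longrightarrow> l \<bullet> b \<le> u \<bullet> b"
  have 1: "Re l \<le> Re u" "Im l \<le> Im u" using le[of 1] le[of \<i>] by (auto simp: Basis_complex_def)
  have "emeasure (distr (lborel \<Otimes>\<^sub>M lborel) borel (\<lambda>(x, y). Complex x y)) (box l u)
      = emeasure (lborel \<Otimes>\<^sub>M lborel) ({Re l<..<Re u} \<times> {Im l<..<Im u})"
    by (subst emeasure_distr[OF measurable_Complex])
       (auto intro!: arg_cong[where f="emeasure _"] simp: in_box_complex_iff space_pair_measure)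
  also have "\<dots> = emeasure lborel {Re l<..<Re u} * emeasure lborel {Im l<..<Im u}"
    by (rule lborel.emeasure_pair_measure_Times) auto
  also have "\<dots> = (\<Prod>b\<in>Basis. (u - l) \<bullet> b)"
    using 1 by (simp add: Basis_complex_def ennreal_mult'')
  finally show "emeasure (distr (lborel \<Otimes>\<^sub>M lborel) borel (\<lambda>(x, y). Complex x y)) (box l u) = (\<Prod>b\<in>Basis. (u - l) \<bullet> b)" .
qed simp

lemma nn_integral_complex:
  fixes f :: "complex \<Rightarrow> ennreal"
  assumes [measurable]: "f \<in> borel_measurable borel"
  shows "(\<integral>\<^sup>+ z. f z \<partial>lborel) = (\<integral>\<^sup>+ x. \<integral>\<^sup>+ y. f (Complex x y) \<partial>lborel \<partial>lborel)"
proof -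
  have "(\<integral>\<^sup>+ z. f z \<partial>lborel) = (\<integral>\<^sup>+ p. f (case p of (x, y) \<Rightarrow> Complex x y) \<partial>(lborel \<Otimes>\<^sub>M lborel))"
    by (subst lborel_complex_prod[symmetric], subst nn_integral_distr) (auto simp: split_def intro!: nn_integral_cong)
  also have "\<dots> = (\<integral>\<^sup>+ x. \<integral>\<^sup>+ y. f (Complex x y) \<partial>lborel \<partial>lborel)"
    by (subst lborel.nn_integral_fst[symmetric]) auto
  finally show ?thesis .
qed

text \<open>The linear isometry between the complex plane and the Cartesian plane, along which
  determinants and the change of variables formula are transported.\<close>

definition vec2 :: "complex \<Rightarrow> real^2" where "vec2 z = vector [Re z, Im z]"
definition cpx2 :: "real^2 \<Rightarrow> complex" where "cpx2 v = Complex (v$1) (v$2)"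

lemma vec2_cpx2 [simp]: "vec2 (cpx2 v) = v" "cpx2 (vec2 z) = z"
  by (simp_all add: vec2_def cpx2_def vec_eq_iff forall_2)

lemma bounded_linear_cpx2: "bounded_linear cpx2"
  by (intro linear_conv_bounded_linear[THEN iffD1] linearI) (simp_all add: cpx2_def complex_eq_iff)

lemma bounded_linear_vec2: "bounded_linear vec2"
  by (intro linear_conv_bounded_linear[THEN iffD1] linearI) (simp_all add: vec2_def vec_eq_iff forall_2)

lemma measurable_cpx2 [measurable]: "cpx2 \<in> borel_measurable borel"
  by (intro borel_measurable_continuous_onI linear_continuous_on bounded_linear_cpx2)

lemma lborel_cpx2: "distr lborel borel cpx2 = lborel"
proof (rule lborel_eqI[symmetric])
  fix l u :: complex assume le: "\<And>b. b \<in> Basis \<Longrightarrow> l \<bullet> b \<le> u \<bullet> b"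
  have 1: "Re l \<le> Re u" "Im l \<le> Im u" using le[of 1] le[of \<i>] by (auto simp: Basis_complex_def)
  have "cpx2 -` box l u = box (vec2 l) (vec2 u)"
    by (auto simp: cpx2_def vec2_def in_box_complex_iff mem_box_cart forall_2)
  then have "emeasure (distr lborel borel cpx2) (box l u) = emeasure lborel (box (vec2 l) (vec2 u))"
    by (subst emeasure_distr) auto
  also have "\<dots> = (\<Prod>b\<in>Basis. (vec2 u - vec2 l) \<bullet> b)"
    using 1 by (intro emeasure_lborel_box) (auto simp: vec2_def Basis_vec_def inner_axis forall_2 UNIV_2)
  also have "\<dots> = (\<Prod>b\<in>Basis. (u - l) \<bullet> b)"
  proof -
    have B: "(Basis :: (real^2) set) = {axis 1 1, axis 2 1}"
      by (auto simp: Basis_vec_def UNIV_2)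
    show ?thesis
      unfolding B using 1
      by (simp add: Basis_complex_def ennreal_mult'' vec2_def axis_eq_axis inner_axis)
  qed
  finally show "emeasure (distr lborel borel cpx2) (box l u) = (\<Prod>b\<in>Basis. (u - l) \<bullet> b)" .
qed simp

text \<open>The determinant of a real-linear map with respect to the basis \<open>1, \<i>\<close>.\<close>

definition det_complex :: "(complex \<Rightarrow> complex) \<Rightarrow> real" where
  "det_complex L = Re (L 1) * Im (L \<i>) - Re (L \<i>) * Im (L 1)"

lemma det_matrix_conj: "det (matrix (\<lambda>v. vec2 (L (cpx2 v)))) = det_complex L"
proof -
  have "cpx2 (axis 1 1) = 1" "cpx2 (axis 2 1) = \<i>"
    by (auto simp: cpx2_def axis_def complex_eq_iff)
  then show ?thesis by (simp add: det_2 matrix_def det_complex_def vec2_def)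
qed

text \<open>This is the formula for the measure of a differentiable injective
  image, transported from the Cartesian plane. There it speaks of integrals with a real value; the image is
  bounded, hence has finite measure.\<close>

lemma emeasure_differentiable_image_ge_bounded:
  fixes \<phi> :: "complex \<Rightarrow> complex"
  assumes S: "S \<in> sets borel" and der: "\<And>z. z \<in> S \<Longrightarrow> (\<phi> has_derivative \<phi>' z) (at z within S)"
    and inj: "inj_on \<phi> S" and J: "J \<in> borel_measurable borel" "\<And>z. z \<in> S \<Longrightarrow> J z = \<bar>det_complex (\<phi>' z)\<bar>"
    and bdd: "bounded (\<phi> ` S)"
  shows "(\<integral>\<^sup>+ z\<in>S. ennreal (J z) \<partial>lborel) \<le> emeasure lebesgue (\<phi> ` S)"
proof -
  define S2 where "S2 = cpx2 -` S"
  define \<psi> where "\<psi> = (\<lambda>v. vec2 (\<phi> (cpx2 v)))"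
  have S2: "S2 \<in> sets borel"
    using measurable_sets[OF measurable_cpx2 S] by (simp add: S2_def)
  have im: "cpx2 ` S2 = S"
    unfolding S2_def by (auto simp: image_iff) (metis vec2_cpx2(2))
  have der2: "(\<psi> has_derivative (\<lambda>v. vec2 (\<phi>' (cpx2 x) (cpx2 v)))) (at x within S2)" if "x \<in> S2" for x
  proof -
    have a: "(cpx2 has_derivative cpx2) (at x within S2)"
      by (rule bounded_linear.has_derivative[OF bounded_linear_cpx2]) (auto intro: derivative_eq_intros)
    have b: "(\<phi> has_derivative \<phi>' (cpx2 x)) (at (cpx2 x) within cpx2 ` S2)"
      using der that by (simp add: im) (auto simp: S2_def)
    show ?thesis
      unfolding \<psi>_def
      by (rule bounded_linear.has_derivative[OF bounded_linear_vec2])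
         (use has_derivative_in_compose[OF a b] in simp)
  qed
  have inj2: "inj_on \<psi> S2"
  proof (rule inj_onI)
    fix x y assume "x \<in> S2" "y \<in> S2" "\<psi> x = \<psi> y"
    then have "\<phi> (cpx2 x) = \<phi> (cpx2 y)" "cpx2 x \<in> S" "cpx2 y \<in> S"
      using vec2_cpx2 by (auto simp: \<psi>_def S2_def) (metis vec2_cpx2(2))
    then have "cpx2 x = cpx2 y" using inj by (auto dest: inj_onD)
    then show "x = y" by (metis vec2_cpx2(1))
  qed
  have imeq: "\<psi> ` S2 = vec2 ` \<phi> ` S"
    unfolding \<psi>_def im[symmetric] by (simp add: image_image)
  have S2l: "S2 \<in> sets lebesgue" using S2 by (simp add: sets_completionI_sets)
  have d: "\<psi> differentiable_on S2"
    using der2 by (auto simp: differentiable_on_def differentiable_def)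
  have L: "\<psi> ` S2 \<in> sets lebesgue"
    by (rule differentiable_image_in_sets_lebesgue[OF S2l _ d]) simp
  have bb: "bounded (\<psi> ` S2)" unfolding imeq
    by (rule bounded_linear_image[OF bdd bounded_linear_vec2])
  have lm: "\<psi> ` S2 \<in> lmeasurable"
    using L bb by (rule bounded_set_imp_lmeasurable[rotated])
  have hi: "((\<lambda>x. \<bar>det (matrix (\<lambda>v. vec2 (\<phi>' (cpx2 x) (cpx2 v))))\<bar>) has_integral measure lebesgue (\<psi> ` S2)) S2"
    using has_measure_differentiable_image[OF S2l der2 inj2, of "measure lebesgue (\<psi> ` S2)"] lm by auto
  have "(\<integral>\<^sup>+ z\<in>S. ennreal (J z) \<partial>lborel) = (\<integral>\<^sup>+ x. ennreal (J (cpx2 x)) * indicator S2 x \<partial>lborel)"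
    by (subst lborel_cpx2[symmetric], subst nn_integral_distr)
       (use S J in \<open>auto simp: S2_def indicator_def intro!: nn_integral_cong\<close>)
  also have "\<dots> = (\<integral>\<^sup>+ x. ennreal \<bar>det (matrix (\<lambda>v. vec2 (\<phi>' (cpx2 x) (cpx2 v))))\<bar> * indicator S2 x \<partial>lborel)"
    by (intro nn_integral_cong) (auto simp: indicator_def S2_def det_matrix_conj J)
  also have "\<dots> = ennreal (measure lebesgue (\<psi> ` S2))"
    by (rule nn_integral_has_integral_lebesgue'[OF _ hi]) auto
  also have "\<dots> = emeasure lebesgue (\<psi> ` S2)"
    using lm by (simp add: emeasure_eq_measure2)
  also have "\<dots> \<le> emeasure lebesgue (\<phi> ` S)"
  proof -
    have cd: "\<phi> differentiable_on S"
      using der by (auto simp: differentiable_on_def differentiable_def)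
    have pl: "\<phi> ` S \<in> sets lebesgue"
      by (rule differentiable_image_in_sets_lebesgue[OF _ _ cd]) (use S in \<open>auto simp: sets_completionI_sets\<close>)
    obtain B where B: "\<phi> ` S \<subseteq> B" "B \<in> sets lborel" "emeasure lebesgue (\<phi> ` S) = emeasure lborel B"
      using completion_upper[OF pl] by metis
    have "emeasure lborel B = emeasure lborel (cpx2 -` B)"
      using B by (subst lborel_cpx2[symmetric], subst emeasure_distr) auto
    moreover have "\<psi> ` S2 \<subseteq> cpx2 -` B" unfolding imeq using B(1) by auto
    moreover have "cpx2 -` B \<in> sets lborel"
      using measurable_sets[OF measurable_cpx2, of B] B(2) by simp
    ultimately show ?thesis
      using B(3) emeasure_mono[of "\<psi> ` S2" "cpx2 -` B" lebesgue]
      by (simp add: emeasure_completion sets_completionI_sets emeasure_lborel_cbox )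
  qed
  finally show ?thesis .
qed

text \<open>Exhaustion by the sets on which \<open>\<phi>\<close> is bounded by \<open>n\<close>, and monotone
  convergence.\<close>

lemma emeasure_differentiable_image_ge:
  fixes \<phi> :: "complex \<Rightarrow> complex"
  assumes S: "S \<in> sets borel" and der: "\<And>z. z \<in> S \<Longrightarrow> (\<phi> has_derivative \<phi>' z) (at z within S)"
    and inj: "inj_on \<phi> S" and J: "J \<in> borel_measurable borel" "\<And>z. z \<in> S \<Longrightarrow> J z = \<bar>det_complex (\<phi>' z)\<bar>"
  shows "(\<integral>\<^sup>+ z\<in>S. ennreal (J z) \<partial>lborel) \<le> emeasure lebesgue (\<phi> ` S)"
proof -
  have cont: "continuous_on S \<phi>"
    using der by (auto simp: continuous_on_eq_continuous_within intro: has_derivative_continuous)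
  have m: "(\<lambda>z. indicator S z *\<^sub>R \<phi> z) \<in> borel_measurable borel"
    by (rule borel_measurable_continuous_on_indicator[OF _ cont]) (use S in auto)
  define T where "T n = S \<inter> {z. norm (indicator S z *\<^sub>R \<phi> z) \<le> real n}" for n
  have T: "T n \<in> sets borel" for n
    unfolding T_def using m S by measurable
  have "(\<integral>\<^sup>+ z\<in>S. ennreal (J z) \<partial>lborel) = (\<integral>\<^sup>+ z. (SUP n. ennreal (J z) * indicator (T n) z) \<partial>lborel)"
  proof (intro nn_integral_cong)
    fix z
    have "indicator S z = (SUP n. indicator (T n) z :: ennreal)"
    proof (cases "z \<in> S")
      case True
      obtain n where "norm (\<phi> z) \<le> real n" using real_arch_simple by blast
      then have "z \<in> T n" using True by (auto simp: T_def)
      then have "(1::ennreal) \<le> (SUP n. indicator (T n) z)" by (intro SUP_upper2[of n]) auto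
      moreover have "(SUP n. indicator (T n) z :: ennreal) \<le> 1" by (intro SUP_least) (auto simp: indicator_def)
      ultimately show ?thesis using True by (auto intro: antisym)
    qed (auto simp: T_def)
    then show "ennreal (J z) * indicator S z = (SUP n. ennreal (J z) * indicator (T n) z)"
      by (simp add: SUP_mult_left_ennreal)
  qed
  also have "\<dots> = (SUP n. \<integral>\<^sup>+ z\<in>T n. ennreal (J z) \<partial>lborel)"
  proof (intro nn_integral_monotone_convergence_SUP)
    note T[measurable] J(1)[measurable]
    show "(\<lambda>z. ennreal (J z) * indicator (T n) z) \<in> borel_measurable lborel" for n
      by measurable
    show "incseq (\<lambda>n z. ennreal (J z) * indicator (T n) z)"
      by (auto simp: incseq_def le_fun_def T_def indicator_def)
  qed
  also have "\<dots> \<le> emeasure lebesgue (\<phi> ` S)"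
  proof (rule SUP_least)
    fix n
    have sub: "T n \<subseteq> S" by (auto simp: T_def)
    have "(\<integral>\<^sup>+ z\<in>T n. ennreal (J z) \<partial>lborel) \<le> emeasure lebesgue (\<phi> ` T n)"
    proof (rule emeasure_differentiable_image_ge_bounded)
      show "bounded (\<phi> ` T n)" unfolding bounded_iff T_def by (intro exI[of _ "real n"]) auto
      show "inj_on \<phi> (T n)" using inj sub by (rule inj_on_subset)
      show "(\<phi> has_derivative \<phi>' z) (at z within T n)" if "z \<in> T n" for z
        using der that sub by (meson has_derivative_subset subsetD)
    qed (use T J sub in auto)
    also have "\<dots> \<le> emeasure lebesgue (\<phi> ` S)"
    proof (rule emeasure_mono)
      have cd: "\<phi> differentiable_on S"
        using der by (auto simp: differentiable_on_def differentiable_def)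
      show "\<phi> ` S \<in> sets lebesgue"
        by (rule differentiable_image_in_sets_lebesgue[OF _ _ cd]) (use S in \<open>auto simp: sets_completionI_sets\<close>)
    qed (use sub in auto)
    finally show "(\<integral>\<^sup>+ z\<in>T n. ennreal (J z) \<partial>lborel) \<le> emeasure lebesgue (\<phi> ` S)" .
  qed
  finally show ?thesis .
qed

text \<open>Both sides are integrals of \<open>u\<close> against a measure on the Borel sets: the push-forward of
  \<open>J dm\<close> on \<open>S\<close>, and Lebesgue measure on \<open>\<phi> ` S\<close>. So it suffices to compare the measures of a Borel set
  \<open>B\<close>, which is the preceding lemma on the part of \<open>S\<close> that \<open>\<phi>\<close> maps into \<open>B\<close>.\<close>

theorem change_of_variables_le:
  fixes \<phi> :: "complex \<Rightarrow> complex" and u :: "complex \<Rightarrow> ennreal"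
  assumes S: "S \<in> sets borel" and der: "\<And>z. z \<in> S \<Longrightarrow> (\<phi> has_derivative \<phi>' z) (at z within S)"
    and inj: "inj_on \<phi> S" and J: "J \<in> borel_measurable borel" "\<And>z. z \<in> S \<Longrightarrow> J z = \<bar>det_complex (\<phi>' z)\<bar>"
    and u: "u \<in> borel_measurable borel"
  shows "(\<integral>\<^sup>+ z\<in>S. u (\<phi> z) * ennreal (J z) \<partial>lborel) \<le> (\<integral>\<^sup>+ y\<in>\<phi> ` S. u y \<partial>lborel)"
proof -
  have cont: "continuous_on S \<phi>"
    using der by (auto simp: continuous_on_eq_continuous_within intro: has_derivative_continuous)
  have cd: "\<phi> differentiable_on S"
    using der by (auto simp: differentiable_on_def differentiable_def)
  have pl: "\<phi> ` S \<in> sets lebesgue"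
    by (rule differentiable_image_in_sets_lebesgue[OF _ _ cd]) (use S in \<open>auto simp: sets_completionI_sets\<close>)
  define \<psi> where "\<psi> z = indicator S z *\<^sub>R \<phi> z" for z
  have m[measurable]: "\<psi> \<in> borel_measurable borel"
    unfolding \<psi>_def by (rule borel_measurable_continuous_on_indicator[OF _ cont]) (use S in auto)
  note S[measurable] J(1)[measurable] u[measurable]
  define M1 where "M1 = distr (density lborel (\<lambda>z. ennreal (J z) * indicator S z)) borel \<psi>"
  define M2 where "M2 = distr (density lebesgue (indicator (\<phi> ` S))) borel (\<lambda>x. x)"
  have idm: "(\<lambda>x. x) \<in> measurable (density lebesgue (indicator (\<phi> ` S))) borel"
    by (auto simp: measurable_def sets_completionI_sets)
  have "M1 \<le> M2"
  proof (subst le_measure)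
    show "\<forall>B\<in>sets M1. emeasure M1 B \<le> emeasure M2 B"
    proof
      fix B assume "B \<in> sets M1"
      then have B[measurable]: "B \<in> sets borel" by (simp add: M1_def)
      define T where "T = S \<inter> \<psi> -` B"
      have T: "T \<in> sets borel"
        unfolding T_def using measurable_sets[OF m B] by (auto)
      have sub: "T \<subseteq> S" by (auto simp: T_def)
      have "emeasure M1 B = (\<integral>\<^sup>+ z\<in>\<psi> -` B. (ennreal (J z) * indicator S z) \<partial>lborel)"
        unfolding M1_def using measurable_sets[OF m B]
        by (subst emeasure_distr) (auto simp: emeasure_density)
      also have "\<dots> = (\<integral>\<^sup>+ z\<in>T. ennreal (J z) \<partial>lborel)"
        by (intro nn_integral_cong) (auto simp: T_def indicator_def)
      also have "\<dots> \<le> emeasure lebesgue (\<phi> ` T)"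
      proof (rule emeasure_differentiable_image_ge)
        show "inj_on \<phi> T" using inj sub by (rule inj_on_subset)
        show "(\<phi> has_derivative \<phi>' z) (at z within T)" if "z \<in> T" for z
          using der that sub by (meson has_derivative_subset subsetD)
      qed (use T J sub in auto)
      also have "\<phi> ` T = B \<inter> \<phi> ` S"
        by (auto simp: T_def \<psi>_def)
      also have "emeasure lebesgue \<dots> = emeasure M2 B"
      proof -
        have Bl: "B \<in> sets lebesgue" using B by (auto simp: sets_completionI_sets)
        have "emeasure M2 B = emeasure (density lebesgue (indicator (\<phi> ` S))) B"
          unfolding M2_def by (subst emeasure_distr[OF idm B]) simp
        also have "\<dots> = (\<integral>\<^sup>+ x. indicator (\<phi> ` S) x * indicator B x \<partial>lebesgue)"
          by (rule emeasure_density) (use pl Bl in auto)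
        also have "\<dots> = (\<integral>\<^sup>+ x. indicator (B \<inter> \<phi> ` S) x \<partial>lebesgue)"
          by (intro nn_integral_cong) (auto simp: indicator_def)
        also have "\<dots> = emeasure lebesgue (B \<inter> \<phi> ` S)"
          by (rule nn_integral_indicator) (use pl Bl in auto)
        finally show ?thesis ..
      qed
      finally show "emeasure M1 B \<le> emeasure M2 B" .
    qed
  qed (auto simp: M1_def M2_def)
  have "(\<integral>\<^sup>+ z\<in>S. u (\<phi> z) * ennreal (J z) \<partial>lborel) = (\<integral>\<^sup>+ z. (ennreal (J z) * indicator S z) * u (\<psi> z) \<partial>lborel)"
    by (intro nn_integral_cong) (auto simp: \<psi>_def indicator_def mult_ac)
  also have "\<dots> = nn_integral M1 u"
    unfolding M1_def by (subst nn_integral_distr) (auto simp: nn_integral_density)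
  also have "\<dots> \<le> nn_integral M2 u"
    by (rule nn_integral_mono_measure[OF _ \<open>M1 \<le> M2\<close>]) (auto simp: M1_def M2_def)
  also have "\<dots> = (\<integral>\<^sup>+ y\<in>\<phi> ` S. u y \<partial>lebesgue)"
    unfolding M2_def using pl
    by (subst nn_integral_distr[OF idm])
       (auto simp: nn_integral_density measurable_completion mult_ac)
  also have "\<dots> = (\<integral>\<^sup>+ y\<in>\<phi> ` S. u y \<partial>lborel)"
    by (rule nn_integral_completion)
  finally show ?thesis .
qed

definition polar :: "complex \<Rightarrow> real \<Rightarrow> real \<Rightarrow> complex" where
  "polar z\<^sub>0 r t = z\<^sub>0 + of_real r * cis t"

lemma has_derivative_polar:
  "((\<lambda>w. polar z\<^sub>0 (Re w) (Im w)) has_derivative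
     (\<lambda>v. of_real (Re v) * cis (Im w) + of_real (Re w) * (of_real (Im v) * (\<i> * cis (Im w))))) (at w within S)"
proof -
  have cis: "cis t = of_real (cos t) + \<i> * of_real (sin t)" for t
    by (simp add: complex_eq_iff)
  show ?thesis
    unfolding polar_def cis
    by (auto intro!: derivative_eq_intros simp: fun_eq_iff complex_eq_iff algebra_simps)
qed

lemma borel_measurable_polar [measurable (raw)]:
  assumes [measurable]: "u \<in> borel_measurable M" "v \<in> borel_measurable M"
  shows "(\<lambda>x. polar z\<^sub>0 (u x) (v x)) \<in> borel_measurable M"
proof -
  have "polar z\<^sub>0 r t = z\<^sub>0 + of_real r * (of_real (cos t) + \<i> * of_real (sin t))" for r t
    by (simp add: polar_def complex_eq_iff)
  then show ?thesis by simp
qed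

lemma inj_on_polar: "inj_on (\<lambda>w. polar z\<^sub>0 (Re w) (Im w)) {w. 0 < Re w \<and> 0 < Im w \<and> Im w < 2 * pi}"
proof (rule inj_onI, clarsimp simp: polar_def)
  fix v w assume *: "0 < Re v" "0 < Im v" "Im v < 2 * pi" "0 < Re w" "0 < Im w" "Im w < 2 * pi"
    and eq: "of_real (Re v) * cis (Im v) = of_real (Re w) * cis (Im w)"
  have A: "Arg2pi (of_real (Re x) * cis (Im x)) = Im x" if "0 < Re x" "0 < Im x" "Im x < 2 * pi" for x
    using that by (intro Arg2pi_unique[of "Re x"]) (auto simp: cis_conv_exp)
  have "cmod (of_real (Re v) * cis (Im v)) = cmod (of_real (Re w) * cis (Im w))" using eq by simp
  then have "Re v = Re w" using * by (simp add: norm_mult)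
  moreover have "Im v = Im w" using A[of v] A[of w] * eq by simp
  ultimately show "v = w" by (simp add: complex_eq_iff)
qed

text \<open>Polar coordinates are injective on the open half strip, with Jacobian \<open>r\<close>. The ray of angle
  0 is left out of the image, which shows as an inequality; this is the direction in which integrals over
  circles are bounded.\<close>

theorem nn_integral_polar_le:
  fixes u :: "complex \<Rightarrow> ennreal"
  assumes u[measurable]: "u \<in> borel_measurable borel"
  shows "(\<integral>\<^sup>+ r\<in>{0<..}. (\<integral>\<^sup>+ t\<in>{0<..<2*pi}. u (polar z\<^sub>0 r t) * ennreal r \<partial>lborel) \<partial>lborel) \<le> (\<integral>\<^sup>+ z. u z \<partial>lborel)"
proof -
  define S where "S = {w. 0 < Re w \<and> 0 < Im w \<and> Im w < 2 * pi}"
  have S[measurable]: "S \<in> sets borel" unfolding S_def by measurable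
  let ?F = "\<lambda>w. (u (polar z\<^sub>0 (Re w) (Im w)) * ennreal (Re w)) * indicator S w"
  have "(\<integral>\<^sup>+ r\<in>{0<..}. (\<integral>\<^sup>+ t\<in>{0<..<2*pi}. u (polar z\<^sub>0 r t) * ennreal r \<partial>lborel) \<partial>lborel)
      = (\<integral>\<^sup>+ r. \<integral>\<^sup>+ t. ?F (Complex r t) \<partial>lborel \<partial>lborel)"
    by (intro nn_integral_cong) (auto simp: S_def indicator_def)
  also have "\<dots> = (\<integral>\<^sup>+ w. ?F w \<partial>lborel)"
    by (rule nn_integral_complex[symmetric]) measurable
  also have "\<dots> \<le> (\<integral>\<^sup>+ y\<in>(\<lambda>w. polar z\<^sub>0 (Re w) (Im w)) ` S. u y \<partial>lborel)"
  proof (rule change_of_variables_le[OF S has_derivative_polar])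
    show "inj_on (\<lambda>w. polar z\<^sub>0 (Re w) (Im w)) S" unfolding S_def by (rule inj_on_polar)
    fix w assume "w \<in> S"
    have "Re w * (cos (Im w) * cos (Im w)) + Re w * (sin (Im w) * sin (Im w)) = Re w"
      by (simp flip: distrib_left power2_eq_square)
    then show "Re w = \<bar>det_complex (\<lambda>v. of_real (Re v) * cis (Im w) + of_real (Re w) * (of_real (Im v) * (\<i> * cis (Im w))))\<bar>"
      using \<open>w \<in> S\<close> by (simp add: det_complex_def S_def mult.left_commute mult.assoc)
  qed auto
  also have "\<dots> \<le> (\<integral>\<^sup>+ z. u z \<partial>lborel)"
    by (intro nn_integral_mono) (auto simp: indicator_def)
  finally show ?thesis .
qed

text \<open>The set is the image of \<open>N \<times> \<real>\<close> under the differentiable map of polar coordinates, and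
  differentiable maps preserve negligible sets.\<close>

lemma null_set_radial:
  assumes N: "N \<in> null_sets lborel" "N \<subseteq> {0<..}"
  shows "{z. cmod (z - z\<^sub>0) \<in> N} \<in> null_sets lborel"
proof -
  have N0[measurable]: "N \<in> sets borel" using N by auto
  have "emeasure lborel {w. Re w \<in> N} = (\<integral>\<^sup>+ w. indicator N (Re w) \<partial>lborel)"
  proof -
    have "(\<integral>\<^sup>+ w. indicator N (Re w) \<partial>lborel) = (\<integral>\<^sup>+ w. indicator {w. Re w \<in> N} w \<partial>lborel)"
      by (intro nn_integral_cong) (auto simp: indicator_def)
    also have "\<dots> = emeasure lborel {w. Re w \<in> N}"
      by (rule nn_integral_indicator) measurable
    finally show ?thesis ..
  qed
  also have "\<dots> = (\<integral>\<^sup>+ r. \<integral>\<^sup>+ t. indicator N r \<partial>(lborel :: real measure) \<partial>lborel)"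
    by (subst nn_integral_complex) auto
  also have "\<dots> = (\<integral>\<^sup>+ r. 0 \<partial>(lborel :: real measure))"
    using AE_not_in[OF N(1)] by (intro nn_integral_cong_AE) auto
  also have "\<dots> = 0" by simp
  finally have "{w. Re w \<in> N} \<in> null_sets lborel" by (intro null_setsI) auto
  then have "negligible {w. Re w \<in> N}" by (simp add: negligible_iff_null_sets null_sets_completionI)
  then have "negligible ((\<lambda>w. polar z\<^sub>0 (Re w) (Im w)) ` {w. Re w \<in> N})"
    by (rule negligible_differentiable_image_negligible[rotated])
       (auto simp: differentiable_on_def differentiable_def intro!: exI has_derivative_polar)
  moreover have "{z. cmod (z - z\<^sub>0) \<in> N} \<subseteq> (\<lambda>w. polar z\<^sub>0 (Re w) (Im w)) ` {w. Re w \<in> N}"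
  proof
    fix z assume "z \<in> {z. cmod (z - z\<^sub>0) \<in> N}"
    moreover have "z = polar z\<^sub>0 (cmod (z - z\<^sub>0)) (Arg (z - z\<^sub>0))"
      using rcis_cmod_Arg[of "z - z\<^sub>0"] by (simp add: polar_def rcis_def)
    ultimately show "z \<in> (\<lambda>w. polar z\<^sub>0 (Re w) (Im w)) ` {w. Re w \<in> N}"
      by (intro image_eqI[of _ _ "Complex (cmod (z - z\<^sub>0)) (Arg (z - z\<^sub>0))"]) auto
  qed
  ultimately have "negligible {z. cmod (z - z\<^sub>0) \<in> N}" by (rule negligible_subset)
  then have "{z. cmod (z - z\<^sub>0) \<in> N} \<in> null_sets lebesgue" by (simp add: negligible_iff_null_sets)
  moreover have "{z. cmod (z - z\<^sub>0) \<in> N} \<in> sets lborel" by measurable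
  ultimately show ?thesis by (simp add: null_sets_completion_iff)
qed

section \<open>Borel sets are Hausdorff measurable\<close>

lemma hausdorff1_delta_antimono:
  "\<delta> \<le> \<delta>' \<Longrightarrow> hausdorff1_delta \<delta>' A \<le> hausdorff1_delta \<delta> A"
  unfolding hausdorff1_delta_def by (rule INF_superset_mono) (auto intro: order_trans)

lemma hausdorff1_outer_mono: "A \<subseteq> B \<Longrightarrow> hausdorff1_outer A \<le> hausdorff1_outer B"
  unfolding hausdorff1_outer_def by (intro SUP_mono') (rule hausdorff1_delta_mono)

lemma hausdorff1_outer_empty [simp]: "hausdorff1_outer {} = 0"
  using outer_measure_space_hausdorff1 by (simp add: outer_measure_space_def positive_def)

lemma hausdorff1_outer_UN: "hausdorff1_outer (\<Union>i. A i) \<le> (\<Sum>i::nat. hausdorff1_outer (A i))"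
proof -
  have "hausdorff1_delta \<delta> (\<Union>i. A i) \<le> (\<Sum>i::nat. hausdorff1_outer (A i))" if "0 < \<delta>" for \<delta>
  proof -
    have "hausdorff1_delta \<delta> (A i) \<le> hausdorff1_outer (A i)" for i
      unfolding hausdorff1_outer_def using that by (intro SUP_upper) auto
    then show ?thesis
      by (intro order_trans[OF hausdorff1_delta_subadditive] suminf_le) auto
  qed
  then show ?thesis unfolding hausdorff1_outer_def[of "\<Union>i. A i"] by (intro SUP_least) auto
qed

lemma hausdorff1_outer_Un: "hausdorff1_outer (A \<union> B) \<le> hausdorff1_outer A + hausdorff1_outer B"
proof -
  have "A \<union> B = (\<Union>i. (\<lambda>i::nat. if i = 0 then A else if i = 1 then B else {}) i)"
    by (auto split: if_splits intro: exI[of _ 0] exI[of _ 1])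
  also have "hausdorff1_outer \<dots> \<le> (\<Sum>i. hausdorff1_outer ((\<lambda>i::nat. if i = 0 then A else if i = 1 then B else {}) i))"
    by (rule hausdorff1_outer_UN)
  also have "\<dots> = (\<Sum>i<2. hausdorff1_outer ((\<lambda>i::nat. if i = 0 then A else if i = 1 then B else {}) i))"
    by (rule suminf_finite) auto
  finally show ?thesis by (simp add: numeral_2_eq_2)
qed

text \<open>Members of a covering that have diameter less than \<open>d\<close> cannot meet both sets. So the
  covering splits into the members that meet \<open>A\<close> and the others, which cover \<open>B\<close>.\<close>

lemma hausdorff1_outer_separated:
  assumes d: "0 < d" "\<And>a b. a \<in> A \<Longrightarrow> b \<in> B \<Longrightarrow> d \<le> dist a b"
  shows "hausdorff1_outer A + hausdorff1_outer B \<le> hausdorff1_outer (A \<union> B)"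
proof -
  have *: "hausdorff1_delta \<delta> A + hausdorff1_delta \<delta> B \<le> hausdorff1_delta \<delta> (A \<union> B)"
    if \<delta>: "0 < \<delta>" "\<delta> < d" for \<delta>
    unfolding hausdorff1_delta_def[of \<delta> "A \<union> B"]
  proof (rule INF_greatest, clarify)
    fix U :: "nat \<Rightarrow> complex set"
    assume cov: "A \<union> B \<subseteq> (\<Union>i. U i)" and U: "\<forall>i. bounded (U i) \<and> diameter (U i) \<le> \<delta>"
    \<comment> \<open>A member that misses \<open>A\<close> is replaced by the empty set, of diameter 0.\<close>
    define UA where "UA i = (if U i \<inter> A \<noteq> {} then U i else {})" for i
    define UB where "UB i = (if U i \<inter> A \<noteq> {} then {} else U i)" for i
    have "hausdorff1_delta \<delta> A \<le> (\<Sum>i. ennreal (diameter (UA i)))"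
      unfolding hausdorff1_delta_def
    proof (rule INF_lower, safe)
      fix x assume "x \<in> A"
      then obtain i where "x \<in> U i" using cov by auto
      then show "x \<in> \<Union> (range UA)" using \<open>x \<in> A\<close> by (auto simp: UA_def intro!: exI[of _ i])
    qed (use U \<delta> in \<open>auto simp: UA_def\<close>)
    moreover have "hausdorff1_delta \<delta> B \<le> (\<Sum>i. ennreal (diameter (UB i)))"
      unfolding hausdorff1_delta_def
    proof (rule INF_lower, safe)
      fix x assume "x \<in> B"
      then obtain i where i: "x \<in> U i" using cov by auto
      have "U i \<inter> A = {}"
      proof (rule ccontr)
        assume "U i \<inter> A \<noteq> {}"
        then obtain a where "a \<in> U i" "a \<in> A" by auto
        then have "dist a x \<le> diameter (U i)" using i U diameter_bounded_bound by blast
        moreover have "diameter (U i) \<le> \<delta>" using U by auto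
        ultimately show False using d(2)[OF \<open>a \<in> A\<close> \<open>x \<in> B\<close>] \<delta> by linarith
      qed
      then show "x \<in> \<Union> (range UB)" using i by (auto simp: UB_def intro!: exI[of _ i])
    qed (use U \<delta> in \<open>auto simp: UB_def\<close>)
    ultimately have "hausdorff1_delta \<delta> A + hausdorff1_delta \<delta> B
        \<le> (\<Sum>i. ennreal (diameter (UA i))) + (\<Sum>i. ennreal (diameter (UB i)))"
      by (rule add_mono)
    also have "\<dots> = (\<Sum>i. ennreal (diameter (UA i)) + ennreal (diameter (UB i)))"
      by (rule suminf_add) auto
    also have "\<dots> = (\<Sum>i. ennreal (diameter (U i)))"
      by (intro suminf_cong) (auto simp: UA_def UB_def)
    finally show "hausdorff1_delta \<delta> A + hausdorff1_delta \<delta> B \<le> (\<Sum>i. ennreal (diameter (U i)))" .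
  qed
  have "hausdorff1_delta \<delta>1 A + hausdorff1_delta \<delta>2 B \<le> hausdorff1_outer (A \<union> B)"
    if "0 < \<delta>1" "0 < \<delta>2" for \<delta>1 \<delta>2
  proof -
    \<comment> \<open>Smaller than \<open>d\<close> for the splitting, and below both given scales for monotonicity.\<close>
    define \<delta> where "\<delta> = min (min \<delta>1 \<delta>2) (d / 2)"
    have \<delta>: "0 < \<delta>" "\<delta> < d" "\<delta> \<le> \<delta>1" "\<delta> \<le> \<delta>2" using that d by (auto simp: \<delta>_def)
    have "hausdorff1_delta \<delta>1 A + hausdorff1_delta \<delta>2 B \<le> hausdorff1_delta \<delta> A + hausdorff1_delta \<delta> B"
      by (intro add_mono hausdorff1_delta_antimono \<delta>)
    also have "\<dots> \<le> hausdorff1_delta \<delta> (A \<union> B)" by (rule *[OF \<delta>(1,2)])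
    also have "\<dots> \<le> hausdorff1_outer (A \<union> B)"
      unfolding hausdorff1_outer_def using \<delta> by (intro SUP_upper) auto
    finally show ?thesis .
  qed
  then have "(SUP \<delta>1\<in>{0<..}. SUP \<delta>2\<in>{0<..}. hausdorff1_delta \<delta>1 A + hausdorff1_delta \<delta>2 B) \<le> hausdorff1_outer (A \<union> B)"
    by (intro SUP_least) auto
  moreover have "(SUP \<delta>1\<in>{0<..}. SUP \<delta>2\<in>{0<..}. hausdorff1_delta \<delta>1 A + hausdorff1_delta \<delta>2 B)
    = hausdorff1_outer A + hausdorff1_outer B"
    unfolding hausdorff1_outer_def
    by (subst ennreal_SUP_add_right[symmetric]) (auto simp: ennreal_SUP_add_left)
  ultimately show ?thesis by simp
qed

text \<open>Caratheodory's criterion for metric outer measures. The set \<open>A - C\<close> consists of \<open>A' n\<close>, which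
  stays away from \<open>C\<close>, and of the shells \<open>R i\<close> with \<open>n \<le> i\<close>. Shells whose indices have the same parity are
  separated, so the measures of all shells have a finite sum, whose tails are negligible.\<close>

lemma closed_in_hausdorff1:
  assumes C: "closed C"
  shows "C \<in> sets hausdorff1"
proof (cases "C = {}")
  case False
  have main: "hausdorff1_outer (A \<inter> C) + hausdorff1_outer (A - C) \<le> hausdorff1_outer A" for A
  proof (cases "hausdorff1_outer A = top")
    case fin: False
    define A' where "A' n = {x \<in> A. 1 / real (n + 1) \<le> infdist x C}" for n
    define R where "R n = {x \<in> A. 1 / real (n + 2) \<le> infdist x C \<and> infdist x C < 1 / real (n + 1)}" for n
    \<comment> \<open>Shells of the same parity are a positive distance apart.\<close>
    have R_sep: "hausdorff1_outer (\<Union>k<m. R (2 * k + e)) \<ge> (\<Sum>k<m. hausdorff1_outer (R (2 * k + e)))" for m e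
    proof (induction m)
      case (Suc m)
      have "(\<Sum>k<Suc m. hausdorff1_outer (R (2 * k + e)))
          \<le> hausdorff1_outer (\<Union>k<m. R (2 * k + e)) + hausdorff1_outer (R (2 * m + e))"
        using Suc by (simp add: add_right_mono)
      also have "\<dots> \<le> hausdorff1_outer ((\<Union>k<m. R (2 * k + e)) \<union> R (2 * m + e))"
      proof (cases "m = 0")
        case False
        show ?thesis
        proof (rule hausdorff1_outer_separated)
          show "0 < 1 / real (2 * m + e) - 1 / real (2 * m + e + 1)"
            using False divide_strict_left_mono[of "real (2 * m + e)" "real (2 * m + e + 1)" 1] by simp
          fix a b assume "a \<in> (\<Union>k<m. R (2 * k + e))" and b: "b \<in> R (2 * m + e)"
          then obtain k where k: "k < m" "a \<in> R (2 * k + e)" by auto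
          have "1 / real (2 * m + e) \<le> 1 / real (2 * k + e + 2)"
            using k by (intro divide_left_mono) auto
          also have "\<dots> \<le> infdist a C" using k by (simp add: R_def)
          also have "\<dots> \<le> infdist b C + dist a b" by (rule infdist_triangle)
          also have "infdist b C < 1 / real (2 * m + e + 1)" using b by (simp add: R_def)
          finally show "1 / real (2 * m + e) - 1 / real (2 * m + e + 1) \<le> dist a b" by simp
        qed
      qed simp
      also have "\<dots> = hausdorff1_outer (\<Union>k<Suc m. R (2 * k + e))"
        by (rule arg_cong[where f=hausdorff1_outer]) (auto simp: lessThan_Suc)
      finally show ?case .
    qed simp
    have R_le: "(\<Sum>k<m. hausdorff1_outer (R (2 * k + e))) \<le> hausdorff1_outer A" for m e
      by (rule order_trans[OF R_sep hausdorff1_outer_mono]) (auto simp: R_def)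
    have "(\<Sum>i<n. hausdorff1_outer (R i)) \<le> hausdorff1_outer A + hausdorff1_outer A" for n
    proof -
      have "(\<Sum>i<2*m. f i) = (\<Sum>k<m. f (2 * k + 0)) + (\<Sum>k<m. f (2 * k + 1))" for m and f :: "nat \<Rightarrow> ennreal"
        by (induction m) (simp_all add: algebra_simps)
      from this[of "\<lambda>i. hausdorff1_outer (R i)" n]
      have "(\<Sum>i<2*n. hausdorff1_outer (R i)) \<le> hausdorff1_outer A + hausdorff1_outer A"
        using add_mono[OF R_le[where m=n and e=0] R_le[where m=n and e=1]] by simp
      moreover have "(\<Sum>i<n. hausdorff1_outer (R i)) \<le> (\<Sum>i<2*n. hausdorff1_outer (R i))"
        by (rule sum_mono2) auto
      ultimately show ?thesis by (rule order_trans[rotated])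
    qed
    then have S_le: "(\<Sum>i. hausdorff1_outer (R i)) \<le> hausdorff1_outer A + hausdorff1_outer A"
      by (intro suminf_le_const) auto
    then have S_fin: "(\<Sum>i. hausdorff1_outer (R i)) < top"
      using fin by (auto simp: less_top[symmetric] top_unique)
    have "hausdorff1_outer (A \<inter> C) + hausdorff1_outer (A - C) + (\<Sum>i<n. hausdorff1_outer (R i))
       \<le> hausdorff1_outer A + (\<Sum>i. hausdorff1_outer (R i))" for n
    proof -
      have sub: "A - C \<subseteq> A' n \<union> (\<Union>i. R (i + n))"
      proof
        fix x assume x: "x \<in> A - C"
        then have pos: "0 < infdist x C"
          using C False by (metis DiffD2 in_closed_iff_infdist_zero infdist_nonneg less_eq_real_def)
        show "x \<in> A' n \<union> (\<Union>i. R (i + n))"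
        proof (cases "1 / real (n + 1) \<le> infdist x C")
          case ge: False
          define P where "P k \<longleftrightarrow> 1 / real (k + 1) \<le> infdist x C" for k
          obtain k0 where "inverse (real (Suc k0)) < infdist x C" using reals_Archimedean[OF pos] by blast
          then have "P k0" by (simp add: P_def inverse_eq_divide)
          define k where "k = (LEAST k. P k)"
          have Pk: "P k" unfolding k_def using \<open>P k0\<close> by (rule LeastI)
          have "\<not> P n" using ge by (simp add: P_def)
          have "n < k"
          proof (rule ccontr)
            assume "\<not> n < k"
            then have "1 / real (n + 1) \<le> 1 / real (k + 1)" by (intro divide_left_mono) auto
            then show False using Pk \<open>\<not> P n\<close> by (simp add: P_def)
          qed
          have "\<not> P (k - 1)" unfolding k_def using \<open>n < k\<close> not_less_Least[of "k - 1" P] by (simp add: k_def)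
          then have "x \<in> R (k - 1)" using Pk \<open>n < k\<close> x by (auto simp: R_def P_def of_nat_diff)
          moreover have "k - 1 = (k - 1 - n) + n" using \<open>n < k\<close> by simp
          ultimately show ?thesis by (metis UN_I UNIV_I UnCI)
        qed (use x in \<open>auto simp: A'_def\<close>)
      qed
      have "hausdorff1_outer (A - C) \<le> hausdorff1_outer (A' n) + hausdorff1_outer (\<Union>i. R (i + n))"
        by (rule order_trans[OF hausdorff1_outer_mono[OF sub] hausdorff1_outer_Un])
      also have "\<dots> \<le> hausdorff1_outer (A' n) + (\<Sum>i. hausdorff1_outer (R (i + n)))"
        by (intro add_left_mono hausdorff1_outer_UN)
      finally have 1: "hausdorff1_outer (A - C) \<le> hausdorff1_outer (A' n) + (\<Sum>i. hausdorff1_outer (R (i + n)))" .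
      have "hausdorff1_outer (A \<inter> C) + hausdorff1_outer (A' n) \<le> hausdorff1_outer (A \<inter> C \<union> A' n)"
      proof (rule hausdorff1_outer_separated)
        show "0 < 1 / real (n + 1)" by simp
        fix a b assume "a \<in> A \<inter> C" "b \<in> A' n"
        then show "1 / real (n + 1) \<le> dist a b"
          using infdist_le[of a C b] by (auto simp: A'_def dist_commute)
      qed
      also have "\<dots> \<le> hausdorff1_outer A" by (rule hausdorff1_outer_mono) (auto simp: A'_def)
      finally have 2: "hausdorff1_outer (A \<inter> C) + hausdorff1_outer (A' n) \<le> hausdorff1_outer A" .
      have 3: "(\<Sum>i. hausdorff1_outer (R i)) = (\<Sum>i. hausdorff1_outer (R (i + n))) + (\<Sum>i<n. hausdorff1_outer (R i))"
        by (rule suminf_offset) auto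
      have "hausdorff1_outer (A \<inter> C) + hausdorff1_outer (A - C) + (\<Sum>i<n. hausdorff1_outer (R i))
         \<le> hausdorff1_outer (A \<inter> C) + (hausdorff1_outer (A' n) + (\<Sum>i. hausdorff1_outer (R (i + n)))) + (\<Sum>i<n. hausdorff1_outer (R i))"
        by (intro add_mono 1 order_refl)
      also have "\<dots> = (hausdorff1_outer (A \<inter> C) + hausdorff1_outer (A' n)) + (\<Sum>i. hausdorff1_outer (R i))"
        unfolding 3 by (simp add: add_ac)
      also have "\<dots> \<le> hausdorff1_outer A + (\<Sum>i. hausdorff1_outer (R i))"
        by (intro add_mono 2 order_refl)
      finally show ?thesis .
    qed
    then have "(SUP n. hausdorff1_outer (A \<inter> C) + hausdorff1_outer (A - C) + (\<Sum>i<n. hausdorff1_outer (R i)))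
       \<le> hausdorff1_outer A + (\<Sum>i. hausdorff1_outer (R i))"
      by (intro SUP_least)
    then have "(hausdorff1_outer (A \<inter> C) + hausdorff1_outer (A - C)) + (\<Sum>i. hausdorff1_outer (R i))
       \<le> hausdorff1_outer A + (\<Sum>i. hausdorff1_outer (R i))"
      by (subst (asm) ennreal_SUP_add_right[symmetric]) (auto simp: suminf_eq_SUP)
    then show ?thesis
      using S_fin by (auto simp: ennreal_add_left_cancel_le add.commute[of _ "suminf _"])
  qed simp
  show ?thesis
    unfolding sets_hausdorff1 lambda_system_def
  proof (safe)
    fix A :: "complex set"
    have "A = (C \<inter> A) \<union> ((UNIV - C) \<inter> A)" by auto
    then have "hausdorff1_outer A \<le> hausdorff1_outer (C \<inter> A) + hausdorff1_outer ((UNIV - C) \<inter> A)"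
      using hausdorff1_outer_Un by metis
    moreover have "C \<inter> A = A \<inter> C" "(UNIV - C) \<inter> A = A - C" by auto
    ultimately show "hausdorff1_outer (C \<inter> A) + hausdorff1_outer ((UNIV - C) \<inter> A) = hausdorff1_outer A"
      using main[of A] by (auto intro: antisym)
  qed auto
qed simp

lemma borel_sets_hausdorff1: "A \<in> sets borel \<Longrightarrow> A \<in> sets hausdorff1"
proof -
  have "sigma_sets UNIV (Collect closed) \<subseteq> sets hausdorff1"
    using sets.sigma_sets_subset[of "Collect closed" hausdorff1] closed_in_hausdorff1 by auto
  then show "A \<in> sets borel \<Longrightarrow> A \<in> sets hausdorff1"
    unfolding borel_eq_closed by (auto simp: sets_measure_of)
qed

lemma measurable_hausdorff1: "f \<in> borel_measurable borel \<Longrightarrow> f \<in> borel_measurable hausdorff1"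
  by (auto simp: measurable_def borel_sets_hausdorff1)

section \<open>The area inequality for curves\<close>

text \<open>The measure with density \<open>h\<close> is outer regular, so \<open>E\<close> has an open
  neighbourhood \<open>U\<close> of hardly larger mass. Cover \<open>E\<close> by non-overlapping intervals in \<open>U\<close> that are so short that
  their images have diameter at most \<open>\<delta>\<close>. The diameter of each image is at most the mass of the interval.\<close>

lemma hausdorff1_outer_image_le_compact:
  fixes \<gamma> :: "real \<Rightarrow> complex" and h :: "real \<Rightarrow> ennreal"
  assumes ab: "a < b" and cont: "continuous_on {a..b} \<gamma>" and h[measurable]: "h \<in> borel_measurable borel"
    and fin: "(\<integral>\<^sup>+ t\<in>{a..b}. h t \<partial>lborel) < \<infinity>"
    and bd: "\<And>s t. a \<le> s \<Longrightarrow> s \<le> t \<Longrightarrow> t \<le> b \<Longrightarrow> ennreal (dist (\<gamma> s) (\<gamma> t)) \<le> (\<integral>\<^sup>+ x\<in>{s..t}. h x \<partial>lborel)"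
    and E[measurable]: "E \<in> sets borel" and Eab: "E \<subseteq> {a..b}"
  shows "hausdorff1_outer (\<gamma> ` E) \<le> (\<integral>\<^sup>+ t\<in>E. h t \<partial>lborel)"
proof (rule ennreal_le_epsilon)
  fix e :: real assume e: "0 < e"
  define M where "M = density lborel (\<lambda>t. h t * indicator {a..b} t)"
  have sM: "sets M = sets borel" by (simp add: M_def)
  have Mfin: "emeasure M (space M) \<noteq> \<infinity>"
    using fin by (simp add: M_def emeasure_density)
  have ME: "emeasure M E = (\<integral>\<^sup>+ t\<in>E. h t \<partial>lborel)"
    unfolding M_def using Eab by (subst emeasure_density) (auto intro!: nn_integral_cong simp: indicator_def)
  have MEfin: "emeasure M E < top"
    using Mfin emeasure_mono[of E "space M" M] by (simp add: sM M_def less_top top_unique)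
  have "(INF U\<in>{U. E \<subseteq> U \<and> open U}. emeasure M U) < emeasure M E + e"
  proof -
    have "emeasure M E < emeasure M E + e"
      using MEfin e ennreal_add_left_cancel_less[of "emeasure M E" 0 "ennreal e"] by simp
    then show ?thesis by (subst outer_regular[OF sM Mfin E, symmetric])
  qed
  then obtain U where U: "E \<subseteq> U" "open U" "emeasure M U < emeasure M E + e"
    by (auto simp: INF_less_iff)
  have "hausdorff1_delta \<delta> (\<gamma> ` E) \<le> emeasure M U" if \<delta>: "0 < \<delta>" for \<delta>
  proof -
    have "uniformly_continuous_on {a..b} \<gamma>"
      by (rule compact_uniformly_continuous[OF cont]) auto
    then obtain d where d: "0 < d" "\<And>s t. s \<in> {a..b} \<Longrightarrow> t \<in> {a..b} \<Longrightarrow> dist t s < d \<Longrightarrow> dist (\<gamma> t) (\<gamma> s) < \<delta>"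
      using \<delta> unfolding uniformly_continuous_on_def by metis
    \<comment> \<open>The gauge keeps intervals around points of \<open>E\<close> inside \<open>U\<close> and shorter than the modulus of continuity; elsewhere it is arbitrary.\<close>
    define g where "g x = (if x \<in> U then U \<inter> ball x (d / 2) else ball x 1)" for x
    have gauge: "gauge g" using U d by (auto simp: gauge_def g_def)
    obtain \<D> where D: "countable \<D>" "\<Union>\<D> \<subseteq> cbox a b"
      "\<And>K. K \<in> \<D> \<Longrightarrow> interior K \<noteq> {} \<and> (\<exists>c d. K = cbox c d)"
      "pairwise (\<lambda>A B. interior A \<inter> interior B = {}) \<D>"
      "\<And>K. K \<in> \<D> \<Longrightarrow> \<exists>x \<in> E \<inter> K. K \<subseteq> g x" "E \<subseteq> \<Union>\<D>"
      using covering_lemma[of E a b g] Eab ab gauge by (metis box_real(1) cbox_interval greaterThanLessThan_empty_iff not_less)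
    define F where "F i = (if i \<in> to_nat_on \<D> ` \<D> then from_nat_into \<D> i else {})" for i
    have F_cases: "F i = {} \<or> F i \<in> \<D>" for i
      unfolding F_def using D(1) by (auto simp: from_nat_into_to_nat_on)
    have UF: "\<Union>\<D> = (\<Union>i. F i)"
    proof
      show "\<Union>\<D> \<subseteq> (\<Union>i. F i)"
      proof
        fix x assume "x \<in> \<Union>\<D>"
        then obtain K where "K \<in> \<D>" "x \<in> K" by auto
        then have "x \<in> F (to_nat_on \<D> K)" using D(1) by (simp add: F_def)
        then show "x \<in> (\<Union>i. F i)" by blast
      qed
      show "(\<Union>i. F i) \<subseteq> \<Union>\<D>" using F_cases by fastforce
    qed
    have Fd: "disjoint_family (\<lambda>i. interior (F i))"
    proof (unfold disjoint_family_on_def, intro ballI impI)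
      fix i j :: nat assume "i \<noteq> j"
      show "interior (F i) \<inter> interior (F j) = {}"
      proof (cases "F i = {} \<or> F j = {}")
        case False
        then have i: "i \<in> to_nat_on \<D> ` \<D>" "j \<in> to_nat_on \<D> ` \<D>" by (auto simp: F_def split: if_splits)
        then have "F i \<in> \<D>" "F j \<in> \<D>" using F_cases False by auto
        moreover have "F i \<noteq> F j" using i \<open>i \<noteq> j\<close> D(1) by (auto simp: F_def)
        ultimately show ?thesis using D(4) by (auto simp: pairwise_def)
      qed auto
    qed
    have Fi: "ennreal (diameter (\<gamma> ` F i)) \<le> emeasure M (interior (F i)) \<and> bounded (\<gamma> ` F i) \<and> diameter (\<gamma> ` F i) \<le> \<delta>" for i
    proof (cases "F i = {}")
      case False
      then have FD: "F i \<in> \<D>" using F_cases by auto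
      obtain c d' where cd: "F i = {c..d'}" using D(3)[OF FD] by auto
      then have le: "c \<le> d'" using False by auto
      have "F i \<subseteq> {a..b}" using D(2) FD unfolding cbox_interval by blast
      then have sub: "{c..d'} \<subseteq> {a..b}" unfolding cd .
      obtain x where x: "x \<in> E" "x \<in> F i" "F i \<subseteq> g x" using D(5)[OF FD] by auto
      have "x \<in> U" using x U by auto
      then have g: "F i \<subseteq> U \<inter> ball x (d / 2)" using x(3) by (simp add: g_def)
      have bd': "bounded (\<gamma> ` F i)" unfolding cd
        by (intro compact_imp_bounded compact_continuous_image continuous_on_subset[OF cont sub]) auto
      have dia: "dist (\<gamma> s) (\<gamma> t) \<le> \<delta>" if "s \<in> F i" "t \<in> F i" for s t
      proof -
        have "dist x s < d / 2" "dist x t < d / 2" using g that by auto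
        then have "dist s t < d" using dist_triangle_half_r by blast
        then show ?thesis using d(2)[of t s] that sub cd by auto
      qed
      define I where "I = (\<integral>\<^sup>+ x\<in>{c..d'}. h x \<partial>lborel)"
      have "I \<le> (\<integral>\<^sup>+ t\<in>{a..b}. h t \<partial>lborel)"
        unfolding I_def using sub by (intro nn_integral_mono) (auto simp: indicator_def)
      then have Ifin: "I < top" using fin by auto
      have "dist (\<gamma> s) (\<gamma> t) \<le> enn2real I" if "s \<in> F i" "t \<in> F i" for s t
      proof -
        have *: "ennreal (dist (\<gamma> s) (\<gamma> t)) \<le> I" if "s \<in> F i" "t \<in> F i" "s \<le> t" for s t
        proof -
          have "ennreal (dist (\<gamma> s) (\<gamma> t)) \<le> (\<integral>\<^sup>+ x\<in>{s..t}. h x \<partial>lborel)"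
            using that sub cd by (intro bd) auto
          also have "\<dots> \<le> I" unfolding I_def using that cd by (intro nn_integral_mono) (auto simp: indicator_def)
          finally show ?thesis .
        qed
        then have "ennreal (dist (\<gamma> s) (\<gamma> t)) \<le> I"
          using that by (metis dist_commute linear)
        then show ?thesis using Ifin by (metis enn2real_ennreal enn2real_mono zero_le_dist)
      qed
      then have "diameter (\<gamma> ` F i) \<le> enn2real I"
        using False by (intro diameter_le) (auto simp: dist_norm)
      then have "ennreal (diameter (\<gamma> ` F i)) \<le> I"
        using Ifin by (metis ennreal_enn2real ennreal_leI)
      also have "I = emeasure M (interior (F i))"
      proof -
        have "emeasure M (interior (F i)) = (\<integral>\<^sup>+ x. (h x * indicator {a..b} x) * indicator {c<..<d'} x \<partial>lborel)"
          unfolding M_def cd interior_atLeastAtMost_real by (rule emeasure_density) auto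
        also have "\<dots> = I" unfolding I_def
          using AE_lborel_singleton[of c] AE_lborel_singleton[of d'] sub
          by (intro nn_integral_cong_AE) (auto simp: indicator_def)
        finally show ?thesis ..
      qed
      finally show ?thesis
        using bd' dia False by (auto intro!: diameter_le simp: dist_norm)
    qed (use \<delta> in auto)
    have "hausdorff1_delta \<delta> (\<gamma> ` E) \<le> (\<Sum>i. ennreal (diameter (\<gamma> ` F i)))"
      unfolding hausdorff1_delta_def
    proof (rule INF_lower, safe)
      fix x assume "x \<in> E"
      then have "x \<in> (\<Union>i. F i)" using D(6) UF by auto
      then show "\<gamma> x \<in> (\<Union>i. \<gamma> ` F i)" by auto
    qed (use Fi in auto)
    also have "\<dots> \<le> (\<Sum>i. emeasure M (interior (F i)))"
      using Fi by (intro suminf_le) auto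
    also have "\<dots> = emeasure M (\<Union>i. interior (F i))"
      by (rule suminf_emeasure) (use Fd in \<open>auto simp: sM\<close>)
    also have "\<dots> \<le> emeasure M U"
    proof (rule emeasure_mono)
      show "(\<Union>i. interior (F i)) \<subseteq> U"
      proof (rule UN_least)
        fix i show "interior (F i) \<subseteq> U"
        proof (cases "F i = {}")
          case False
          then have "F i \<in> \<D>" using F_cases by auto
          then obtain x where "x \<in> E" "F i \<subseteq> g x" using D(5) by blast
          then have "F i \<subseteq> U" using U(1) by (auto simp: g_def split: if_splits)
          then show ?thesis using interior_subset by blast
        qed auto
      qed
    qed (use U in \<open>auto simp: sM\<close>)
    finally show ?thesis .
  qed
  then have "hausdorff1_outer (\<gamma> ` E) \<le> emeasure M U"
    unfolding hausdorff1_outer_def by (intro SUP_least) auto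
  also have "\<dots> \<le> (\<integral>\<^sup>+ t\<in>E. h t \<partial>lborel) + e" using U(3) unfolding ME by simp
  finally show "hausdorff1_outer (\<gamma> ` E) \<le> (\<integral>\<^sup>+ t\<in>E. h t \<partial>lborel) + e" .
qed

text \<open>An enumeration of the compact intervals in \<open>V\<close> with rational endpoints, padded with empty
  sets. An open set is their union, which makes it a countable union of compact intervals.\<close>

definition rat_interval :: "real set \<Rightarrow> nat \<Rightarrow> real set" where
  "rat_interval V n = (case from_nat n of (p :: rat, q :: rat) \<Rightarrow>
     if p < q \<and> {of_rat p..of_rat q} \<subseteq> V then {of_rat p..of_rat q} else {})"

lemma rat_interval_cases:
  obtains "rat_interval V n = {}" | a b where "a < b" "rat_interval V n = {a..b}" "{a..b} \<subseteq> V"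
proof -
  obtain p q :: rat where pq: "from_nat n = (p, q)" by (metis surj_pair)
  show thesis
  proof (cases "p < q \<and> {of_rat p..of_rat q} \<subseteq> V")
    case True
    then show thesis using that(2)[of "of_rat p" "of_rat q"] by (auto simp: rat_interval_def pq of_rat_less)
  next
    case False
    show thesis by (rule that(1)) (unfold rat_interval_def pq prod.case if_not_P[OF False], rule refl)
  qed
qed

lemma compact_rat_interval: "compact (rat_interval V n)"
  by (rule rat_interval_cases[of V n]) auto

lemma UN_rat_interval:
  assumes "open V"
  shows "(\<Union>n. rat_interval V n) = V"
proof
  show "(\<Union>n. rat_interval V n) \<subseteq> V"
    by (rule UN_least, rule rat_interval_cases) auto
  show "V \<subseteq> (\<Union>n. rat_interval V n)"
  proof
    fix x assume "x \<in> V"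
    then obtain e where e: "0 < e" "ball x e \<subseteq> V" using assms open_contains_ball by blast
    obtain p where p: "x - e < of_rat p" "of_rat p < x" using of_rat_dense[of "x - e" x] e by auto
    obtain q where q: "x < of_rat q" "of_rat q < x + e" using of_rat_dense[of x "x + e"] e by auto
    have "(of_rat p :: real) < of_rat q" using p q by linarith
    moreover have "{of_rat p..of_rat q} \<subseteq> V" using e p q by (auto simp: dist_real_def subset_iff)
    ultimately have "x \<in> rat_interval V (to_nat (p, q))"
      using p q by (simp add: rat_interval_def of_rat_less)
    then show "x \<in> (\<Union>n. rat_interval V n)" by blast
  qed
qed

text \<open>The set \<open>E\<close> is the disjoint union of countably many Borel pieces, each inside a compact
  interval in \<open>V\<close>.\<close>

lemma hausdorff1_outer_image_le:
  fixes \<gamma> :: "real \<Rightarrow> complex" and h :: "real \<Rightarrow> ennreal"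
  assumes V: "open V" and cont: "continuous_on V \<gamma>" and h[measurable]: "h \<in> borel_measurable borel"
    and fin: "\<And>a b. a < b \<Longrightarrow> {a..b} \<subseteq> V \<Longrightarrow> (\<integral>\<^sup>+ t\<in>{a..b}. h t \<partial>lborel) < \<infinity>"
    and bd: "\<And>s t. s \<le> t \<Longrightarrow> {s..t} \<subseteq> V \<Longrightarrow> ennreal (dist (\<gamma> s) (\<gamma> t)) \<le> (\<integral>\<^sup>+ x\<in>{s..t}. h x \<partial>lborel)"
    and E[measurable]: "E \<in> sets borel" and EV: "E \<subseteq> V"
  shows "hausdorff1_outer (\<gamma> ` E) \<le> (\<integral>\<^sup>+ t\<in>E. h t \<partial>lborel)"
proof -
  define P where "P n = E \<inter> disjointed (rat_interval V) n" for n
  have ri[measurable]: "rat_interval V n \<in> sets borel" for n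
    using compact_rat_interval borel_compact by blast
  have P[measurable]: "P n \<in> sets borel" for n
    unfolding P_def disjointed_def by measurable
  have Pd: "disjoint_family P"
    using disjoint_family_disjointed[of "rat_interval V"] by (auto simp: P_def disjoint_family_on_def)
  have UP: "(\<Union>n. P n) = E"
    using EV UN_rat_interval[OF V] by (auto simp: P_def UN_disjointed_eq simp flip: Int_UN_distrib)
  have P_le: "hausdorff1_outer (\<gamma> ` P n) \<le> (\<integral>\<^sup>+ t\<in>P n. h t \<partial>lborel)" for n
  proof (cases rule: rat_interval_cases[of V n])
    case 1
    then have "P n = {}" using disjointed_subset[of "rat_interval V" n] by (auto simp: P_def)
    then show ?thesis by simp
  next
    case (2 a b)
    show ?thesis
    proof (rule hausdorff1_outer_image_le_compact[OF \<open>a < b\<close>])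
      show "P n \<subseteq> {a..b}" using disjointed_subset[of "rat_interval V" n] 2 by (auto simp: P_def)
      show "ennreal (dist (\<gamma> s) (\<gamma> t)) \<le> (\<integral>\<^sup>+ x\<in>{s..t}. h x \<partial>lborel)" if "a \<le> s" "s \<le> t" "t \<le> b" for s t
        using 2 that by (intro bd) auto
    qed (use 2 fin cont in \<open>auto intro: continuous_on_subset\<close>)
  qed
  have "hausdorff1_outer (\<gamma> ` E) = hausdorff1_outer (\<Union>n. \<gamma> ` P n)"
    unfolding UP[symmetric] by (simp add: image_UN)
  also have "\<dots> \<le> (\<Sum>n. hausdorff1_outer (\<gamma> ` P n))" by (rule hausdorff1_outer_UN)
  also have "\<dots> \<le> (\<Sum>n. \<integral>\<^sup>+ t\<in>P n. h t \<partial>lborel)" by (intro suminf_le P_le) auto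
  also have "\<dots> = (\<integral>\<^sup>+ t\<in>(\<Union>n. P n). h t \<partial>lborel)"
    by (rule nn_integral_disjoint_family[symmetric, OF _ _ Pd]) auto
  finally show ?thesis unfolding UP .
qed

text \<open>The part of \<open>V\<close> in a half-open cell of length \<open>1 / k\<close>. The cells are numbered by integers, and
  these by natural numbers, so that the pieces form a sequence.\<close>

definition grid_piece :: "real set \<Rightarrow> nat \<Rightarrow> nat \<Rightarrow> real set" where
  "grid_piece V k n = V \<inter> {t. \<lfloor>t * real k\<rfloor> = int_decode n}"

text \<open>Half-open intervals and open sets are countable unions of compact sets; hence so is the
  piece, and so is its continuous image.\<close>

lemma borel_image_grid_piece:
  fixes \<gamma> :: "real \<Rightarrow> complex"
  assumes V: "open V" and cont: "continuous_on V \<gamma>" and k: "0 < k"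
  shows "\<gamma> ` grid_piece V k n \<in> sets borel"
proof -
  define a where "a = of_int (int_decode n) / real k"
  define b where "b = (of_int (int_decode n) + 1) / real k"
  have J: "{t. \<lfloor>t * real k\<rfloor> = int_decode n} = (\<Union>m. {a..b - 1 / real (Suc m)})"
  proof -
    have "{t. \<lfloor>t * real k\<rfloor> = int_decode n} = {a..<b}"
      using k by (auto simp: a_def b_def floor_eq_iff field_simps)
    also have "\<dots> = (\<Union>m. {a..b - 1 / real (Suc m)})"
    proof
      show "{a..<b} \<subseteq> (\<Union>m. {a..b - 1 / real (Suc m)})"
      proof
        fix x assume x: "x \<in> {a..<b}"
        then obtain m where "inverse (real (Suc m)) < b - x" using reals_Archimedean[of "b - x"] by auto
        then show "x \<in> (\<Union>m. {a..b - 1 / real (Suc m)})"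
          using x by (auto simp: inverse_eq_divide intro!: exI[of _ m])
      qed
      show "(\<Union>m. {a..b - 1 / real (Suc m)}) \<subseteq> {a..<b}"
      proof (rule UN_least, rule subsetI)
        fix m x assume "x \<in> {a..b - 1 / real (Suc m)}"
        moreover have "0 < 1 / real (Suc m)" by simp
        ultimately have "a \<le> x" "x < b" by (simp_all only: atLeastAtMost_iff, linarith+)
        then show "x \<in> {a..<b}" by simp
      qed
    qed
    finally show ?thesis .
  qed
  have "grid_piece V k n = (\<Union>i. rat_interval V i) \<inter> (\<Union>m. {a..b - 1 / real (Suc m)})"
    unfolding grid_piece_def J UN_rat_interval[OF V] ..
  also have "\<dots> = (\<Union>i. \<Union>m. rat_interval V i \<inter> {a..b - 1 / real (Suc m)})" by blast
  finally have eq: "\<gamma> ` grid_piece V k n = (\<Union>i. \<Union>m. \<gamma> ` (rat_interval V i \<inter> {a..b - 1 / real (Suc m)}))"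
    by (simp only: image_UN)
  have "compact (\<gamma> ` (rat_interval V i \<inter> {a..b - 1 / real (Suc m)}))" for i m
    using UN_rat_interval[OF V]
    by (intro compact_continuous_image continuous_on_subset[OF cont] compact_Int compact_rat_interval) auto
  then have "\<gamma> ` (rat_interval V i \<inter> {a..b - 1 / real (Suc m)}) \<in> sets borel" for i m
    by (rule borel_compact)
  then show ?thesis unfolding eq by (intro sets.countable_UN) auto
qed

lemma borel_grid_piece [measurable]: "open V \<Longrightarrow> grid_piece V k n \<in> sets borel"
  unfolding grid_piece_def by (rule sets.Int[OF borel_open]) measurable

lemma disjoint_family_grid_piece: "disjoint_family (grid_piece V k)"
  by (auto simp: disjoint_family_on_def grid_piece_def) (metis int_decode_eq)

lemma UN_grid_piece: "(\<Union>n. grid_piece V k n) = V"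
  by (auto simp: grid_piece_def) (metis int_encode_inverse)

text \<open>Both integrals integrate \<open>\<rho>\<close> against a Borel measure: Hausdorff measure on
  \<open>C\<close>, and the push-forward of \<open>h dt\<close> under \<open>\<gamma>\<close>. An inequality between the measures of Borel sets passes to the
  integrals. The relation \<open>R\<close> covers upper bounds (for curves) and lower bounds (for arc length) at once.\<close>

lemma nn_integral_mono_distr_hausdorff1:
  fixes \<gamma> :: "real \<Rightarrow> complex"
  assumes J: "J \<in> sets borel" and \<gamma>: "(\<lambda>t. indicator J t *\<^sub>R \<gamma> t) \<in> borel_measurable borel"
    and h[measurable]: "h \<in> borel_measurable borel" and C: "C \<in> sets borel"
    and \<rho>: "\<rho> \<in> borel_measurable borel"
    and R: "R = (\<le>) \<or> R = (\<ge>)"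
    and le: "\<And>B. B \<in> sets borel \<Longrightarrow> R (hausdorff1_outer (B \<inter> C)) (\<integral>\<^sup>+ t\<in>{t \<in> J. \<gamma> t \<in> B}. h t \<partial>lborel)"
  shows "R (\<integral>\<^sup>+ y\<in>C. \<rho> y \<partial>hausdorff1) (\<integral>\<^sup>+ t\<in>J. \<rho> (\<gamma> t) * h t \<partial>lborel)"
proof -
  define \<psi> where "\<psi> t = indicator J t *\<^sub>R \<gamma> t" for t
  note J[measurable] C[measurable] \<rho>[measurable]
  have m[measurable]: "\<psi> \<in> borel_measurable borel" using \<gamma> by (simp add: \<psi>_def[abs_def])
  define M1 where "M1 = distr (density hausdorff1 (indicator C)) borel (\<lambda>x. x)"
  define M2 where "M2 = distr (density lborel (\<lambda>t. h t * indicator J t)) borel \<psi>"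
  have Ch: "C \<in> sets hausdorff1" using C by (rule borel_sets_hausdorff1)
  have idm: "(\<lambda>x. x) \<in> measurable (density hausdorff1 (indicator C)) borel"
    using measurable_hausdorff1[of "\<lambda>x. x"] by simp
  have M1: "emeasure M1 B = hausdorff1_outer (B \<inter> C)" if B: "B \<in> sets borel" for B
  proof -
    have "emeasure M1 B = emeasure (density hausdorff1 (indicator C)) B"
      unfolding M1_def by (subst emeasure_distr[OF idm B]) simp
    also have "\<dots> = (\<integral>\<^sup>+ x. indicator C x * indicator B x \<partial>hausdorff1)"
      by (rule emeasure_density) (use Ch borel_sets_hausdorff1[OF B] in auto)
    also have "\<dots> = (\<integral>\<^sup>+ x. indicator (B \<inter> C) x \<partial>hausdorff1)"
      by (intro nn_integral_cong) (auto simp: indicator_def)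
    also have "\<dots> = emeasure hausdorff1 (B \<inter> C)"
      by (rule nn_integral_indicator) (use Ch borel_sets_hausdorff1[OF B] in auto)
    also have "\<dots> = hausdorff1_outer (B \<inter> C)"
      by (rule emeasure_hausdorff1) (use Ch borel_sets_hausdorff1[OF B] in auto)
    finally show ?thesis .
  qed
  have M2: "emeasure M2 B = (\<integral>\<^sup>+ t\<in>{t \<in> J. \<gamma> t \<in> B}. h t \<partial>lborel)" if B: "B \<in> sets borel" for B
  proof -
    have "emeasure M2 B = (\<integral>\<^sup>+ t\<in>\<psi> -` B. (h t * indicator J t) \<partial>lborel)"
      unfolding M2_def using measurable_sets[OF m B]
      by (subst emeasure_distr) (use B in \<open>auto simp: emeasure_density\<close>)
    also have "\<dots> = (\<integral>\<^sup>+ t\<in>{t \<in> J. \<gamma> t \<in> B}. h t \<partial>lborel)"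
      by (intro nn_integral_cong) (auto simp: \<psi>_def indicator_def)
    finally show ?thesis .
  qed
  have I1: "(\<integral>\<^sup>+ y\<in>C. \<rho> y \<partial>hausdorff1) = nn_integral M1 \<rho>"
    unfolding M1_def using Ch measurable_hausdorff1[OF \<rho>]
    by (subst nn_integral_distr[OF idm]) (auto simp: nn_integral_density mult_ac)
  have I2: "(\<integral>\<^sup>+ t\<in>J. \<rho> (\<gamma> t) * h t \<partial>lborel) = nn_integral M2 \<rho>"
  proof -
    have "(\<integral>\<^sup>+ t\<in>J. \<rho> (\<gamma> t) * h t \<partial>lborel) = (\<integral>\<^sup>+ t. (h t * indicator J t) * \<rho> (\<psi> t) \<partial>lborel)"
      by (intro nn_integral_cong) (auto simp: \<psi>_def indicator_def mult_ac)
    also have "\<dots> = nn_integral M2 \<rho>"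
      unfolding M2_def by (subst nn_integral_distr) (auto simp: nn_integral_density)
    finally show ?thesis .
  qed
  have sets: "sets M1 = sets M2" by (simp add: M1_def M2_def)
  have sb: "sets M1 = sets borel" "sets M2 = sets borel" by (simp_all add: M1_def M2_def)
  from R show ?thesis
  proof
    assume R: "R = (\<le>)"
    have "M1 \<le> M2" using le M1 M2 unfolding R by (subst le_measure[OF sets]) (auto simp: sb)
    then show ?thesis unfolding R I1 I2 by (intro nn_integral_mono_measure sets)
  next
    assume R: "R = (\<ge>)"
    have "M2 \<le> M1" using le M1 M2 unfolding R by (subst le_measure[OF sets[symmetric]]) (auto simp: sb)
    then show ?thesis unfolding R I1 I2 by (intro nn_integral_mono_measure sets[symmetric])
  qed
qed

text \<open>Finitely many preimages of \<open>y\<close> lie in distinct cells as soon as the grid is finer than the gaps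
  between them. So the number of pieces whose image contains \<open>y\<close> eventually reaches every finite lower bound for the
  multiplicity.\<close>

lemma multiplicity_pieces:
  fixes \<gamma> :: "real \<Rightarrow> complex" and c :: ennreal
  shows "c * multiplicity_at y \<gamma> V
    \<le> liminf (\<lambda>k. c * (\<Sum>n. indicator (\<gamma> ` grid_piece V (Suc k) n) y))" (is "_ \<le> ?L")
proof -
  have *: "c * of_nat (card X) \<le> ?L" if X: "finite X" "X \<subseteq> {x\<in>V. \<gamma> x = y}" for X
  proof (rule Liminf_bounded)
    have "\<forall>\<^sub>F k in sequentially. inj_on (\<lambda>t. \<lfloor>t * real (Suc k)\<rfloor>) X"
    proof -
      have "\<forall>\<^sub>F k in sequentially. \<lfloor>s * real (Suc k)\<rfloor> \<noteq> \<lfloor>t * real (Suc k)\<rfloor>" if "s \<noteq> t" for s t :: real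
      proof -
        obtain m where m: "1 / \<bar>s - t\<bar> < real m" using reals_Archimedean2 by blast
        show ?thesis
        proof (rule eventually_sequentiallyI)
          fix k assume "m \<le> k"
          then have "1 / \<bar>s - t\<bar> < real (Suc k)" using m by simp
          then have "1 < \<bar>s - t\<bar> * real (Suc k)" using that by (simp add: field_simps)
          also have "\<dots> = \<bar>s * real (Suc k) - t * real (Suc k)\<bar>"
            by (simp add: abs_mult flip: left_diff_distrib)
          finally show "\<lfloor>s * real (Suc k)\<rfloor> \<noteq> \<lfloor>t * real (Suc k)\<rfloor>" by linarith
        qed
      qed
      then have "\<forall>\<^sub>F k in sequentially. \<forall>s\<in>X. \<forall>t\<in>X. s \<noteq> t \<longrightarrow> \<lfloor>s * real (Suc k)\<rfloor> \<noteq> \<lfloor>t * real (Suc k)\<rfloor>"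
        using X(1) by (auto simp: eventually_ball_finite_distrib simp del: of_nat_Suc)
      then show ?thesis by eventually_elim (auto simp: inj_on_def)
    qed
    then show "\<forall>\<^sub>F k in sequentially. c * of_nat (card X) \<le> c * (\<Sum>n. indicator (\<gamma> ` grid_piece V (Suc k) n) y)"
    proof eventually_elim
      case (elim k)
      let ?e = "\<lambda>t. int_encode \<lfloor>t * real (Suc k)\<rfloor>"
      have "inj_on ?e X" using elim by (auto simp: inj_on_def int_encode_eq)
      then have "of_nat (card X) = (\<Sum>n\<in>?e ` X. 1 :: ennreal)" by (simp add: card_image)
      also have "\<dots> \<le> (\<Sum>n\<in>?e ` X. indicator (\<gamma> ` grid_piece V (Suc k) n) y)"
      proof (rule sum_mono)
        fix n assume "n \<in> ?e ` X"
        then obtain t where t: "t \<in> X" "n = ?e t" by auto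
        then have "t \<in> grid_piece V (Suc k) n" "\<gamma> t = y" using X by (auto simp: grid_piece_def)
        then show "1 \<le> (indicator (\<gamma> ` grid_piece V (Suc k) n) y :: ennreal)" by (auto simp: indicator_def)
      qed
      also have "\<dots> \<le> (\<Sum>n. indicator (\<gamma> ` grid_piece V (Suc k) n) y)"
        using X by (intro sum_le_suminf) auto
      finally show ?case by (rule mult_left_mono) simp
    qed
  qed
  show ?thesis
  proof (cases "finite {x\<in>V. \<gamma> x = y}")
    case True
    then show ?thesis using * by (simp add: multiplicity_at_def)
  next
    case False
    have "c * of_nat m \<le> ?L" for m
      using infinite_arbitrarily_large[OF False, of m] * by blast
    then have "(SUP m. c * of_nat m) \<le> ?L" by (intro SUP_least)
    then show ?thesis using False
      by (simp add: multiplicity_at_def SUP_mult_left_ennreal[symmetric] ennreal_SUP_of_nat_eq_top)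
  qed
qed

text \<open>On a piece of a grid, where the image is counted once, the bound for
  \<open>hausdorff1_outer\<close> passes to integrals. Summation over the pieces counts \<open>y\<close> as often as there are pieces whose
  image contains it; when the grid is refined, Fatou's lemma and \<open>multiplicity_pieces\<close> give the multiplicity.\<close>

theorem curve_area_inequality:
  fixes \<gamma> :: "real \<Rightarrow> complex" and h :: "real \<Rightarrow> ennreal"
  assumes V: "open V" and cont: "continuous_on V \<gamma>" and h[measurable]: "h \<in> borel_measurable borel"
    and fin: "\<And>a b. a < b \<Longrightarrow> {a..b} \<subseteq> V \<Longrightarrow> (\<integral>\<^sup>+ t\<in>{a..b}. h t \<partial>lborel) < \<infinity>"
    and bd: "\<And>s t. s \<le> t \<Longrightarrow> {s..t} \<subseteq> V \<Longrightarrow> ennreal (dist (\<gamma> s) (\<gamma> t)) \<le> (\<integral>\<^sup>+ x\<in>{s..t}. h x \<partial>lborel)"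
    and \<rho>: "\<rho> \<in> borel_measurable borel"
  shows "(\<integral>\<^sup>+ y. \<rho> y * multiplicity_at y \<gamma> V \<partial>hausdorff1) \<le> (\<integral>\<^sup>+ t\<in>V. \<rho> (\<gamma> t) * h t \<partial>lborel)"
proof -
  note V[measurable (raw)]
  have pm[measurable]: "grid_piece V k n \<in> sets borel" for k n using V by measurable
  have gm[measurable]: "(\<lambda>t. indicator V t *\<^sub>R \<gamma> t) \<in> borel_measurable borel"
    by (rule borel_measurable_continuous_on_indicator[OF _ cont]) (use V in auto)
  have im[measurable]: "\<gamma> ` grid_piece V (Suc k) n \<in> sets hausdorff1" for k n
    by (intro borel_sets_hausdorff1 borel_image_grid_piece V cont) simp
  have rm[measurable]: "\<rho> \<in> borel_measurable hausdorff1" by (rule measurable_hausdorff1[OF \<rho>])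
  have piece: "(\<integral>\<^sup>+ y\<in>\<gamma> ` grid_piece V (Suc k) n. \<rho> y \<partial>hausdorff1)
     \<le> (\<integral>\<^sup>+ t\<in>grid_piece V (Suc k) n. \<rho> (\<gamma> t) * h t \<partial>lborel)" for k n
  proof (rule nn_integral_mono_distr_hausdorff1[where R = "(\<le>)"])
    let ?J = "grid_piece V (Suc k) n"
    have sub: "?J \<subseteq> V" by (auto simp: grid_piece_def)
    have "(\<lambda>t. indicator ?J t *\<^sub>R (indicator V t *\<^sub>R \<gamma> t)) \<in> borel_measurable borel" by measurable
    also have "(\<lambda>t. indicator ?J t *\<^sub>R (indicator V t *\<^sub>R \<gamma> t)) = (\<lambda>t. indicator ?J t *\<^sub>R \<gamma> t)"
      using sub by (auto simp: fun_eq_iff indicator_def)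
    finally show Jm: "(\<lambda>t. indicator ?J t *\<^sub>R \<gamma> t) \<in> borel_measurable borel" .
    show "\<gamma> ` ?J \<in> sets borel" by (intro borel_image_grid_piece V cont) simp
    fix B :: "complex set" assume B: "B \<in> sets borel"
    have "{t \<in> ?J. \<gamma> t \<in> B} = ?J \<inter> (\<lambda>t. indicator ?J t *\<^sub>R \<gamma> t) -` B" by (auto simp: indicator_def)
    also have "\<dots> \<in> sets borel" using measurable_sets[OF Jm B] by auto
    finally have Bm: "{t \<in> ?J. \<gamma> t \<in> B} \<in> sets borel" .
    have "hausdorff1_outer (\<gamma> ` {t \<in> ?J. \<gamma> t \<in> B}) \<le> (\<integral>\<^sup>+ t\<in>{t \<in> ?J. \<gamma> t \<in> B}. h t \<partial>lborel)"
      by (rule hausdorff1_outer_image_le[OF V cont h fin bd Bm]) (use sub in auto)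
    moreover have "\<gamma> ` {t \<in> ?J. \<gamma> t \<in> B} = B \<inter> \<gamma> ` ?J" by auto
    ultimately show "hausdorff1_outer (B \<inter> \<gamma> ` ?J) \<le> (\<integral>\<^sup>+ t\<in>{t \<in> ?J. \<gamma> t \<in> B}. h t \<partial>lborel)" by simp
  qed (use \<rho> in auto)
  have level: "(\<integral>\<^sup>+ y. \<rho> y * (\<Sum>n. indicator (\<gamma> ` grid_piece V (Suc k) n) y) \<partial>hausdorff1)
     \<le> (\<integral>\<^sup>+ t\<in>V. \<rho> (\<gamma> t) * h t \<partial>lborel)" for k
  proof -
    have "(\<integral>\<^sup>+ y. \<rho> y * (\<Sum>n. indicator (\<gamma> ` grid_piece V (Suc k) n) y) \<partial>hausdorff1)
      = (\<integral>\<^sup>+ y. (\<Sum>n. \<rho> y * indicator (\<gamma> ` grid_piece V (Suc k) n) y) \<partial>hausdorff1)"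
      by simp
    also have "\<dots> = (\<Sum>n. \<integral>\<^sup>+ y\<in>\<gamma> ` grid_piece V (Suc k) n. \<rho> y \<partial>hausdorff1)"
      by (rule nn_integral_suminf) measurable
    also have "\<dots> \<le> (\<Sum>n. \<integral>\<^sup>+ t\<in>grid_piece V (Suc k) n. \<rho> (\<gamma> t) * h t \<partial>lborel)"
      by (intro suminf_le piece) auto
    also have "\<dots> = (\<Sum>n. \<integral>\<^sup>+ t\<in>grid_piece V (Suc k) n. \<rho> (indicator V t *\<^sub>R \<gamma> t) * h t \<partial>lborel)"
      by (intro suminf_cong nn_integral_cong) (auto simp: indicator_def grid_piece_def)
    also have "\<dots> = (\<integral>\<^sup>+ t\<in>(\<Union>n. grid_piece V (Suc k) n). \<rho> (indicator V t *\<^sub>R \<gamma> t) * h t \<partial>lborel)"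
      by (rule nn_integral_disjoint_family[symmetric, OF _ _ disjoint_family_grid_piece])
         (use \<rho> in measurable)
    also have "\<dots> = (\<integral>\<^sup>+ t\<in>V. \<rho> (\<gamma> t) * h t \<partial>lborel)"
      unfolding UN_grid_piece by (intro nn_integral_cong) (auto simp: indicator_def)
    finally show ?thesis .
  qed
  have "(\<integral>\<^sup>+ y. \<rho> y * multiplicity_at y \<gamma> V \<partial>hausdorff1)
     \<le> (\<integral>\<^sup>+ y. liminf (\<lambda>k. \<rho> y * (\<Sum>n. indicator (\<gamma> ` grid_piece V (Suc k) n) y)) \<partial>hausdorff1)"
    by (intro nn_integral_mono multiplicity_pieces)
  also have "\<dots> \<le> liminf (\<lambda>k. \<integral>\<^sup>+ y. \<rho> y * (\<Sum>n. indicator (\<gamma> ` grid_piece V (Suc k) n) y) \<partial>hausdorff1)"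
    by (rule nn_integral_liminf) measurable
  also have "\<dots> \<le> liminf (\<lambda>k::nat. (\<integral>\<^sup>+ t\<in>V. \<rho> (\<gamma> t) * h t \<partial>lborel))"
    by (intro Liminf_mono always_eventually allI level)
  also have "\<dots> = (\<integral>\<^sup>+ t\<in>V. \<rho> (\<gamma> t) * h t \<partial>lborel)"
    by (intro Liminf_const) simp
  finally show ?thesis .
qed

section \<open>Arc length on circles\<close>

text \<open>Since \<open>\<phi>\<close> shrinks distances at most by the factor \<open>c\<close>, a covering of the image
  yields a covering of \<open>T\<close> by intervals whose lengths are the diameters divided by \<open>c\<close>.\<close>

lemma hausdorff1_outer_ge_lebesgue:
  fixes \<phi> :: "real \<Rightarrow> complex"
  assumes T[measurable]: "T \<in> sets borel" "bounded T" and c: "0 < c"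
    and lip: "\<And>s t. s \<in> T \<Longrightarrow> t \<in> T \<Longrightarrow> c * \<bar>s - t\<bar> \<le> dist (\<phi> s) (\<phi> t)"
  shows "ennreal c * emeasure lborel T \<le> hausdorff1_outer (\<phi> ` T)"
proof -
  have "ennreal c * emeasure lborel T \<le> hausdorff1_delta 1 (\<phi> ` T)"
    unfolding hausdorff1_delta_def
  proof (rule INF_greatest, clarify)
    fix U :: "nat \<Rightarrow> complex set"
    assume cov: "\<phi> ` T \<subseteq> (\<Union>i. U i)" and U: "\<forall>i. bounded (U i) \<and> diameter (U i) \<le> 1"
    define W where "W i = {t \<in> T. \<phi> t \<in> U i}" for i
    \<comment> \<open>The preimage of a member of the covering has diameter at most \<open>diameter (U i) / c\<close>.\<close>
    define I where "I i = (if W i = {} then {} else {Inf (W i)..Inf (W i) + diameter (U i) / c})" for i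
    have dnn: "0 \<le> diameter (U i)" for i using U by (simp add: diameter_ge_0)
    have WI: "W i \<subseteq> I i" for i
    proof
      fix t assume t: "t \<in> W i"
      have bb: "bdd_below (W i)"
        using T(2) by (intro bounded_imp_bdd_below bounded_subset[OF T(2)]) (auto simp: W_def)
      have "t - diameter (U i) / c \<le> s" if s: "s \<in> W i" for s
      proof -
        have "c * \<bar>s - t\<bar> \<le> dist (\<phi> s) (\<phi> t)" using s t by (intro lip) (auto simp: W_def)
        also have "\<dots> \<le> diameter (U i)"
          using s t U by (intro diameter_bounded_bound) (auto simp: W_def)
        finally have "\<bar>s - t\<bar> \<le> diameter (U i) / c" using c by (simp add: field_simps)
        then show ?thesis by linarith
      qed
      then have "t - diameter (U i) / c \<le> Inf (W i)" using t by (intro cInf_greatest) auto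
      moreover have "Inf (W i) \<le> t" using t bb by (rule cInf_lower)
      ultimately show "t \<in> I i" using t by (auto simp: I_def)
    qed
    have "T \<subseteq> (\<Union>i. I i)"
    proof
      fix t assume "t \<in> T"
      then obtain i where "\<phi> t \<in> U i" using cov by auto
      then have "t \<in> W i" using \<open>t \<in> T\<close> by (simp add: W_def)
      then show "t \<in> (\<Union>i. I i)" using WI by auto
    qed
    then have "emeasure lborel T \<le> emeasure lborel (\<Union>i. I i)"
      by (intro emeasure_mono) (auto simp: I_def)
    also have "\<dots> \<le> (\<Sum>i. emeasure lborel (I i))"
      by (intro emeasure_subadditive_countably) (auto simp: I_def)
    also have "\<dots> \<le> (\<Sum>i. ennreal (diameter (U i) / c))"
      using dnn c by (intro suminf_le) (auto simp: I_def)
    finally have "ennreal c * emeasure lborel T \<le> ennreal c * (\<Sum>i. ennreal (diameter (U i) / c))"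
      by (rule mult_left_mono) simp
    also have "\<dots> = (\<Sum>i. ennreal c * ennreal (diameter (U i) / c))" by simp
    also have "\<dots> = (\<Sum>i. ennreal (diameter (U i)))"
      using c dnn by (intro suminf_cong) (simp flip: ennreal_mult)
    finally show "ennreal c * emeasure lborel T \<le> (\<Sum>i. ennreal (diameter (U i)))" .
  qed
  also have "\<dots> \<le> hausdorff1_outer (\<phi> ` T)"
    unfolding hausdorff1_outer_def by (intro SUP_upper) auto
  finally show ?thesis .
qed

lemma mult_cos_le_sin: "0 \<le> x \<Longrightarrow> x \<le> pi / 2 \<Longrightarrow> x * cos x \<le> sin (x :: real)"
proof -
  assume x: "0 \<le> x" "x \<le> pi / 2"
  have "sin 0 - 0 * cos 0 \<le> sin x - x * cos x"
    by (rule DERIV_nonneg_imp_nondecreasing[OF x(1)])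
       (use x in \<open>auto intro!: derivative_eq_intros exI mult_nonneg_nonneg sin_ge_zero\<close>)
  then show ?thesis by simp
qed

text \<open>With \<open>d = |s - t| / 2\<close> the chord has length \<open>2 r sin d\<close>, and \<open>sin d\<close> is at least \<open>d cos d\<close>.\<close>

lemma dist_circle_ge:
  assumes "0 \<le> r" "\<bar>s - t\<bar> \<le> 2 * x" "x \<le> pi / 2"
  shows "r * cos x * \<bar>s - t\<bar> \<le> dist (z\<^sub>0 + of_real r * cis s) (z\<^sub>0 + of_real r * cis t)"
proof -
  define d where "d = \<bar>s - t\<bar> / 2"
  have d: "0 \<le> d" "d \<le> x" using assms by (auto simp: d_def)
  have "cmod (cis s - cis t) = 2 * \<bar>sin ((s - t) / 2)\<bar>"
  proof -
    have "(cmod (cis s - cis t))\<^sup>2 = (cos s - cos t)\<^sup>2 + (sin s - sin t)\<^sup>2"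
      by (simp add: cmod_power2)
    also have "\<dots> = (2 * \<bar>sin ((s - t) / 2)\<bar>)\<^sup>2"
    proof -
      have "(cos s - cos t)\<^sup>2 + (sin s - sin t)\<^sup>2 = 2 - 2 * cos (s - t)"
        by (simp add: cos_diff power2_eq_square algebra_simps)
      also have "cos (s - t) = 1 - 2 * (sin ((s - t) / 2))\<^sup>2"
        using cos_double_sin[of "(s - t) / 2"] by (simp only: mult_2 field_sum_of_halves)
      finally show ?thesis by (simp add: power_mult_distrib)
    qed
    finally have sq: "(cmod (cis s - cis t))\<^sup>2 = (2 * \<bar>sin ((s - t) / 2)\<bar>)\<^sup>2" .
    show ?thesis by (rule power2_eq_imp_eq[OF sq]) auto
  qed
  also have "\<bar>sin ((s - t) / 2)\<bar> = sin d"
  proof -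
    have "0 \<le> sin d" using d assms pi_gt_zero by (intro sin_ge_zero) linarith+
    moreover have "sin ((t - s) / 2) = - sin ((s - t) / 2)"
      by (metis minus_diff_eq minus_divide_left sin_minus)
    ultimately show ?thesis by (auto simp: d_def abs_if)
  qed
  finally have eq: "cmod (cis s - cis t) = 2 * sin d" .
  have "d * cos x \<le> d * cos d" using d assms by (intro mult_left_mono cos_monotone_0_pi_le) auto
  also have "\<dots> \<le> sin d" using d assms by (intro mult_cos_le_sin) auto
  finally have "cos x * \<bar>s - t\<bar> \<le> cmod (cis s - cis t)" unfolding eq by (simp add: d_def mult_ac)
  then have "r * (cos x * \<bar>s - t\<bar>) \<le> r * cmod (cis s - cis t)" using assms by (intro mult_left_mono) auto
  also have "\<dots> = dist (z\<^sub>0 + of_real r * cis s) (z\<^sub>0 + of_real r * cis t)"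
    using assms by (simp add: dist_norm norm_mult flip: right_diff_distrib)
  finally show ?thesis by (simp add: mult_ac)
qed

text \<open>On a cell of length \<open>1 / k\<close> the parametrization of the circle shrinks distances at
  most by the factor \<open>r cos (1 / k)\<close>, which tends to \<open>r\<close>. The images of the cells are disjoint, so the lower
  bounds for them add up.\<close>

theorem circle_length_le_hausdorff1:
  assumes r: "0 < r" and \<rho>: "\<rho> \<in> borel_measurable borel"
  shows "(\<integral>\<^sup>+ t\<in>{0<..<2*pi}. \<rho> (z\<^sub>0 + of_real r * cis t) * ennreal r \<partial>lborel)
    \<le> (\<integral>\<^sup>+ y\<in>sphere z\<^sub>0 r. \<rho> y \<partial>hausdorff1)"
proof -
  define c where "c t = z\<^sub>0 + of_real r * cis t" for t
  define V where "V = {0<..<2*pi}"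
  have V: "open V" by (simp add: V_def)
  have cm[measurable]: "c \<in> borel_measurable borel"
    unfolding c_def by (intro borel_measurable_continuous_onI continuous_intros)
  have "(\<ge>) (\<integral>\<^sup>+ y\<in>sphere z\<^sub>0 r. \<rho> y \<partial>hausdorff1) (\<integral>\<^sup>+ t\<in>V. \<rho> (c t) * (\<lambda>_. ennreal r) t \<partial>lborel)"
  proof (rule nn_integral_mono_distr_hausdorff1)
    fix B :: "complex set" assume B[measurable]: "B \<in> sets borel"
    define T where "T = {t \<in> V. c t \<in> B}"
    have T[measurable]: "T \<in> sets borel"
      using measurable_sets[OF cm B] by (simp add: T_def V_def)
    have le: "ennreal (r * cos (1 / real (Suc k))) * emeasure lborel T \<le> hausdorff1_outer (B \<inter> sphere z\<^sub>0 r)" for k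
    proof -
      let ?k = "Suc k"
      have kx: "0 \<le> 1 / real ?k" "1 / real ?k \<le> 1" by auto
      have cpos: "0 < cos (1 / real ?k)" using kx pi_gt3 by (intro cos_gt_zero_pi) linarith+
      have pd: "disjoint_family (\<lambda>n. c ` grid_piece V ?k n)"
      proof -
        have "inj_on c V"
        proof (rule inj_onI)
          fix s t assume st: "s \<in> V" "t \<in> V" "c s = c t"
          have A: "Arg2pi (cis x) = x" if "x \<in> V" for x
            using that by (intro Arg2pi_unique[of 1]) (auto simp: cis_conv_exp V_def)
          have "cis s = cis t" using st r by (simp add: c_def)
          then show "s = t" using A st by metis
        qed
        moreover have "grid_piece V ?k n \<subseteq> V" for n by (auto simp: grid_piece_def)
        ultimately show ?thesis
          using disjoint_family_grid_piece[of V ?k] unfolding disjoint_family_on_def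
          by (metis inj_on_image_Int image_empty)
      qed
      have cp: "c ` grid_piece V ?k n \<in> sets borel" for n
        by (rule borel_image_grid_piece[OF V]) (auto simp: c_def intro!: continuous_intros)
      have dp: "grid_piece V ?k n \<in> sets borel" for n using V by measurable
      have ch: "B \<inter> c ` grid_piece V ?k n \<in> sets hausdorff1" for n
        by (intro borel_sets_hausdorff1 sets.Int B cp)
      have "ennreal (r * cos (1 / real ?k)) * emeasure lborel T
         = ennreal (r * cos (1 / real ?k)) * emeasure lborel (\<Union>n. T \<inter> grid_piece V ?k n)"
        by (simp flip: Int_UN_distrib add: UN_grid_piece) (simp add: T_def Int_absorb2)
      also have "\<dots> = (\<Sum>n. ennreal (r * cos (1 / real ?k)) * emeasure lborel (T \<inter> grid_piece V ?k n))"
        using disjoint_family_grid_piece[of V ?k] dp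
        by (subst suminf_emeasure[symmetric]) (auto simp: disjoint_family_on_def)
      also have "\<dots> \<le> (\<Sum>n. emeasure hausdorff1 (B \<inter> c ` grid_piece V ?k n))"
      proof (rule suminf_le)
        fix n
        have "ennreal (r * cos (1 / real ?k)) * emeasure lborel (T \<inter> grid_piece V ?k n)
          \<le> hausdorff1_outer (c ` (T \<inter> grid_piece V ?k n))"
        proof (rule hausdorff1_outer_ge_lebesgue)
          show "bounded (T \<inter> grid_piece V ?k n)"
            by (rule bounded_subset[OF bounded_closed_interval[of 0 "2*pi"]]) (auto simp: T_def V_def)
          fix s t assume st: "s \<in> T \<inter> grid_piece V ?k n" "t \<in> T \<inter> grid_piece V ?k n"
          then have "\<lfloor>s * real ?k\<rfloor> = \<lfloor>t * real ?k\<rfloor>" by (auto simp: grid_piece_def)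
          then have "\<bar>s * real ?k - t * real ?k\<bar> \<le> 1" by linarith
          then have "\<bar>s - t\<bar> * real ?k \<le> 1" by (simp add: abs_mult flip: left_diff_distrib)
          then have "\<bar>s - t\<bar> \<le> 1 / real ?k" by (simp add: pos_le_divide_eq)
          also have "\<dots> \<le> 2 * (1 / real ?k)" using kx(1) by linarith
          finally show "r * cos (1 / real ?k) * \<bar>s - t\<bar> \<le> dist (c s) (c t)"
            unfolding c_def using r kx pi_gt3 by (intro dist_circle_ge) linarith+
        qed (use dp r cpos in auto)
        also have "c ` (T \<inter> grid_piece V ?k n) = B \<inter> c ` grid_piece V ?k n"
          by (auto simp: T_def grid_piece_def)
        also have "hausdorff1_outer \<dots> = emeasure hausdorff1 \<dots>"
          by (rule emeasure_hausdorff1[symmetric, OF ch])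
        finally show "ennreal (r * cos (1 / real ?k)) * emeasure lborel (T \<inter> grid_piece V ?k n)
          \<le> emeasure hausdorff1 (B \<inter> c ` grid_piece V ?k n)" .
      qed auto
      also have "\<dots> = emeasure hausdorff1 (\<Union>n. B \<inter> c ` grid_piece V ?k n)"
        by (rule suminf_emeasure) (use ch pd in \<open>auto intro: disjoint_family_on_bisimulation[OF pd]\<close>)
      also have "\<dots> \<le> emeasure hausdorff1 (B \<inter> sphere z\<^sub>0 r)"
        using r by (intro emeasure_mono borel_sets_hausdorff1) (auto simp: c_def dist_norm norm_mult)
      also have "\<dots> = hausdorff1_outer (B \<inter> sphere z\<^sub>0 r)"
        by (rule emeasure_hausdorff1, rule borel_sets_hausdorff1) auto
      finally show ?thesis .
    qed
    have "(\<lambda>k. ennreal (r * cos (1 / real (Suc k))) * emeasure lborel T) \<longlonglongrightarrow> ennreal (r * cos 0) * emeasure lborel T"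
    proof -
      have "emeasure lborel T \<le> emeasure lborel V" by (rule emeasure_mono) (auto simp: T_def V_def)
      then have "emeasure lborel T < top" by (auto simp: V_def intro: le_less_trans)
      moreover have "(\<lambda>k. 1 / real (Suc k)) \<longlonglongrightarrow> 0"
        using LIMSEQ_inverse_real_of_nat by (simp add: inverse_eq_divide)
      then have "(\<lambda>k. cos (1 / real (Suc k))) \<longlonglongrightarrow> cos 0" by (rule tendsto_cos)
      then have "(\<lambda>k. ennreal (r * cos (1 / real (Suc k)))) \<longlonglongrightarrow> ennreal (r * cos 0)"
        by (intro tendsto_ennrealI tendsto_mult_left)
      ultimately show ?thesis
        unfolding mult.commute[of _ "emeasure lborel T"] by (rule ennreal_tendsto_cmult)
    qed
    then have "ennreal (r * cos 0) * emeasure lborel T \<le> hausdorff1_outer (B \<inter> sphere z\<^sub>0 r)"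
      by (rule LIMSEQ_le_const2) (use le in auto)
    then show "(\<integral>\<^sup>+ t\<in>{t \<in> V. c t \<in> B}. ennreal r \<partial>lborel) \<le> hausdorff1_outer (B \<inter> sphere z\<^sub>0 r)"
      by (simp add: T_def[symmetric] nn_integral_cmult_indicator)
  qed (use \<rho> in \<open>auto simp: V_def\<close>)
  then show ?thesis by (simp add: V_def c_def)
qed

section \<open>Continuity of translation in the mean\<close>

lemma nn_integral_lborel_shift:
  fixes u :: "complex \<Rightarrow> ennreal"
  assumes [measurable]: "u \<in> borel_measurable borel"
  shows "(\<integral>\<^sup>+ z. u (z + a) \<partial>lborel) = (\<integral>\<^sup>+ z. u z \<partial>lborel)"
  by (subst (2) lborel_distr_plus[of a, symmetric], subst nn_integral_distr) (auto simp: add.commute)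

lemma nn_integral_lborel_reflect:
  fixes u :: "complex \<Rightarrow> ennreal"
  assumes [measurable]: "u \<in> borel_measurable borel"
  shows "(\<integral>\<^sup>+ z. u (a - z) \<partial>lborel) = (\<integral>\<^sup>+ z. u z \<partial>lborel)"
  by (subst (2) lborel_affine[of "-1" a], simp, subst nn_integral_density, simp, simp, subst nn_integral_distr) auto

lemma lborel_compact_open_approx:
  fixes A :: "complex set"
  assumes A[measurable]: "A \<in> sets borel" and fin: "emeasure lborel A < \<infinity>" and e: "0 < (e::real)"
  obtains K U where "compact K" "open U" "K \<subseteq> A" "A \<subseteq> U" "emeasure lborel (U - K) < e"
proof -
  define N where "N = density lborel (indicator A)"
  have sN: "sets N = sets borel" by (simp add: N_def)
  have N: "emeasure N B = emeasure lborel (A \<inter> B)" if "B \<in> sets borel" for B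
    using that unfolding N_def
    by (subst emeasure_density) (auto simp: nn_integral_indicator[symmetric] simp del: nn_integral_indicator
        intro!: nn_integral_cong split: split_indicator)
  have fN: "emeasure N (space N) \<noteq> \<infinity>" using fin N[of UNIV] by (auto simp: N_def)
  obtain U where U: "open U" "A \<subseteq> U" "emeasure lborel (U - A) < e / 2"
    using outer_regular_lborel[OF A, of "e / 2"] e by auto
  obtain K where K: "K \<subseteq> A" "compact K" "emeasure lborel (A - K) < e / 2"
  proof (cases "emeasure lborel A = 0")
    case True
    then show thesis using e by (intro that[of "{}"]) auto
  next
    case False
    define t where "t = enn2real (emeasure lborel A)"
    have t: "emeasure lborel A = ennreal t" "0 < t"
      using False fin by (auto simp: t_def enn2real_positive_iff zero_less_iff_neq_zero)
    have "ennreal (t - e / 2) < ennreal t" using e t by (intro ennreal_lessI) auto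
    also have "\<dots> = (SUP K \<in> {K. K \<subseteq> A \<and> compact K}. emeasure N K)"
      using inner_regular[OF sN fN A] N[OF A] t by simp
    finally obtain K where K: "K \<subseteq> A" "compact K" "ennreal (t - e / 2) < emeasure N K"
      by (auto simp: less_SUP_iff)
    have Km: "K \<in> sets borel" using K(2) by (rule borel_compact)
    have NK: "emeasure N K = emeasure lborel K" using N[OF Km] K(1) by (simp add: Int_absorb1)
    have Kf: "emeasure lborel K \<noteq> \<infinity>" using emeasure_mono[OF K(1), of lborel] fin A by auto
    have "emeasure lborel (A - K) = emeasure lborel A - emeasure lborel K"
      by (rule emeasure_Diff) (use Kf Km K in auto)
    also have "\<dots> < e / 2"
    proof -
      obtain k where k: "emeasure lborel K = ennreal k" "0 \<le> k" using Kf by (cases "emeasure lborel K") auto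
      have "t - e / 2 < k"
        using K(3) unfolding NK k(1) by (metis ennreal_leI not_le)
      then show ?thesis using k e unfolding t(1) k(1)
        by (simp add: ennreal_minus ennreal_lessI)
    qed
    finally show thesis using that K by blast
  qed
  have Km: "K \<in> sets borel" using K(2) by (rule borel_compact)
  have "emeasure lborel (U - K) \<le> emeasure lborel ((U - A) \<union> (A - K))"
    using U Km by (intro emeasure_mono) auto
  also have "\<dots> \<le> emeasure lborel (U - A) + emeasure lborel (A - K)"
    using U Km by (intro emeasure_subadditive) auto
  also have "\<dots> < ennreal (e / 2) + ennreal (e / 2)"
    using U K by (intro add_strict_mono) auto
  also have "\<dots> = e" using e by (simp flip: ennreal_plus)
  finally show thesis using that U K by blast
qed

definition translation_modulus :: "(complex \<Rightarrow> complex) \<Rightarrow> complex \<Rightarrow> ennreal" where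
  "translation_modulus g h = (\<integral>\<^sup>+ z. ennreal (norm (g (z + h) - g z)) \<partial>lborel)"

text \<open>For the indicator function of \<open>A\<close>, choose \<open>K \<subseteq> A \<subseteq> U\<close> by regularity: if
  \<open>h\<close> is smaller than the distance from \<open>K\<close> to the complement of \<open>U\<close>, then only points with
  \<open>z \<in> U - K\<close> or \<open>z + h \<in> U - K\<close> contribute. The property is preserved under sums, and under limits in the mean
  because translations preserve the integral.\<close>

theorem L1_translation_continuous:
  fixes g :: "complex \<Rightarrow> complex"
  assumes "integrable lborel g"
  shows "\<forall>e>0. \<exists>d>0. \<forall>h. norm h < d \<longrightarrow> translation_modulus g h \<le> ennreal e"
  using assms
proof (induction rule: integrable_induct)
  case (base A c)
  note A = base(1)[measurable]
  show ?case
  proof (intro allI impI)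
    fix e :: real assume e: "0 < e"
    define e' where "e' = e / (2 * (norm c + 1))"
    have e': "0 < e'" using e by (simp add: e'_def add_nonneg_pos)
    obtain K U where KU: "compact K" "open U" "K \<subseteq> A" "A \<subseteq> U" "emeasure lborel (U - K) < e'"
      using lborel_compact_open_approx[of A e'] base e' by auto
    have Wm[measurable]: "U - K \<in> sets borel" using KU by (auto intro: borel_compact)
    obtain d where d: "0 < d" "(\<Union>x\<in>K. ball x d) \<subseteq> U"
      using compact_subset_open_imp_ball_epsilon_subset[of K U] KU by (metis order.trans)
    show "\<exists>d>0. \<forall>h. norm h < d \<longrightarrow> translation_modulus (\<lambda>x. indicat_real A x *\<^sub>R c) h \<le> ennreal e"
    proof (intro exI conjI allI impI)
      fix h :: complex assume h: "norm h < d"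
      have near: "y \<in> U" if "x \<in> K" "dist x y < d" for x y
        using d(2) that by (meson UN_I mem_ball subsetD)
      have pt: "ennreal (norm (indicat_real A (z + h) *\<^sub>R c - indicat_real A z *\<^sub>R c))
         \<le> ennreal (norm c) * (indicator (U - K) z + indicator (U - K) (z + h))" for z
      proof -
        have a: "z + h \<in> U" if "z \<in> K" using near[OF that, of "z + h"] h by (simp add: dist_norm)
        have b: "z \<in> U" if "z + h \<in> K" using near[OF that, of z] h by (simp add: dist_norm)
        have "z \<in> U - K \<or> z + h \<in> U - K" if "(z \<in> A) \<noteq> (z + h \<in> A)"
          using a b that KU(3,4) by blast
        then show ?thesis
          by (auto simp: indicator_def intro: order_trans[OF _ mult_left_mono[of 1]])
      qed
      have "translation_modulus (\<lambda>x. indicat_real A x *\<^sub>R c) h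
         \<le> (\<integral>\<^sup>+ z. ennreal (norm c) * (indicator (U - K) z + indicator (U - K) (z + h)) \<partial>lborel)"
        unfolding translation_modulus_def by (intro nn_integral_mono pt)
      also have "\<dots> = ennreal (norm c) * ((\<integral>\<^sup>+ z. indicator (U - K) z \<partial>lborel) + (\<integral>\<^sup>+ z. indicator (U - K) (z + h) \<partial>lborel))"
        by (simp add: nn_integral_cmult nn_integral_add del: nn_integral_indicator)
      also have "(\<integral>\<^sup>+ z. indicator (U - K) (z + h) \<partial>lborel) = (\<integral>\<^sup>+ z. indicator (U - K) z \<partial>lborel)"
        by (rule nn_integral_lborel_shift) measurable
      also have "ennreal (norm c) * ((\<integral>\<^sup>+ z. indicator (U - K) z \<partial>lborel) + (\<integral>\<^sup>+ z. indicator (U - K) z \<partial>lborel))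
         \<le> ennreal (norm c) * (ennreal e' + ennreal e')"
        using KU(5) by (intro mult_left_mono add_mono) auto
      also have "\<dots> = ennreal (norm c * (e' + e'))"
        using e' by (simp flip: ennreal_plus ennreal_mult)
      also have "\<dots> \<le> ennreal e"
        using e by (intro ennreal_leI) (simp add: e'_def divide_le_eq add_nonneg_pos)
      finally show "translation_modulus (\<lambda>x. indicat_real A x *\<^sub>R c) h \<le> ennreal e" .
    qed (use d in auto)
  qed
next
  case (add f g)
  have [measurable]: "f \<in> borel_measurable borel" "g \<in> borel_measurable borel" using add by auto
  show ?case
  proof (intro allI impI)
    fix e :: real assume e: "0 < e"
    obtain d1 d2 where d: "0 < d1" "\<And>h. norm h < d1 \<Longrightarrow> translation_modulus f h \<le> ennreal (e / 2)"
       "0 < d2" "\<And>h. norm h < d2 \<Longrightarrow> translation_modulus g h \<le> ennreal (e / 2)"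
      using add e by (metis half_gt_zero)
    show "\<exists>d>0. \<forall>h. norm h < d \<longrightarrow> translation_modulus (\<lambda>x. f x + g x) h \<le> ennreal e"
    proof (intro exI[of _ "min d1 d2"] conjI allI impI)
      fix h :: complex assume h: "norm h < min d1 d2"
      have "translation_modulus (\<lambda>x. f x + g x) h
        \<le> (\<integral>\<^sup>+ z. ennreal (norm (f (z + h) - f z)) + ennreal (norm (g (z + h) - g z)) \<partial>lborel)"
        unfolding translation_modulus_def
        by (intro nn_integral_mono) (auto simp: add_diff_add intro!: ennreal_leI norm_triangle_ineq simp flip: ennreal_plus)
      also have "\<dots> = translation_modulus f h + translation_modulus g h"
        unfolding translation_modulus_def by (rule nn_integral_add) auto
      also have "\<dots> \<le> ennreal (e / 2) + ennreal (e / 2)" using d h by (intro add_mono) auto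
      also have "\<dots> = e" using e by (simp flip: ennreal_plus)
      finally show "translation_modulus (\<lambda>x. f x + g x) h \<le> ennreal e" .
    qed (use d in auto)
  qed
next
  case (lim f s)
  have [measurable]: "f \<in> borel_measurable borel" "\<And>i. s i \<in> borel_measurable borel" using lim by auto
  show ?case
  proof (intro allI impI)
    fix e :: real assume e: "0 < e"
    have "(\<lambda>i. \<integral>\<^sup>+ z. norm (f z - s i z) \<partial>lborel) \<longlonglongrightarrow> 0"
    proof (rule nn_integral_dominated_convergence_norm[where w = "\<lambda>x. 2 * norm (f x)"])
      show "(\<integral>\<^sup>+ x. ennreal (2 * norm (f x)) \<partial>lborel) < \<infinity>"
      proof -
        have "(\<integral>\<^sup>+ x. ennreal (norm (f x)) \<partial>lborel) < \<infinity>"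
          using lim.hyps by (simp add: integrable_iff_bounded)
        then show ?thesis
          by (simp add: ennreal_mult' nn_integral_cmult ennreal_mult_less_top)
      qed
    qed (use lim in auto)
    then have "(\<lambda>i. \<integral>\<^sup>+ z. norm (s i z - f z) \<partial>lborel) \<longlonglongrightarrow> 0"
      by (simp only: norm_minus_commute)
    then have "\<forall>\<^sub>F i in sequentially. (\<integral>\<^sup>+ z. norm (s i z - f z) \<partial>lborel) < ennreal (e / 3)"
      using e by (intro order_tendstoD) auto
    then obtain i where i: "(\<integral>\<^sup>+ z. norm (s i z - f z) \<partial>lborel) < ennreal (e / 3)"
      using eventually_happens'[OF sequentially_bot] by blast
    obtain d where d: "0 < d" "\<And>h. norm h < d \<Longrightarrow> translation_modulus (s i) h \<le> ennreal (e / 3)"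
      using lim.IH[of i] e by (meson divide_pos_pos zero_less_numeral)
    show "\<exists>d>0. \<forall>h. norm h < d \<longrightarrow> translation_modulus f h \<le> ennreal e"
    proof (intro exI[of _ d] conjI allI impI)
      fix h :: complex assume h: "norm h < d"
      have "translation_modulus f h
        \<le> (\<integral>\<^sup>+ z. ennreal (norm (s i (z + h) - f (z + h))) + (ennreal (norm (s i (z + h) - s i z)) + ennreal (norm (s i z - f z))) \<partial>lborel)"
        unfolding translation_modulus_def
      proof (intro nn_integral_mono)
        fix z
        have "norm (f (z + h) - f z) \<le> norm (s i (z + h) - f (z + h)) + (norm (s i (z + h) - s i z) + norm (s i z - f z))"
          using norm_triangle_ineq[of "f (z + h) - s i (z + h)" "(s i (z + h) - s i z) + (s i z - f z)"]
            norm_triangle_ineq[of "s i (z + h) - s i z" "s i z - f z"]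
          by (simp add: norm_minus_commute[of "f (z + h)" "s i (z + h)"])
        then show "ennreal (norm (f (z + h) - f z)) \<le> ennreal (norm (s i (z + h) - f (z + h))) + (ennreal (norm (s i (z + h) - s i z)) + ennreal (norm (s i z - f z)))"
          by (auto simp flip: ennreal_plus intro: ennreal_leI)
      qed
      also have "\<dots> = (\<integral>\<^sup>+ z. norm (s i (z + h) - f (z + h)) \<partial>lborel) + (translation_modulus (s i) h + (\<integral>\<^sup>+ z. norm (s i z - f z) \<partial>lborel))"
        unfolding translation_modulus_def by (simp add: nn_integral_add)
      also have "(\<integral>\<^sup>+ z. norm (s i (z + h) - f (z + h)) \<partial>lborel) = (\<integral>\<^sup>+ z. norm (s i z - f z) \<partial>lborel)"
        by (rule nn_integral_lborel_shift[of "\<lambda>z. ennreal (norm (s i z - f z))"]) measurable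
      also have "(\<integral>\<^sup>+ z. norm (s i z - f z) \<partial>lborel) + (translation_modulus (s i) h + (\<integral>\<^sup>+ z. norm (s i z - f z) \<partial>lborel))
         \<le> ennreal (e / 3) + (ennreal (e / 3) + ennreal (e / 3))"
        using i d(2)[OF h] by (intro add_mono) auto
      also have "\<dots> = e" using e by (simp flip: ennreal_plus)
      finally show "translation_modulus f h \<le> ennreal e" .
    qed (use d in auto)
  qed
qed

section \<open>A smooth kernel\<close>

text \<open>The derivative is quantified existentially, so that the closure rules below exhibit it.\<close>

primrec Ck_real :: "nat \<Rightarrow> (real \<Rightarrow> real) \<Rightarrow> bool" where
  "Ck_real 0 f \<longleftrightarrow> continuous_on UNIV f"
| "Ck_real (Suc k) f \<longleftrightarrow> (\<exists>f'. (\<forall>x. (f has_real_derivative f' x) (at x)) \<and> Ck_real k f')"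

lemma Ck_real_Suc_imp: "Ck_real (Suc k) f \<Longrightarrow> Ck_real k f"
proof (induction k arbitrary: f)
  case 0
  then show ?case by (auto simp: continuous_on_eq_continuous_at intro: DERIV_isCont)
next
  case (Suc k)
  then show ?case by (metis Ck_real.simps(2))
qed

lemma Ck_real_SucI:
  "(\<And>x. (f has_real_derivative f' x) (at x)) \<Longrightarrow> Ck_real k f' \<Longrightarrow> Ck_real (Suc k) f"
  by auto

lemma Ck_real_SucE:
  assumes "Ck_real (Suc k) f"
  obtains f' where "\<And>x. (f has_real_derivative f' x) (at x)" "Ck_real k f'"
  using assms by auto

lemma Ck_real_add: "Ck_real k f \<Longrightarrow> Ck_real k g \<Longrightarrow> Ck_real k (\<lambda>x. f x + g x)"
proof (induction k arbitrary: f g)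
  case (Suc k)
  obtain f' where f': "\<And>x. (f has_real_derivative f' x) (at x)" "Ck_real k f'"
    using Suc.prems(1) by (rule Ck_real_SucE) blast
  obtain g' where g': "\<And>x. (g has_real_derivative g' x) (at x)" "Ck_real k g'"
    using Suc.prems(2) by (rule Ck_real_SucE) blast
  show ?case
    by (rule Ck_real_SucI[OF DERIV_add[OF f'(1) g'(1)] Suc.IH[OF f'(2) g'(2)]])
qed (simp add: continuous_on_add)

lemma Ck_real_mult: "Ck_real k f \<Longrightarrow> Ck_real k g \<Longrightarrow> Ck_real k (\<lambda>x. f x * g x)"
proof (induction k arbitrary: f g)
  case (Suc k)
  obtain f' where f': "\<And>x. (f has_real_derivative f' x) (at x)" "Ck_real k f'"
    using Suc.prems(1) by (rule Ck_real_SucE) blast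
  obtain g' where g': "\<And>x. (g has_real_derivative g' x) (at x)" "Ck_real k g'"
    using Suc.prems(2) by (rule Ck_real_SucE) blast
  have c: "Ck_real k f" "Ck_real k g"
    using Ck_real_Suc_imp[OF Suc.prems(1)] Ck_real_Suc_imp[OF Suc.prems(2)] by auto
  have "Ck_real k (\<lambda>x. f' x * g x + g' x * f x)"
    by (rule Ck_real_add[OF Suc.IH[OF f'(2) c(2)] Suc.IH[OF g'(2) c(1)]])
  with DERIV_mult[OF f'(1) g'(1)] show ?case by (rule Ck_real_SucI)
qed (simp add: continuous_on_mult)

lemma Ck_real_const: "Ck_real k (\<lambda>x. c)"
  by (induction k arbitrary: c) (auto intro!: exI[of _ "\<lambda>x. 0"])

lemma Ck_real_affine: "Ck_real k f \<Longrightarrow> Ck_real k (\<lambda>x. f (a + b * x))"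
proof (induction k arbitrary: f)
  case (Suc k)
  obtain f' where f': "\<And>x. (f has_real_derivative f' x) (at x)" "Ck_real k f'"
    using Suc.prems by (rule Ck_real_SucE) blast
  have "((\<lambda>x. f (a + b * x)) has_real_derivative f' (a + b * x) * b) (at x)" for x
    by (rule DERIV_chain2[OF f'(1)]) (auto intro!: derivative_eq_intros)
  moreover have "Ck_real k (\<lambda>x. f' (a + b * x) * b)"
    by (rule Ck_real_mult[OF Suc.IH[OF f'(2)] Ck_real_const])
  ultimately show ?case by (rule Ck_real_SucI)
next
  case 0
  then have "continuous_on UNIV f" by simp
  then have "continuous_on UNIV (\<lambda>x. f (a + b * x))"
    by (rule continuous_on_compose2) (auto intro!: continuous_on_add continuous_on_mult)
  then show ?case by simp
qed

text \<open>The factors \<open>1 / x ^ n\<close> make this family of flat functions closed under differentiation, up to linear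
  combinations; smoothness of all its members then follows by a single induction.\<close>

definition exp_flat :: "nat \<Rightarrow> real \<Rightarrow> real" where
  "exp_flat n x = (if 0 < x then exp (- inverse x) / x ^ n else 0)"

text \<open>At 0 the decay of \<open>exp (- 1 / x)\<close> beats every power of \<open>1 / x\<close>.\<close>

lemma exp_flat_derivative:
  "(exp_flat n has_real_derivative - real n * exp_flat (Suc n) x + exp_flat (n + 2) x) (at x)"
proof -
  consider "0 < x" | "x < 0" | "x = 0" by linarith
  then show ?thesis
  proof cases
    case 1
    have "((\<lambda>x. exp (- inverse x) / x ^ n) has_real_derivative - real n * exp_flat (Suc n) x + exp_flat (n + 2) x) (at x)"
    proof -
      have p: "((\<lambda>x. x ^ n) has_real_derivative real n * x ^ (n - Suc 0)) (at x)"
        by (rule DERIV_pow)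
      have e: "((\<lambda>x. exp (- inverse x)) has_real_derivative exp (- inverse x) * inverse x ^ 2) (at x)"
        using 1 by (auto intro!: derivative_eq_intros simp: power2_eq_square)
      have "(exp (- inverse x) * inverse x ^ 2 * x ^ n - exp (- inverse x) * (real n * x ^ (n - Suc 0))) / (x ^ n * x ^ n)
         = - real n * exp_flat (Suc n) x + exp_flat (n + 2) x"
        using 1 by (cases n) (simp_all add: exp_flat_def field_simps power2_eq_square)
      then show ?thesis using DERIV_divide[OF e p] 1 by simp
    qed
    then show ?thesis
      by (rule has_field_derivative_transform_within_open[of _ _ _ "{0<..}"]) (use 1 in \<open>auto simp: exp_flat_def\<close>)
  next
    case 2
    have "((\<lambda>x. 0) has_real_derivative 0) (at x)" by simp
    then have "(exp_flat n has_real_derivative 0) (at x)"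
      by (rule has_field_derivative_transform_within_open[of _ _ _ "{..<0}"]) (use 2 in \<open>auto simp: exp_flat_def\<close>)
    then show ?thesis using 2 by (simp add: exp_flat_def)
  next
    case 3
    have "((\<lambda>y::real. exp (- inverse y) / y ^ Suc n) \<longlongrightarrow> 0) (at_right 0)"
    proof -
      have "((\<lambda>y. y ^ Suc n / exp y) \<longlongrightarrow> (0::real)) at_top" by (rule tendsto_power_div_exp_0)
      then have "((\<lambda>y. inverse y ^ Suc n / exp (inverse y)) \<longlongrightarrow> (0::real)) (at_right 0)"
        by (rule filterlim_compose[OF _ filterlim_inverse_at_top_right])
      moreover have "(\<lambda>y::real. inverse y ^ Suc n / exp (inverse y)) = (\<lambda>y. exp (- inverse y) / y ^ Suc n)"
        unfolding exp_minus divide_inverse power_inverse by (rule ext) (rule mult.commute)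
      ultimately show ?thesis by (simp only:)
    qed
    then have r: "((\<lambda>y. exp_flat n y / y) \<longlongrightarrow> 0) (at_right 0)"
      by (rule Lim_transform_eventually) (auto simp: exp_flat_def eventually_at_filter)
    have l: "((\<lambda>y. exp_flat n y / y) \<longlongrightarrow> 0) (at_left 0)"
      by (rule Lim_transform_eventually[of "\<lambda>_. 0"]) (auto simp: exp_flat_def eventually_at_filter)
    have "((\<lambda>y. exp_flat n y / y) \<longlongrightarrow> 0) (at 0)" using l r by (rule filterlim_split_at)
    then show ?thesis unfolding 3 has_field_derivative_iff by (simp add: exp_flat_def)
  qed
qed

lemma Ck_real_exp_flat: "Ck_real k (exp_flat n)"
proof (induction k arbitrary: n)
  case 0
  then show ?case using exp_flat_derivative by (auto simp: continuous_on_eq_continuous_at intro: DERIV_isCont)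
next
  case (Suc k)
  have "Ck_real k (\<lambda>x. - real n * exp_flat (Suc n) x + exp_flat (n + 2) x)"
    by (intro Ck_real_add Ck_real_mult Ck_real_const Suc)
  with exp_flat_derivative show ?case by (rule Ck_real_SucI)
qed

definition bump :: "real \<Rightarrow> real" where "bump x = exp_flat 0 x * exp_flat 0 (1 - x)"

lemma Ck_real_bump: "Ck_real k bump"
proof -
  have "Ck_real k (\<lambda>x. exp_flat 0 x * exp_flat 0 (1 + (-1) * x))"
    by (rule Ck_real_mult[OF Ck_real_exp_flat Ck_real_affine[OF Ck_real_exp_flat]])
  then show ?thesis by (simp add: bump_def[abs_def])
qed

lemma bump_nonneg: "0 \<le> bump x" by (simp add: bump_def exp_flat_def)
lemma bump_pos: "0 < x \<Longrightarrow> x < 1 \<Longrightarrow> 0 < bump x" by (simp add: bump_def exp_flat_def)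
lemma bump_zero: "x \<notin> {0..1} \<Longrightarrow> bump x = 0" by (auto simp: bump_def exp_flat_def)

definition bump_mass :: real where "bump_mass = integral\<^sup>L lborel bump"

lemma integrable_bump: "integrable lborel bump"
proof -
  have c: "continuous_on UNIV bump" using Ck_real_bump[of 0] by simp
  have "integrable lborel (\<lambda>x. indicator {0..1} x *\<^sub>R bump x)"
    by (rule borel_integrable_compact) (auto intro: continuous_on_subset[OF c])
  also have "(\<lambda>x. indicator {0..1} x *\<^sub>R bump x) = bump"
    using bump_zero by (auto simp: fun_eq_iff indicator_def)
  finally show ?thesis .
qed

lemma bump_mass_pos: "0 < bump_mass"
proof -
  have "0 \<le> bump_mass" unfolding bump_mass_def by (intro integral_nonneg_AE) (simp add: bump_nonneg)
  moreover have "bump_mass \<noteq> 0"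
  proof
    assume "bump_mass = 0"
    then have "AE x in lborel. bump x = 0"
      unfolding bump_mass_def by (subst (asm) integral_nonneg_eq_0_iff_AE[OF integrable_bump]) (auto simp: bump_nonneg)
    then have "AE x in lborel. x \<notin> {0<..<1::real}" by eventually_elim (use bump_pos in force)
    then have "emeasure lborel {0<..<1::real} = 0" by (subst (asm) AE_iff_measurable[of "{0<..<1}"]) auto
    then show False by simp
  qed
  ultimately show ?thesis by linarith
qed

text \<open>A kernel of mass one with support in the interval of length \<open>1 / (m + 1)\<close> to the right of 0.\<close>

definition mollifier1 :: "nat \<Rightarrow> real \<Rightarrow> real" where
  "mollifier1 m x = real (Suc m) / bump_mass * bump (real (Suc m) * x)"

lemma Ck_real_mollifier1: "Ck_real k (mollifier1 m)"
proof -
  have "Ck_real k (\<lambda>x. real (Suc m) / bump_mass * bump (0 + real (Suc m) * x))"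
    by (rule Ck_real_mult[OF Ck_real_const Ck_real_affine[OF Ck_real_bump]])
  then show ?thesis by (simp add: mollifier1_def[abs_def])
qed

lemma mollifier1_nonneg: "0 \<le> mollifier1 m x"
  using bump_mass_pos by (simp add: mollifier1_def bump_nonneg)

lemma mollifier1_zero:
  assumes "x \<notin> {0..1 / real (Suc m)}" shows "mollifier1 m x = 0"
proof -
  have "real (Suc m) * x \<notin> {0..1}"
    using assms by (simp add: zero_le_mult_iff pos_le_divide_eq mult.commute del: of_nat_Suc)
  then show ?thesis by (simp add: mollifier1_def bump_zero del: of_nat_Suc)
qed

lemma continuous_mollifier1: "continuous_on S (mollifier1 m)"
  using Ck_real_mollifier1[of 0 m] by (auto intro: continuous_on_subset)

lemma measurable_mollifier1 [measurable]: "mollifier1 m \<in> borel_measurable borel"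
  by (intro borel_measurable_continuous_onI continuous_mollifier1)

lemma nn_integral_mollifier1: "(\<integral>\<^sup>+ x. ennreal (mollifier1 m x) \<partial>lborel) = 1"
proof -
  have [measurable]: "bump \<in> borel_measurable borel" using integrable_bump by simp
  have B: "(\<integral>\<^sup>+ x. ennreal (bump x) \<partial>lborel) = ennreal bump_mass"
    unfolding bump_mass_def by (rule nn_integral_eq_integral[OF integrable_bump]) (simp add: bump_nonneg)
  have "ennreal bump_mass = (\<integral>\<^sup>+ x. ennreal (bump x) \<partial>lborel)" by (rule B[symmetric])
  also have "\<dots> = real (Suc m) * (\<integral>\<^sup>+ x. ennreal (bump (0 + real (Suc m) * x)) \<partial>lborel)"
    by (subst nn_integral_real_affine[of _ "real (Suc m)" 0]) auto
  finally have *: "ennreal (real (Suc m)) * (\<integral>\<^sup>+ x. ennreal (bump (real (Suc m) * x)) \<partial>lborel) = ennreal bump_mass"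
    by (simp del: of_nat_Suc)
  have "(\<integral>\<^sup>+ x. ennreal (mollifier1 m x) \<partial>lborel)
     = (\<integral>\<^sup>+ x. ennreal (1 / bump_mass) * (ennreal (real (Suc m)) * ennreal (bump (real (Suc m) * x))) \<partial>lborel)"
    using bump_mass_pos by (intro nn_integral_cong) (simp add: mollifier1_def bump_nonneg flip: ennreal_mult del: of_nat_Suc)
  also have "\<dots> = ennreal (1 / bump_mass) * ennreal bump_mass"
    by (simp add: nn_integral_cmult * del: of_nat_Suc)
  also have "\<dots> = 1" using bump_mass_pos by (simp flip: ennreal_mult)
  finally show ?thesis .
qed

text \<open>A product kernel: its partial derivatives are products of functions of one variable.\<close>

definition mollifier :: "nat \<Rightarrow> complex \<Rightarrow> real" where
  "mollifier m z = mollifier1 m (Re z) * mollifier1 m (Im z)"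

lemma mollifier_nonneg: "0 \<le> mollifier m z" by (simp add: mollifier_def mollifier1_nonneg)

lemma continuous_mollifier: "continuous_on S (mollifier m)"
  unfolding mollifier_def
  by (intro continuous_intros continuous_on_compose2[OF continuous_mollifier1[of UNIV]]) auto

lemma measurable_mollifier [measurable]: "mollifier m \<in> borel_measurable borel"
  by (intro borel_measurable_continuous_onI continuous_mollifier)

lemma mollifier_zero: "2 / real (Suc m) < norm z \<Longrightarrow> mollifier m z = 0"
proof (rule ccontr)
  assume "mollifier m z \<noteq> 0" and n: "2 / real (Suc m) < norm z"
  then have "mollifier1 m (Re z) \<noteq> 0" "mollifier1 m (Im z) \<noteq> 0"
    by (auto simp: mollifier_def)
  then have "Re z \<in> {0..1 / real (Suc m)}" "Im z \<in> {0..1 / real (Suc m)}"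
    using mollifier1_zero by blast+
  then have "\<bar>Re z\<bar> \<le> 1 / real (Suc m)" "\<bar>Im z\<bar> \<le> 1 / real (Suc m)" by auto
  then have "norm z \<le> 1 / real (Suc m) + 1 / real (Suc m)"
    using cmod_le[of z] by linarith
  then show False using n by simp
qed

lemma nn_integral_mollifier: "(\<integral>\<^sup>+ z. ennreal (mollifier m z) \<partial>lborel) = 1"
proof -
  have "(\<integral>\<^sup>+ z. ennreal (mollifier m z) \<partial>lborel)
      = (\<integral>\<^sup>+ x. \<integral>\<^sup>+ y. ennreal (mollifier1 m x) * ennreal (mollifier1 m y) \<partial>lborel \<partial>lborel)"
    by (subst nn_integral_complex) (auto simp: mollifier_def mollifier1_nonneg ennreal_mult intro!: nn_integral_cong)
  also have "\<dots> = 1" by (simp add: nn_integral_cmult nn_integral_mollifier1)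
  finally show ?thesis .
qed

text \<open>Both partial derivatives of a product of two functions of one variable are again such products, which
  is what the induction feeds on.\<close>

lemma Ck_function_prod:
  assumes "\<And>k. Ck_real k a" "\<And>k. Ck_real k b"
  shows "Ck_function k (\<lambda>w. a (Re w) * b (Im w))"
  using assms
proof (induction k arbitrary: a b)
  case 0
  have "continuous_on UNIV a" "continuous_on UNIV b" using 0[of 0] by auto
  then show ?case
    by (auto intro!: continuous_intros intro: continuous_on_compose2)
next
  case (Suc k)
  obtain a' where a': "\<And>x. (a has_real_derivative a' x) (at x)"
    using Suc.prems(1)[of "Suc 0"] by auto
  obtain b' where b': "\<And>x. (b has_real_derivative b' x) (at x)"
    using Suc.prems(2)[of "Suc 0"] by auto
  have Ca: "Ck_real j a'" for j
  proof -
    obtain a2 where "\<And>x. (a has_real_derivative a2 x) (at x)" "Ck_real j a2" using Suc.prems(1)[of "Suc j"] by auto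
    moreover from this(1) have "a2 = a'" by (intro ext DERIV_unique[OF _ a'])
    ultimately show ?thesis by simp
  qed
  have Cb: "Ck_real j b'" for j
  proof -
    obtain a2 where "\<And>x. (b has_real_derivative a2 x) (at x)" "Ck_real j a2" using Suc.prems(2)[of "Suc j"] by auto
    moreover from this(1) have "a2 = b'" by (intro ext DERIV_unique[OF _ b'])
    ultimately show ?thesis by simp
  qed
  have d1: "((\<lambda>t. a (Re (z + of_real t * 1)) * b (Im (z + of_real t * 1))) has_vector_derivative a' (Re z) * b (Im z)) (at 0)" for z
  proof -
    have "((\<lambda>t. a (Re z + t)) has_real_derivative a' (Re z + 0) * 1) (at 0)"
      by (rule DERIV_chain2[OF a']) (auto intro!: derivative_eq_intros)
    then show ?thesis
      by (auto simp flip: has_real_derivative_iff_has_vector_derivative intro!: derivative_eq_intros)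
  qed
  have d2: "((\<lambda>t. a (Re (z + of_real t * \<i>)) * b (Im (z + of_real t * \<i>))) has_vector_derivative a (Re z) * b' (Im z)) (at 0)" for z
  proof -
    have "((\<lambda>t. b (Im z + t)) has_real_derivative b' (Im z + 0) * 1) (at 0)"
      by (rule DERIV_chain2[OF b']) (auto intro!: derivative_eq_intros)
    then show ?thesis
      by (auto simp flip: has_real_derivative_iff_has_vector_derivative intro!: derivative_eq_intros)
  qed
  have e: "dir_deriv 1 (\<lambda>w. a (Re w) * b (Im w)) = (\<lambda>w. a' (Re w) * b (Im w))"
    "dir_deriv \<i> (\<lambda>w. a (Re w) * b (Im w)) = (\<lambda>w. a (Re w) * b' (Im w))"
    using d1 d2 by (auto simp: dir_deriv_def fun_eq_iff intro!: vector_derivative_at)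
  have "has_dir_deriv (\<lambda>w. a (Re w) * b (Im w)) 1 z" "has_dir_deriv (\<lambda>w. a (Re w) * b (Im w)) \<i> z" for z
    unfolding has_dir_deriv_def by (rule differentiableI_vector[OF d1], rule differentiableI_vector[OF d2])
  then show ?case using Suc.IH[of a' b] Suc.IH[of a b'] Ca Cb Suc.prems by (auto simp: e)
qed

definition mollifier1' :: "nat \<Rightarrow> real \<Rightarrow> real" where "mollifier1' m = deriv (mollifier1 m)"

lemma mollifier1_deriv: "(mollifier1 m has_real_derivative mollifier1' m x) (at x)"
  using Ck_real_mollifier1[of 1 m] DERIV_imp_deriv unfolding mollifier1'_def One_nat_def Ck_real.simps by metis

lemma continuous_mollifier1': "continuous_on S (mollifier1' m)"
proof -
  obtain f' where f': "\<forall>x. (mollifier1 m has_real_derivative f' x) (at x)" "continuous_on UNIV f'"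
    using Ck_real_mollifier1[of 1 m] by auto
  have "mollifier1' m = f'" by (rule ext) (rule DERIV_unique[OF mollifier1_deriv f'(1)[rule_format]])
  then show ?thesis using f'(2) by (auto intro: continuous_on_subset)
qed

lemma measurable_mollifier1' [measurable]: "mollifier1' m \<in> borel_measurable borel"
  by (intro borel_measurable_continuous_onI continuous_mollifier1')

lemma mollifier1'_zero: 
  assumes "x \<notin> {0..1 / real (Suc m)}" shows "mollifier1' m x = 0"
proof -
  have "((\<lambda>_. 0) has_real_derivative 0) (at x)" by simp
  then have "(mollifier1 m has_real_derivative 0) (at x)"
    by (rule has_field_derivative_transform_within_open[of _ _ _ "- {0..1 / real (Suc m)}"])
       (use assms mollifier1_zero in auto)
  then show ?thesis using mollifier1_deriv DERIV_unique by blast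
qed

text \<open>As functions of the integration variable the kernels are test functions, so that they can be
  inserted into the definition of weak derivatives.\<close>

lemma mollifier_test_function:
  assumes "cball z (2 / real (Suc m)) \<subseteq> D"
  shows "test_function D (\<lambda>w. mollifier m (z - w))"
    and "dir_deriv 1 (\<lambda>w. mollifier m (z - w)) w = - mollifier1' m (Re z - Re w) * mollifier1 m (Im z - Im w)"
    and "dir_deriv \<i> (\<lambda>w. mollifier m (z - w)) w = - mollifier1 m (Re z - Re w) * mollifier1' m (Im z - Im w)"
proof -
  have "Ck_function k (\<lambda>w. (\<lambda>x. mollifier1 m (Re z + (-1) * x)) (Re w) * (\<lambda>x. mollifier1 m (Im z + (-1) * x)) (Im w))" for k
    by (rule Ck_function_prod[OF Ck_real_affine[OF Ck_real_mollifier1] Ck_real_affine[OF Ck_real_mollifier1]])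
  then have C: "Ck_function k (\<lambda>w. mollifier m (z - w))" for k by (simp add: mollifier_def)
  have "{w. mollifier m (z - w) \<noteq> 0} \<subseteq> cball z (2 / real (Suc m))"
    using mollifier_zero by (force simp: dist_norm simp del: of_nat_Suc)
  then have sub: "closure {w. mollifier m (z - w) \<noteq> 0} \<subseteq> cball z (2 / real (Suc m))"
    by (rule closure_minimal) auto
  then have "bounded (closure {w. mollifier m (z - w) \<noteq> 0})"
    by (rule bounded_subset[OF bounded_cball])
  then have "compact (closure {w. mollifier m (z - w) \<noteq> 0})"
    by (simp only: compact_eq_bounded_closed closed_closure simp_thms)
  then show "test_function D (\<lambda>w. mollifier m (z - w))"
    unfolding test_function_def using C assms sub by blast
  have "((\<lambda>t. mollifier1 m (x - t)) has_real_derivative mollifier1' m (x - 0) * (-1)) (at 0)" for x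
    by (rule DERIV_chain2[OF mollifier1_deriv]) (auto intro!: derivative_eq_intros)
  note d = this
  have "((\<lambda>t. mollifier1 m (Re z - Re w - t) * mollifier1 m (Im z - Im w)) has_real_derivative
     - mollifier1' m (Re z - Re w) * mollifier1 m (Im z - Im w)) (at 0)"
    using d[of "Re z - Re w"] by (auto intro!: derivative_eq_intros)
  then show "dir_deriv 1 (\<lambda>w. mollifier m (z - w)) w = - mollifier1' m (Re z - Re w) * mollifier1 m (Im z - Im w)"
    unfolding dir_deriv_def by (intro vector_derivative_at)
      (simp add: has_real_derivative_iff_has_vector_derivative mollifier_def diff_diff_eq)
  have "((\<lambda>t. mollifier1 m (Re z - Re w) * mollifier1 m (Im z - Im w - t)) has_real_derivative
     - mollifier1 m (Re z - Re w) * mollifier1' m (Im z - Im w)) (at 0)"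
    using d[of "Im z - Im w"] by (auto intro!: derivative_eq_intros)
  then show "dir_deriv \<i> (\<lambda>w. mollifier m (z - w)) w = - mollifier1 m (Re z - Re w) * mollifier1' m (Im z - Im w)"
    unfolding dir_deriv_def by (intro vector_derivative_at)
      (simp add: has_real_derivative_iff_has_vector_derivative mollifier_def diff_diff_eq)
qed

section \<open>Mollification\<close>

text \<open>Borel measurable and integrable on compact subsets of \<open>D\<close>. Sobolev maps and their weak derivatives are
  replaced by representatives of this kind, to which Fubini's theorem applies.\<close>

definition locally_L1 :: "complex set \<Rightarrow> (complex \<Rightarrow> complex) \<Rightarrow> bool" where
  "locally_L1 D F \<longleftrightarrow> F \<in> borel_measurable borel \<and>
     (\<forall>C. compact C \<and> C \<subseteq> D \<longrightarrow> (\<integral>\<^sup>+ z\<in>C. ennreal (norm (F z)) \<partial>lborel) < \<infinity>)"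

lemma locally_L1_measurable: "locally_L1 D F \<Longrightarrow> F \<in> borel_measurable borel"
  by (simp add: locally_L1_def)

lemma locally_L1_finite:
  "locally_L1 D F \<Longrightarrow> compact C \<Longrightarrow> C \<subseteq> D \<Longrightarrow> (\<integral>\<^sup>+ z\<in>C. ennreal (norm (F z)) \<partial>lborel) < \<infinity>"
  by (auto simp: locally_L1_def)

definition mollify :: "nat \<Rightarrow> (complex \<Rightarrow> complex) \<Rightarrow> complex \<Rightarrow> complex" where
  "mollify m F z = (\<integral>w. mollifier m (z - w) *\<^sub>R F w \<partial>lborel)"

lemma bump_le_1: "bump x \<le> 1"
  by (auto simp: bump_def exp_flat_def mult_le_one)

lemma mollifier1_bound: "mollifier1 m x \<le> real (Suc m) / bump_mass"
  unfolding mollifier1_def using bump_mass_pos bump_le_1 bump_nonneg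
  by (intro mult_left_le) auto

lemma mollifier_bound: "mollifier m z \<le> (real (Suc m) / bump_mass)\<^sup>2"
  unfolding mollifier_def power2_eq_square using bump_mass_pos
  by (intro mult_mono mollifier1_bound mollifier1_nonneg) auto

lemma integrable_mollifier_mult:
  fixes F :: "complex \<Rightarrow> complex"
  assumes F[measurable]: "F \<in> borel_measurable borel"
    and fin: "(\<integral>\<^sup>+ w\<in>cball z (2 / real (Suc m)). ennreal (norm (F w)) \<partial>lborel) < \<infinity>"
  shows "integrable lborel (\<lambda>w. mollifier m (z - w) *\<^sub>R F w)"
proof (rule integrableI_bounded)
  let ?B = "(real (Suc m) / bump_mass)\<^sup>2"
  have [measurable]: "cball z (2 / real (Suc m)) \<in> sets borel" by (rule borel_closed) simp
  have "(\<integral>\<^sup>+ w. ennreal (norm (mollifier m (z - w) *\<^sub>R F w)) \<partial>lborel)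
    \<le> (\<integral>\<^sup>+ w. ennreal ?B * (ennreal (norm (F w)) * indicator (cball z (2 / real (Suc m))) w) \<partial>lborel)"
  proof (intro nn_integral_mono)
    fix w
    show "ennreal (norm (mollifier m (z - w) *\<^sub>R F w)) \<le> ennreal ?B * (ennreal (norm (F w)) * indicator (cball z (2 / real (Suc m))) w)"
    proof (cases "w \<in> cball z (2 / real (Suc m))")
      case True
      then show ?thesis
        using mollifier_bound[of m "z - w"] mollifier_nonneg[of m "z - w"]
        by (auto simp flip: ennreal_mult intro!: ennreal_leI mult_right_mono simp del: of_nat_Suc)
    next
      case False
      then have "mollifier m (z - w) = 0" by (intro mollifier_zero) (simp add: dist_norm del: of_nat_Suc)
      then show ?thesis by simp
    qed
  qed
  also have "\<dots> = ennreal ?B * (\<integral>\<^sup>+ w\<in>cball z (2 / real (Suc m)). ennreal (norm (F w)) \<partial>lborel)"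
    by (rule nn_integral_cmult) measurable
  also have "\<dots> < \<infinity>" using fin by (simp add: ennreal_mult_less_top del: of_nat_Suc)
  finally show "(\<integral>\<^sup>+ w. ennreal (norm (mollifier m (z - w) *\<^sub>R F w)) \<partial>lborel) < \<infinity>" .
qed measurable

lemma nn_integral_mollifier_shift: "(\<integral>\<^sup>+ w. ennreal (mollifier m (z - w)) \<partial>lborel) = 1"
  by (subst nn_integral_lborel_reflect[of "\<lambda>w. ennreal (mollifier m w)" z]) (auto simp: nn_integral_mollifier)

text \<open>The kernel has mass one, so that \<open>c\<close> is its own average.\<close>

lemma mollify_diff_le:
  assumes F[measurable]: "F \<in> borel_measurable borel"
    and fin: "(\<integral>\<^sup>+ w\<in>cball z (2 / real (Suc m)). ennreal (norm (F w)) \<partial>lborel) < \<infinity>"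
  shows "ennreal (norm (mollify m F z - c)) \<le> (\<integral>\<^sup>+ w. ennreal (mollifier m (z - w)) * ennreal (norm (F w - c)) \<partial>lborel)"
proof -
  have i1: "integrable lborel (\<lambda>w. mollifier m (z - w) *\<^sub>R F w)" by (rule integrable_mollifier_mult[OF F fin])
  have i0: "integrable lborel (\<lambda>w. mollifier m (z - w))"
    by (rule integrableI_bounded) (auto simp: mollifier_nonneg nn_integral_mollifier_shift)
  have one: "(\<integral>w. mollifier m (z - w) \<partial>lborel) = 1"
    using nn_integral_eq_integral[OF i0] nn_integral_mollifier_shift[of m z]
    by (simp add: mollifier_nonneg)
  have "mollify m F z - c = (\<integral>w. mollifier m (z - w) *\<^sub>R F w \<partial>lborel) - (\<integral>w. mollifier m (z - w) \<partial>lborel) *\<^sub>R c"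
    unfolding mollify_def one by simp
  also have "\<dots> = (\<integral>w. mollifier m (z - w) *\<^sub>R F w - mollifier m (z - w) *\<^sub>R c \<partial>lborel)"
    using i0 i1 by simp
  also have "\<dots> = (\<integral>w. mollifier m (z - w) *\<^sub>R (F w - c) \<partial>lborel)"
    by (simp add: scaleR_diff_right)
  finally have eq: "mollify m F z - c = (\<integral>w. mollifier m (z - w) *\<^sub>R (F w - c) \<partial>lborel)" .
  have "integrable lborel (\<lambda>w. mollifier m (z - w) *\<^sub>R (F w - c))"
    unfolding scaleR_diff_right using i0 i1 by simp
  from integral_norm_bound_ennreal[OF this]
  show ?thesis unfolding eq
    by (simp add: mollifier_nonneg ennreal_mult)
qed

lemma compact_neighbourhood:
  fixes K :: "complex set"
  assumes "compact K" "open D" "K \<subseteq> D"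
  obtains \<delta> K' where "0 < \<delta>" "compact K'" "K \<subseteq> K'" "K' \<subseteq> D" "\<And>x y. x \<in> K \<Longrightarrow> norm (y - x) \<le> \<delta> \<Longrightarrow> y \<in> K'"
proof -
  obtain \<delta> where d: "0 < \<delta>" "(\<Union>x\<in>K. cball x \<delta>) \<subseteq> D"
    using compact_subset_open_imp_cball_epsilon_subset[OF assms] by auto
  define K' where "K' = {x + y | x y. x \<in> K \<and> y \<in> cball 0 \<delta>}"
  have "compact K'" unfolding K'_def by (rule compact_sums[OF assms(1) compact_cball])
  moreover have "K' \<subseteq> D"
  proof
    fix v assume "v \<in> K'"
    then obtain x y where "v = x + y" "x \<in> K" "norm y \<le> \<delta>" by (auto simp: K'_def)
    then have "v \<in> cball x \<delta>" by (simp add: dist_norm)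
    then show "v \<in> D" using d \<open>x \<in> K\<close> by blast
  qed
  moreover have mem: "y \<in> K'" if "x \<in> K" "norm (y - x) \<le> \<delta>" for x y
  proof -
    have "y = x + (y - x)" "y - x \<in> cball 0 \<delta>" using that by auto
    then show ?thesis unfolding K'_def using \<open>x \<in> K\<close> by blast
  qed
  moreover have "K \<subseteq> K'" using mem[of x x for x] d by auto
  ultimately show thesis using that d by blast
qed

text \<open>The difference is an average of translation differences of \<open>G\<close> over vectors of length at most
  \<open>norm s + 2 / (m + 1)\<close>, which are small in the mean. The shift \<open>s\<close> is there because difference quotients
  of a mollified map are averages of its gradient along a short segment.\<close>

theorem mollify_L1:
  assumes D: "open D" and G: "locally_L1 D G" and K: "compact K" "K \<subseteq> D" and e: "0 < (e::real)"
  shows "\<exists>d>0. \<forall>m s. norm s + 2 / real (Suc m) < d \<longrightarrow>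
     (\<integral>\<^sup>+ z\<in>K. ennreal (norm (mollify m G (z + s) - G z)) \<partial>lborel) \<le> ennreal e"
proof -
  note Gm[measurable] = locally_L1_measurable[OF G]
  obtain \<delta> K' where K': "0 < \<delta>" "compact K'" "K \<subseteq> K'" "K' \<subseteq> D" "\<And>x y. x \<in> K \<Longrightarrow> norm (y - x) \<le> \<delta> \<Longrightarrow> y \<in> K'"
    using compact_neighbourhood[OF K(1) D K(2)] by metis
  have Km[measurable]: "K \<in> sets borel" "K' \<in> sets borel" using K K' by (auto intro: borel_compact)
  define g where "g z = indicator K' z *\<^sub>R G z" for z
  have gm[measurable]: "g \<in> borel_measurable borel" unfolding g_def by measurable
  have gi: "integrable lborel g"
  proof (rule integrableI_bounded)
    have "(\<integral>\<^sup>+ z. ennreal (norm (g z)) \<partial>lborel) = (\<integral>\<^sup>+ z\<in>K'. ennreal (norm (G z)) \<partial>lborel)"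
      by (intro nn_integral_cong) (auto simp: g_def indicator_def)
    also have "\<dots> < \<infinity>" by (rule locally_L1_finite[OF G K'(2,4)])
    finally show "(\<integral>\<^sup>+ z. ennreal (norm (g z)) \<partial>lborel) < \<infinity>" .
  qed measurable
  obtain d0 where d0: "0 < d0" "\<And>h. norm h < d0 \<Longrightarrow> translation_modulus g h \<le> ennreal e"
    using L1_translation_continuous[OF gi] e by blast
  show ?thesis
  proof (intro exI[of _ "min d0 \<delta>"] conjI allI impI)
    fix m :: nat and s :: complex assume ms: "norm s + 2 / real (Suc m) < min d0 \<delta>"
    have pt: "ennreal (norm (mollify m G (z + s) - G z)) * indicator K z
      \<le> (\<integral>\<^sup>+ u. ennreal (mollifier m u) * ennreal (norm (g (z + (s - u)) - g z)) \<partial>lborel)" for z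
    proof (cases "z \<in> K")
      case True
      have ball: "w \<in> K'" if "norm (z + s - w) \<le> 2 / real (Suc m)" for w
      proof (rule K'(5)[OF True])
        have "norm (w - z) = norm (s - (z + s - w))" by (simp add: algebra_simps)
        also have "\<dots> \<le> norm s + norm (z + s - w)" by (rule norm_triangle_ineq4)
        also have "\<dots> \<le> \<delta>" using that ms by simp
        finally show "norm (w - z) \<le> \<delta>" .
      qed
      have gz: "g z = G z" using True K'(3) by (auto simp: g_def)
      have "(\<integral>\<^sup>+ w\<in>cball (z + s) (2 / real (Suc m)). ennreal (norm (G w)) \<partial>lborel) < \<infinity>"
      proof (rule locally_L1_finite[OF G])
        show "cball (z + s) (2 / real (Suc m)) \<subseteq> D"
          using ball K'(4) by (auto simp: dist_norm simp del: of_nat_Suc)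
      qed simp
      then have "ennreal (norm (mollify m G (z + s) - G z))
         \<le> (\<integral>\<^sup>+ w. ennreal (mollifier m (z + s - w)) * ennreal (norm (G w - G z)) \<partial>lborel)"
        by (rule mollify_diff_le[OF Gm])
      also have "\<dots> \<le> (\<integral>\<^sup>+ w. ennreal (mollifier m (z + s - w)) * ennreal (norm (g w - g z)) \<partial>lborel)"
      proof (intro nn_integral_mono)
        fix w
        show "ennreal (mollifier m (z + s - w)) * ennreal (norm (G w - G z))
          \<le> ennreal (mollifier m (z + s - w)) * ennreal (norm (g w - g z))"
        proof (cases "norm (z + s - w) \<le> 2 / real (Suc m)")
          case True
          then have "g w = G w" using ball by (simp add: g_def)
          then show ?thesis by (simp add: gz)
        next
          case False
          then show ?thesis by (simp add: mollifier_zero del: of_nat_Suc)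
        qed
      qed
      also have "\<dots> = (\<integral>\<^sup>+ u. ennreal (mollifier m (z + s - (z + s - u))) * ennreal (norm (g (z + s - u) - g z)) \<partial>lborel)"
        by (rule nn_integral_lborel_reflect[symmetric]) measurable
      finally show ?thesis using True by (simp add: add_diff_eq)
    qed simp
    have "(\<integral>\<^sup>+ z\<in>K. ennreal (norm (mollify m G (z + s) - G z)) \<partial>lborel)
      \<le> (\<integral>\<^sup>+ z. \<integral>\<^sup>+ u. ennreal (mollifier m u) * ennreal (norm (g (z + (s - u)) - g z)) \<partial>lborel \<partial>lborel)"
      by (intro nn_integral_mono pt)
    also have "\<dots> = (\<integral>\<^sup>+ u. \<integral>\<^sup>+ z. ennreal (mollifier m u) * ennreal (norm (g (z + (s - u)) - g z)) \<partial>lborel \<partial>lborel)"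
      by (rule lborel_pair.Fubini') measurable
    also have "\<dots> = (\<integral>\<^sup>+ u. ennreal (mollifier m u) * translation_modulus g (s - u) \<partial>lborel)"
      unfolding translation_modulus_def by (intro nn_integral_cong nn_integral_cmult) measurable
    also have "\<dots> \<le> (\<integral>\<^sup>+ u. ennreal (mollifier m u) * ennreal e \<partial>lborel)"
    proof (intro nn_integral_mono)
      fix u
      show "ennreal (mollifier m u) * translation_modulus g (s - u) \<le> ennreal (mollifier m u) * ennreal e"
      proof (cases "norm u \<le> 2 / real (Suc m)")
        case True
        have "norm (s - u) \<le> norm s + norm u" by (rule norm_triangle_ineq4)
        also have "\<dots> < d0" using True ms by simp
        finally show ?thesis by (intro mult_left_mono d0) auto
      next
        case False
        then show ?thesis by (simp add: mollifier_zero del: of_nat_Suc)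
      qed
    qed
    also have "\<dots> = ennreal e" by (simp add: nn_integral_multc nn_integral_mollifier)
    finally show "(\<integral>\<^sup>+ z\<in>K. ennreal (norm (mollify m G (z + s) - G z)) \<partial>lborel) \<le> ennreal e" .
  qed (use d0 K' in auto)
qed

lemma mollify_tendsto:
  assumes D: "open D" and F: "locally_L1 D F" and cont: "continuous_on D F" and z: "z \<in> D"
  shows "(\<lambda>m. mollify m F z) \<longlonglongrightarrow> F z"
proof (rule tendstoI)
  fix e :: real assume e: "0 < e"
  note Fm[measurable] = locally_L1_measurable[OF F]
  have "isCont F z" using cont D z by (simp add: continuous_on_eq_continuous_at)
  then obtain d1 where d1: "0 < d1" "\<And>w. dist w z < d1 \<Longrightarrow> dist (F w) (F z) < e / 2"
    using e unfolding continuous_at_eps_delta by (metis half_gt_zero)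
  obtain d2 where d2: "0 < d2" "cball z d2 \<subseteq> D" using D z open_contains_cball by blast
  obtain m0 where m0: "inverse (real (Suc m0)) < min d1 d2 / 2"
    using reals_Archimedean[of "min d1 d2 / 2"] d1 d2 by auto
  show "\<forall>\<^sub>F m in sequentially. dist (mollify m F z) (F z) < e"
  proof (rule eventually_sequentiallyI[of m0])
    fix m assume m: "m0 \<le> m"
    have "inverse (real (Suc m)) \<le> inverse (real (Suc m0))" using m by simp
    then have small: "2 / real (Suc m) < min d1 d2" using m0 by (simp add: inverse_eq_divide)
    have "cball z (2 / real (Suc m)) \<subseteq> cball z d2" using small by (intro subset_cball) simp
    then have "cball z (2 / real (Suc m)) \<subseteq> D" using d2(2) by (rule order_trans)
    then have "(\<integral>\<^sup>+ w\<in>cball z (2 / real (Suc m)). ennreal (norm (F w)) \<partial>lborel) < \<infinity>"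
      by (intro locally_L1_finite[OF F]) auto
    then have "ennreal (norm (mollify m F z - F z))
        \<le> (\<integral>\<^sup>+ w. ennreal (mollifier m (z - w)) * ennreal (norm (F w - F z)) \<partial>lborel)"
      by (rule mollify_diff_le[OF Fm])
    also have "\<dots> \<le> (\<integral>\<^sup>+ w. ennreal (mollifier m (z - w)) * ennreal (e / 2) \<partial>lborel)"
    proof (intro nn_integral_mono)
      fix w
      show "ennreal (mollifier m (z - w)) * ennreal (norm (F w - F z)) \<le> ennreal (mollifier m (z - w)) * ennreal (e / 2)"
      proof (cases "norm (z - w) \<le> 2 / real (Suc m)")
        case True
        then have "dist w z < d1" using small by (simp add: dist_norm norm_minus_commute)
        from d1(2)[OF this] show ?thesis by (intro mult_left_mono ennreal_leI) (auto simp: dist_norm)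
      next
        case False
        then show ?thesis by (simp add: mollifier_zero del: of_nat_Suc)
      qed
    qed
    also have "\<dots> = ennreal (e / 2)" by (simp add: nn_integral_multc nn_integral_mollifier_shift)
    finally show "dist (mollify m F z) (F z) < e" using e by (simp add: dist_norm)
  qed
qed

definition weak_gradient :: "complex set \<Rightarrow> (complex \<Rightarrow> complex) \<Rightarrow> (complex \<Rightarrow> complex) \<Rightarrow> (complex \<Rightarrow> complex) \<Rightarrow> bool" where
  "weak_gradient D F G1 G2 \<longleftrightarrow> (\<forall>\<phi>. test_function D \<phi> \<longrightarrow>
     (\<integral>w. dir_deriv 1 \<phi> w *\<^sub>R F w \<partial>lborel) = - (\<integral>w. \<phi> w *\<^sub>R G1 w \<partial>lborel) \<and>
     (\<integral>w. dir_deriv \<i> \<phi> w *\<^sub>R F w \<partial>lborel) = - (\<integral>w. \<phi> w *\<^sub>R G2 w \<partial>lborel))"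

lemma bounded_on_compact_real:
  fixes f :: "real \<Rightarrow> real"
  assumes "continuous_on {a..b} f"
  obtains B where "0 \<le> B" "\<And>t. t \<in> {a..b} \<Longrightarrow> \<bar>f t\<bar> \<le> B"
proof -
  have "bounded (f ` {a..b})"
    by (intro compact_imp_bounded compact_continuous_image assms) auto
  then obtain B where "\<forall>v\<in>f ` {a..b}. norm v \<le> B" unfolding bounded_iff by blast
  then show thesis by (intro that[of "max 0 B"]) (auto simp: le_max_iff_disj)
qed

text \<open>For fixed \<open>w\<close> the fundamental theorem of calculus applies to the kernel \<open>mollifier m (c t - w)\<close> along
  the curve. Integration against \<open>F w\<close> and Fubini's theorem leave the derivative of the kernel against \<open>F\<close>, which is
  the kernel against the weak gradient.\<close>

theorem mollify_curve:
  fixes x y x' y' :: "real \<Rightarrow> real"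
  defines "c \<equiv> \<lambda>t. Complex (x t) (y t)"
  assumes D: "open D" and F: "locally_L1 D F" and W: "weak_gradient D F G1 G2"
    and ab: "a \<le> b" and x: "\<And>t. (x has_real_derivative x' t) (at t)" and y: "\<And>t. (y has_real_derivative y' t) (at t)"
    and cont': "continuous_on UNIV x'" "continuous_on UNIV y'"
    and near: "\<And>t. t \<in> {a..b} \<Longrightarrow> cball (c t) (2 / real (Suc m)) \<subseteq> D"
  shows "integrable lborel (\<lambda>t. indicator {a..b} t *\<^sub>R (x' t *\<^sub>R mollify m G1 (c t) + y' t *\<^sub>R mollify m G2 (c t)))"
    and "mollify m F (c b) - mollify m F (c a)
      = (\<integral>t. indicator {a..b} t *\<^sub>R (x' t *\<^sub>R mollify m G1 (c t) + y' t *\<^sub>R mollify m G2 (c t)) \<partial>lborel)"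
proof -
  note Fm[measurable] = locally_L1_measurable[OF F]
  have cx: "continuous_on S x" and cy: "continuous_on S y" for S
    using x y by (auto intro!: DERIV_continuous_on intro: has_field_derivative_at_within)
  have [measurable]: "x \<in> borel_measurable borel" "y \<in> borel_measurable borel"
    "x' \<in> borel_measurable borel" "y' \<in> borel_measurable borel"
    by (intro borel_measurable_continuous_onI cx cy cont')+
  \<comment> \<open>The derivative \<open>\<Psi>\<close> of the kernel along the curve, split into its two partial derivatives.\<close>
  define P where "P t w = mollifier1' m (x t - Re w) * mollifier1 m (y t - Im w)" for t w
  define R where "R t w = mollifier1 m (x t - Re w) * mollifier1' m (y t - Im w)" for t w
  define \<Psi> where "\<Psi> t w = x' t * P t w + y' t * R t w" for t w
  have cc: "continuous_on S c" for S
    unfolding c_def by (intro continuous_on_Complex cx cy)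
  \<comment> \<open>A compact set that contains the supports of all kernels along the curve.\<close>
  define K where "K = {u + v | u v. u \<in> c ` {a..b} \<and> v \<in> cball 0 (2 / real (Suc m))}"
  have K: "compact K" unfolding K_def
    by (intro compact_sums compact_continuous_image cc) auto
  have KD: "K \<subseteq> D"
  proof
    fix v assume "v \<in> K"
    then obtain t u where "t \<in> {a..b}" "v = c t + u" "norm u \<le> 2 / real (Suc m)" by (auto simp: K_def)
    then show "v \<in> D" using near[of t] by (auto simp: dist_norm subset_iff simp del: of_nat_Suc)
  qed
  have Km[measurable]: "K \<in> sets borel" using K by (rule borel_compact)
  have supp: "w \<in> K" if "t \<in> {a..b}" "x t - Re w \<in> {0..1 / real (Suc m)}" "y t - Im w \<in> {0..1 / real (Suc m)}" for t w
  proof -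
    have "norm (w - c t) \<le> \<bar>Re (w - c t)\<bar> + \<bar>Im (w - c t)\<bar>" by (rule cmod_le)
    also have "\<dots> \<le> 1 / real (Suc m) + 1 / real (Suc m)"
      using that by (intro add_mono) (auto simp: c_def)
    finally have "w - c t \<in> cball 0 (2 / real (Suc m))" by simp
    moreover have "w = c t + (w - c t)" by simp
    ultimately show ?thesis unfolding K_def using that(1) by blast
  qed
  have PR0: "P t w = 0" "R t w = 0" if "t \<in> {a..b}" "w \<notin> K" for t w
  proof -
    have "x t - Re w \<notin> {0..1 / real (Suc m)} \<or> y t - Im w \<notin> {0..1 / real (Suc m)}"
      using supp[OF that(1), of w] that(2) by blast
    then show "P t w = 0" "R t w = 0"
      unfolding P_def R_def mult_eq_0_iff using mollifier1_zero mollifier1'_zero by blast+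
  qed
  obtain B1 where B1: "0 \<le> B1" "\<And>t. t \<in> {0..1 / real (Suc m)} \<Longrightarrow> \<bar>mollifier1' m t\<bar> \<le> B1"
    using bounded_on_compact_real[OF continuous_mollifier1'] by metis
  have B1': "\<bar>mollifier1' m t\<bar> \<le> B1" for t
    using B1 mollifier1'_zero[of t m] by (cases "t \<in> {0..1 / real (Suc m)}") auto
  obtain Bx where Bx: "0 \<le> Bx" "\<And>t. t \<in> {a..b} \<Longrightarrow> \<bar>x' t\<bar> \<le> Bx"
    using bounded_on_compact_real[of a b x'] cont' by (metis continuous_on_subset subset_UNIV)
  obtain By where By: "0 \<le> By" "\<And>t. t \<in> {a..b} \<Longrightarrow> \<bar>y' t\<bar> \<le> By"
    using bounded_on_compact_real[of a b y'] cont' by (metis continuous_on_subset subset_UNIV)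
  define B0 where "B0 = real (Suc m) / bump_mass"
  have B0: "0 \<le> B0" "\<bar>mollifier1 m t\<bar> \<le> B0" for t
    using mollifier1_bound[of m t] mollifier1_nonneg[of m t] bump_mass_pos by (auto simp: B0_def)
  have PB: "\<bar>P t w\<bar> \<le> B1 * B0" "\<bar>R t w\<bar> \<le> B0 * B1" for t w
    unfolding P_def R_def abs_mult using B1 B1' B0 by (auto intro!: mult_mono)
  define B where "B = Bx * (B1 * B0) + By * (B0 * B1)"
  have B: "\<bar>\<Psi> t w\<bar> \<le> B" if "t \<in> {a..b}" for t w
  proof -
    have "\<bar>\<Psi> t w\<bar> \<le> \<bar>x' t * P t w\<bar> + \<bar>y' t * R t w\<bar>" unfolding \<Psi>_def by (rule abs_triangle_ineq)
    also have "\<dots> \<le> B" unfolding B_def abs_mult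
      using Bx By PB B1 B0(1) that by (intro add_mono mult_mono) auto
    finally show ?thesis .
  qed
  have Bnn: "0 \<le> B" using Bx By B1 B0(1) by (simp add: B_def)
  have int_prod: "integrable (lborel \<Otimes>\<^sub>M lborel) (\<lambda>(t, w). indicator {a..b} t *\<^sub>R (\<Psi> t w *\<^sub>R F w))"
  proof (rule integrableI_bounded)
    show "(\<lambda>(t, w). indicator {a..b} t *\<^sub>R (\<Psi> t w *\<^sub>R F w)) \<in> borel_measurable (lborel \<Otimes>\<^sub>M lborel)"
      unfolding \<Psi>_def P_def R_def by measurable
    have "(\<integral>\<^sup>+ p. ennreal (norm (case p of (t, w) \<Rightarrow> indicator {a..b} t *\<^sub>R (\<Psi> t w *\<^sub>R F w))) \<partial>(lborel \<Otimes>\<^sub>M lborel))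
       \<le> (\<integral>\<^sup>+ p. (case p of (t, w) \<Rightarrow> indicator {a..b} t * (ennreal B * (ennreal (norm (F w)) * indicator K w))) \<partial>(lborel \<Otimes>\<^sub>M lborel))"
    proof (intro nn_integral_mono)
      fix p :: "real \<times> complex"
      obtain t w where p: "p = (t, w)" by force
      have "ennreal (norm (indicator {a..b} t *\<^sub>R (\<Psi> t w *\<^sub>R F w)))
        \<le> indicator {a..b} t * (ennreal B * (ennreal (norm (F w)) * indicator K w))"
      proof (cases "t \<in> {a..b} \<and> w \<in> K")
        case True
        then show ?thesis using B[of t w] Bnn
          by (auto simp flip: ennreal_mult intro!: ennreal_leI mult_right_mono)
      next
        case False
        then show ?thesis using PR0[of t w] by (auto simp: \<Psi>_def indicator_def)
      qed
      then show "ennreal (norm (case p of (t, w) \<Rightarrow> indicator {a..b} t *\<^sub>R (\<Psi> t w *\<^sub>R F w)))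
        \<le> (case p of (t, w) \<Rightarrow> indicator {a..b} t * (ennreal B * (ennreal (norm (F w)) * indicator K w)))"
        unfolding p prod.case .
    qed
    also have "\<dots> = (\<integral>\<^sup>+ t. \<integral>\<^sup>+ w. indicator {a..b} t * (ennreal B * (ennreal (norm (F w)) * indicator K w)) \<partial>lborel \<partial>lborel)"
      by (subst lborel.nn_integral_fst[symmetric]) auto
    also have "\<dots> = ennreal (b - a) * (ennreal B * (\<integral>\<^sup>+ w\<in>K. ennreal (norm (F w)) \<partial>lborel))"
      using ab by (simp add: nn_integral_cmult nn_integral_multc)
    also have "\<dots> < \<infinity>"
      using locally_L1_finite[OF F K KD] by (simp add: ennreal_mult_less_top)
    finally show "(\<integral>\<^sup>+ p. ennreal (norm (case p of (t, w) \<Rightarrow> indicator {a..b} t *\<^sub>R (\<Psi> t w *\<^sub>R F w))) \<partial>(lborel \<Otimes>\<^sub>M lborel)) < \<infinity>" .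
  qed
  have moll_int: "integrable lborel (\<lambda>w. mollifier m (c t - w) *\<^sub>R F w)" if "t \<in> {a..b}" for t
    using near[OF that] by (intro integrable_mollifier_mult Fm locally_L1_finite[OF F]) auto
  have \<Psi>_cont: "continuous_on {a..b} (\<lambda>t. \<Psi> t w)" for w
    unfolding \<Psi>_def P_def R_def
    by (intro continuous_intros continuous_on_compose2[OF continuous_mollifier1[of UNIV]]
        continuous_on_compose2[OF continuous_mollifier1'[of UNIV]] cx cy
        continuous_on_subset[OF cont'(1)] continuous_on_subset[OF cont'(2)]) auto
  have \<Psi>_int: "integrable lborel (\<lambda>t. indicator {a..b} t *\<^sub>R \<Psi> t w)" for w
    by (rule borel_integrable_compact[OF compact_Icc \<Psi>_cont])
  have FTC: "mollifier m (c b - w) - mollifier m (c a - w) = (\<integral>t. indicator {a..b} t *\<^sub>R \<Psi> t w \<partial>lborel)" for w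
  proof -
    have "(\<integral>t. indicator {a..b} t *\<^sub>R \<Psi> t w \<partial>lborel)
        = mollifier1 m (x b - Re w) * mollifier1 m (y b - Im w) - mollifier1 m (x a - Re w) * mollifier1 m (y a - Im w)"
    proof (rule integral_FTC_atLeastAtMost[OF ab])
      fix t
      have 1: "((\<lambda>t. mollifier1 m (x t - Re w)) has_real_derivative mollifier1' m (x t - Re w) * x' t) (at t)"
        by (rule DERIV_chain2[OF mollifier1_deriv]) (auto intro!: derivative_eq_intros x)
      have 2: "((\<lambda>t. mollifier1 m (y t - Im w)) has_real_derivative mollifier1' m (y t - Im w) * y' t) (at t)"
        by (rule DERIV_chain2[OF mollifier1_deriv]) (auto intro!: derivative_eq_intros y)
      have "((\<lambda>t. mollifier1 m (x t - Re w) * mollifier1 m (y t - Im w)) has_real_derivative \<Psi> t w) (at t)"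
        using DERIV_mult[OF 1 2] by (simp add: \<Psi>_def P_def R_def algebra_simps)
      then show "((\<lambda>t. mollifier1 m (x t - Re w) * mollifier1 m (y t - Im w)) has_vector_derivative \<Psi> t w) (at t within {a..b})"
        by (simp add: has_real_derivative_iff_has_vector_derivative has_vector_derivative_at_within)
    next
      show "continuous_on {a..b} (\<lambda>t. \<Psi> t w)" by (rule \<Psi>_cont)
    qed
    then show ?thesis by (simp add: mollifier_def c_def)
  qed
  have "mollify m F (c b) - mollify m F (c a)
      = (\<integral>w. (mollifier m (c b - w) - mollifier m (c a - w)) *\<^sub>R F w \<partial>lborel)"
    unfolding mollify_def using moll_int[of a] moll_int[of b] ab
    by (simp add: scaleR_diff_left)
  also have "\<dots> = (\<integral>w. (\<integral>t. indicator {a..b} t *\<^sub>R (\<Psi> t w *\<^sub>R F w) \<partial>lborel) \<partial>lborel)"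
    unfolding FTC integral_scaleR_left[OF \<Psi>_int, symmetric] scaleR_scaleR[symmetric]
    by (simp only: real_scaleR_def scaleR_scaleR)
  also have "\<dots> = (\<integral>t. (\<integral>w. indicator {a..b} t *\<^sub>R (\<Psi> t w *\<^sub>R F w) \<partial>lborel) \<partial>lborel)"
    by (rule lborel_pair.Fubini_integral[OF int_prod])
  finally have diff: "mollify m F (c b) - mollify m F (c a)
      = (\<integral>t. (\<integral>w. indicator {a..b} t *\<^sub>R (\<Psi> t w *\<^sub>R F w) \<partial>lborel) \<partial>lborel)" .
  have inner: "(\<lambda>t. \<integral>w. indicator {a..b} t *\<^sub>R (\<Psi> t w *\<^sub>R F w) \<partial>lborel)
      = (\<lambda>t. indicator {a..b} t *\<^sub>R (x' t *\<^sub>R mollify m G1 (c t) + y' t *\<^sub>R mollify m G2 (c t)))"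
  proof
    fix t
    show "(\<integral>w. indicator {a..b} t *\<^sub>R (\<Psi> t w *\<^sub>R F w) \<partial>lborel)
      = indicator {a..b} t *\<^sub>R (x' t *\<^sub>R mollify m G1 (c t) + y' t *\<^sub>R mollify m G2 (c t))"
    proof (cases "t \<in> {a..b}")
      case True
      have PRint: "integrable lborel (\<lambda>w. Q w *\<^sub>R F w)"
        if Q: "Q \<in> borel_measurable borel" "\<And>w. \<bar>Q w\<bar> \<le> C" "\<And>w. w \<notin> K \<Longrightarrow> Q w = 0" for Q C
      proof (rule integrableI_bounded)
        have C: "0 \<le> C" using Q(2)[of 0] by simp
        have "(\<integral>\<^sup>+ w. ennreal (norm (Q w *\<^sub>R F w)) \<partial>lborel) \<le> (\<integral>\<^sup>+ w. ennreal C * (ennreal (norm (F w)) * indicator K w) \<partial>lborel)"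
        proof (intro nn_integral_mono)
          fix w show "ennreal (norm (Q w *\<^sub>R F w)) \<le> ennreal C * (ennreal (norm (F w)) * indicator K w)"
            using Q(2)[of w] Q(3)[of w] C by (cases "w \<in> K")
              (auto simp flip: ennreal_mult intro!: ennreal_leI mult_right_mono)
        qed
        also have "\<dots> = ennreal C * (\<integral>\<^sup>+ w\<in>K. ennreal (norm (F w)) \<partial>lborel)" by (rule nn_integral_cmult) measurable
        also have "\<dots> < \<infinity>" using locally_L1_finite[OF F K KD] by (simp add: ennreal_mult_less_top)
        finally show "(\<integral>\<^sup>+ w. ennreal (norm (Q w *\<^sub>R F w)) \<partial>lborel) < \<infinity>" .
      qed (use Q in measurable)
      have Pi: "integrable lborel (\<lambda>w. P t w *\<^sub>R F w)"
        by (rule PRint[OF _ PB(1) PR0(1)[OF True]]) (simp add: P_def)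
      have Ri: "integrable lborel (\<lambda>w. R t w *\<^sub>R F w)"
        by (rule PRint[OF _ PB(2) PR0(2)[OF True]]) (simp add: R_def)
      note T = mollifier_test_function[OF near[OF True]]
      have "- (\<integral>w. P t w *\<^sub>R F w \<partial>lborel) = - mollify m G1 (c t)"
      proof -
        have "(\<integral>w. dir_deriv 1 (\<lambda>w. mollifier m (c t - w)) w *\<^sub>R F w \<partial>lborel) = - mollify m G1 (c t)"
          using W T(1) unfolding weak_gradient_def mollify_def by blast
        moreover have "(\<integral>w. dir_deriv 1 (\<lambda>w. mollifier m (c t - w)) w *\<^sub>R F w \<partial>lborel)
            = (\<integral>w. - (P t w *\<^sub>R F w) \<partial>lborel)"
          unfolding T(2) by (intro Bochner_Integration.integral_cong refl) (simp add: P_def c_def)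
        ultimately show ?thesis by simp
      qed
      moreover have "- (\<integral>w. R t w *\<^sub>R F w \<partial>lborel) = - mollify m G2 (c t)"
      proof -
        have "(\<integral>w. dir_deriv \<i> (\<lambda>w. mollifier m (c t - w)) w *\<^sub>R F w \<partial>lborel) = - mollify m G2 (c t)"
          using W T(1) unfolding weak_gradient_def mollify_def by blast
        moreover have "(\<integral>w. dir_deriv \<i> (\<lambda>w. mollifier m (c t - w)) w *\<^sub>R F w \<partial>lborel)
            = (\<integral>w. - (R t w *\<^sub>R F w) \<partial>lborel)"
          unfolding T(3) by (intro Bochner_Integration.integral_cong refl) (simp add: R_def c_def)
        ultimately show ?thesis by simp
      qed
      moreover have "(\<integral>w. \<Psi> t w *\<^sub>R F w \<partial>lborel)
        = x' t *\<^sub>R (\<integral>w. P t w *\<^sub>R F w \<partial>lborel) + y' t *\<^sub>R (\<integral>w. R t w *\<^sub>R F w \<partial>lborel)"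
      proof -
        have "(\<integral>w. \<Psi> t w *\<^sub>R F w \<partial>lborel) = (\<integral>w. x' t *\<^sub>R (P t w *\<^sub>R F w) + y' t *\<^sub>R (R t w *\<^sub>R F w) \<partial>lborel)"
          by (simp add: \<Psi>_def scaleR_add_left)
        also have "\<dots> = (\<integral>w. x' t *\<^sub>R (P t w *\<^sub>R F w) \<partial>lborel) + (\<integral>w. y' t *\<^sub>R (R t w *\<^sub>R F w) \<partial>lborel)"
          by (rule Bochner_Integration.integral_add) (intro integrable_scaleR_right Pi Ri)+
        also have "\<dots> = x' t *\<^sub>R (\<integral>w. P t w *\<^sub>R F w \<partial>lborel) + y' t *\<^sub>R (\<integral>w. R t w *\<^sub>R F w \<partial>lborel)"
          by (simp only: integral_scaleR_right)
        finally show ?thesis .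
      qed
      ultimately show ?thesis using True by simp
    qed simp
  qed
  show "mollify m F (c b) - mollify m F (c a)
      = (\<integral>t. indicator {a..b} t *\<^sub>R (x' t *\<^sub>R mollify m G1 (c t) + y' t *\<^sub>R mollify m G2 (c t)) \<partial>lborel)"
    unfolding diff inner ..
  show "integrable lborel (\<lambda>t. indicator {a..b} t *\<^sub>R (x' t *\<^sub>R mollify m G1 (c t) + y' t *\<^sub>R mollify m G2 (c t)))"
    using lborel_pair.integrable_fst[OF int_prod] unfolding inner .
qed

section \<open>Classical and weak partial derivatives\<close>

lemma lebesgue_borel_representative:
  fixes g :: "complex \<Rightarrow> complex"
  assumes "g \<in> borel_measurable lebesgue"
  obtains G where "G \<in> borel_measurable borel" "AE z in lborel. g z = G z"
proof -
  have "(\<lambda>z. Re (g z)) \<in> borel_measurable lebesgue" "(\<lambda>z. Im (g z)) \<in> borel_measurable lebesgue"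
    using assms by measurable
  then obtain R I where RI: "R \<in> borel_measurable lborel" "AE z in lborel. Re (g z) = R z"
    "I \<in> borel_measurable lborel" "AE z in lborel. Im (g z) = I z"
    by (blast dest: completion_ex_borel_measurable_real)
  show thesis
  proof
    have [measurable]: "R \<in> borel_measurable borel" "I \<in> borel_measurable borel" using RI by simp_all
    show "(\<lambda>z. of_real (R z) + \<i> * of_real (I z)) \<in> borel_measurable borel" by measurable
    show "AE z in lborel. g z = of_real (R z) + \<i> * of_real (I z)"
      using RI(2,4) by eventually_elim (simp add: complex_eq_iff)
  qed
qed

text \<open>Along an exhaustion of \<open>D\<close> by compact sets \<open>g\<close> is a limit of measurable
  functions.\<close>

lemma locally_integrable_representative:
  assumes D: "open D" and g: "locally_integrable_on g D"
  obtains G where "locally_L1 D G" "AE z in lborel. z \<in> D \<longrightarrow> g z = G z"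
    "(\<lambda>z. indicator D z *\<^sub>R g z) \<in> borel_measurable lebesgue"
proof -
  obtain C :: "nat \<Rightarrow> complex set" where C: "\<And>n. compact (C n)" "\<And>n. C n \<subseteq> D"
    "\<And>n. C n \<subseteq> interior (C (Suc n))" "\<Union>(range C) = D"
    using open_Union_compact_subsets[OF D] by metis
  have incr: "C m \<subseteq> C n" if "m \<le> n" for m n
    using C(3) interior_subset by (intro lift_Suc_mono_le[OF _ that]) blast
  have si: "set_integrable lebesgue K g" if "compact K" "K \<subseteq> D" for K
    using g that by (auto simp: locally_integrable_on_def)
  have m: "(\<lambda>z. indicator D z *\<^sub>R g z) \<in> borel_measurable lebesgue"
  proof (rule borel_measurable_LIMSEQ_metric)
    show "(\<lambda>z. indicator (C n) z *\<^sub>R g z) \<in> borel_measurable lebesgue" for n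
      using si[OF C(1,2)] unfolding set_integrable_def by (rule borel_measurable_integrable)
    fix z
    show "(\<lambda>n. indicator (C n) z *\<^sub>R g z) \<longlonglongrightarrow> indicator D z *\<^sub>R g z"
    proof (cases "z \<in> D")
      case True
      then obtain n0 where "z \<in> C n0" using C(4) by auto
      then have "\<forall>n\<ge>n0. indicator (C n) z *\<^sub>R g z = indicator D z *\<^sub>R g z"
        using incr True by (auto simp: indicator_def)
      then show ?thesis
        by (intro tendsto_eventually) (simp only: eventually_sequentially, blast)
    next
      case False
      then have "z \<notin> C n" for n using C(2) by auto
      then show ?thesis using False by simp
    qed
  qed
  obtain G where G: "G \<in> borel_measurable borel" "AE z in lborel. indicator D z *\<^sub>R g z = G z"
    using lebesgue_borel_representative[OF m] .
  have ae: "AE z in lborel. z \<in> D \<longrightarrow> g z = G z" using G(2) by eventually_elim auto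
  have "locally_L1 D G"
    unfolding locally_L1_def
  proof (intro conjI allI impI G(1))
    fix K assume K: "compact K \<and> K \<subseteq> D"
    have "(\<integral>\<^sup>+ z\<in>K. ennreal (norm (G z)) \<partial>lborel) = (\<integral>\<^sup>+ z. ennreal (norm (indicator K z *\<^sub>R g z)) \<partial>lborel)"
      using ae K by (intro nn_integral_cong_AE) (auto elim!: eventually_mono simp: indicator_def)
    also have "\<dots> = (\<integral>\<^sup>+ z. ennreal (norm (indicator K z *\<^sub>R g z)) \<partial>lebesgue)"
      by (rule nn_integral_completion[symmetric])
    also have "\<dots> < \<infinity>"
      using si K unfolding set_integrable_def integrable_iff_bounded by blast
    finally show "(\<integral>\<^sup>+ z\<in>K. ennreal (norm (G z)) \<partial>lborel) < \<infinity>" .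
  qed
  then show thesis using that ae m by blast
qed

lemma test_function_zero: "test_function D \<phi> \<Longrightarrow> z \<notin> D \<Longrightarrow> \<phi> z = 0"
  unfolding test_function_def using closure_subset[of "{z. \<phi> z \<noteq> 0}"] by blast

lemma test_function_measurable:
  assumes "test_function D \<phi>" "v \<in> {1, \<i>}"
  shows "\<phi> \<in> borel_measurable borel" "dir_deriv v \<phi> \<in> borel_measurable borel"
proof -
  have "Ck_function 0 \<phi>" "Ck_function (Suc 0) \<phi>" using assms by (auto simp: test_function_def simp del: Ck_function.simps)
  then show "\<phi> \<in> borel_measurable borel" "dir_deriv v \<phi> \<in> borel_measurable borel"
    using assms(2) by (auto intro!: borel_measurable_continuous_onI)
qed

text \<open>Changing the weak derivatives on null sets does not affect the integrals, and test functions vanish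
  outside \<open>D\<close>, so that these may be taken over the plane.\<close>

lemma W11_representatives:
  assumes D: "open D" and cont: "continuous_on D f" and W: "W11_loc D f"
  defines "F \<equiv> \<lambda>z. indicator D z *\<^sub>R f z"
  obtains G1 G2 where "locally_L1 D F" "locally_L1 D G1" "locally_L1 D G2" "weak_gradient D F G1 G2"
proof -
  have Fm[measurable]: "F \<in> borel_measurable borel"
    unfolding F_def by (rule borel_measurable_continuous_on_indicator[OF _ cont]) (use D in auto)
  have "locally_L1 D F"
    unfolding locally_L1_def
  proof (intro conjI allI impI Fm)
    fix K assume K: "compact K \<and> K \<subseteq> D"
    then have [measurable]: "K \<in> sets borel" by (auto intro: borel_compact)
    have "bounded (f ` K)"
      using K by (intro compact_imp_bounded compact_continuous_image continuous_on_subset[OF cont]) auto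
    then obtain B where B: "\<forall>v\<in>f ` K. norm v \<le> B" unfolding bounded_iff by blast
    have "(\<integral>\<^sup>+ z\<in>K. ennreal (norm (F z)) \<partial>lborel) \<le> (\<integral>\<^sup>+ z. ennreal B * indicator K z \<partial>lborel)"
      using B K by (intro nn_integral_mono) (auto simp: indicator_def F_def intro!: ennreal_leI)
    also have "\<dots> = ennreal B * emeasure lborel K" by (simp add: nn_integral_cmult_indicator)
    also have "\<dots> < \<infinity>" using K emeasure_compact_finite[of K] by (simp add: ennreal_mult_less_top)
    finally show "(\<integral>\<^sup>+ z\<in>K. ennreal (norm (F z)) \<partial>lborel) < \<infinity>" .
  qed
  have rep: "\<exists>G. locally_L1 D G \<and> (\<forall>\<phi>. test_function D \<phi> \<longrightarrow>
      (\<integral>w. dir_deriv v \<phi> w *\<^sub>R F w \<partial>lborel) = - (\<integral>w. \<phi> w *\<^sub>R G w \<partial>lborel))" if v: "v \<in> {1, \<i>}" for v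
  proof -
    obtain g where g: "locally_integrable_on g D" "weak_dir_deriv D v f g"
      using W v unfolding W11_loc_def by blast
    obtain G where G: "locally_L1 D G" "AE z in lborel. z \<in> D \<longrightarrow> g z = G z"
      "(\<lambda>z. indicator D z *\<^sub>R g z) \<in> borel_measurable lebesgue"
      using locally_integrable_representative[OF D g(1)] .
    note Gm[measurable] = locally_L1_measurable[OF G(1)]
    have "(\<integral>w. dir_deriv v \<phi> w *\<^sub>R F w \<partial>lborel) = - (\<integral>w. \<phi> w *\<^sub>R G w \<partial>lborel)" if \<phi>: "test_function D \<phi>" for \<phi>
    proof -
      note [measurable] = test_function_measurable[OF \<phi> v]
      have \<phi>l: "\<phi> \<in> borel_measurable lebesgue"
        by (rule measurable_completion) simp
      have "(\<integral>w. dir_deriv v \<phi> w *\<^sub>R F w \<partial>lborel) = (\<integral>w. dir_deriv v \<phi> w *\<^sub>R F w \<partial>lebesgue)"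
        by (rule integral_completion[symmetric]) measurable
      also have "\<dots> = (LINT z:D|lebesgue. dir_deriv v \<phi> z *\<^sub>R f z)"
        unfolding set_lebesgue_integral_def
        by (intro Bochner_Integration.integral_cong refl) (auto simp: F_def indicator_def)
      also have "\<dots> = - (LINT z:D|lebesgue. \<phi> z *\<^sub>R g z)"
        using g(2) \<phi> unfolding weak_dir_deriv_def by blast
      also have "(LINT z:D|lebesgue. \<phi> z *\<^sub>R g z) = (\<integral>w. \<phi> w *\<^sub>R G w \<partial>lebesgue)"
        unfolding set_lebesgue_integral_def
      proof (rule integral_cong_AE)
        have "(\<lambda>z. \<phi> z *\<^sub>R (indicator D z *\<^sub>R g z)) \<in> borel_measurable lebesgue"
          using \<phi>l G(3) by (rule borel_measurable_scaleR)
        then show "(\<lambda>z. indicator D z *\<^sub>R \<phi> z *\<^sub>R g z) \<in> borel_measurable lebesgue"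
          by (simp add: mult.commute)
        show "(\<lambda>w. \<phi> w *\<^sub>R G w) \<in> borel_measurable lebesgue"
          by (rule measurable_completion) simp
        show "AE z in lebesgue. indicator D z *\<^sub>R \<phi> z *\<^sub>R g z = \<phi> z *\<^sub>R G z"
          using AE_completion[OF G(2)] by eventually_elim (use test_function_zero[OF \<phi>] in \<open>auto simp: indicator_def\<close>)
      qed
      also have "(\<integral>w. \<phi> w *\<^sub>R G w \<partial>lebesgue) = (\<integral>w. \<phi> w *\<^sub>R G w \<partial>lborel)"
        by (rule integral_completion) measurable
      finally show ?thesis .
    qed
    then show ?thesis using G(1) by blast
  qed
  obtain G1 G2 where "locally_L1 D G1" "locally_L1 D G2" "weak_gradient D F G1 G2"
    using rep[of 1] rep[of \<i>] unfolding weak_gradient_def by auto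
  with \<open>locally_L1 D F\<close> show thesis using that by blast
qed

lemma measurable_mollify [measurable]:
  assumes [measurable]: "G \<in> borel_measurable borel"
  shows "mollify m G \<in> borel_measurable borel"
proof -
  have "(\<lambda>z. \<integral>w. mollifier m (z - w) *\<^sub>R G w \<partial>lborel) \<in> borel_measurable borel"
    by measurable
  then show ?thesis by (simp add: mollify_def[abs_def])
qed

lemma norm_integral_le_nn_integral:
  fixes f :: "real \<Rightarrow> complex"
  assumes "integrable lborel (\<lambda>t. indicator A t *\<^sub>R f t)"
  shows "ennreal (norm (\<integral>t. indicator A t *\<^sub>R f t \<partial>lborel)) \<le> (\<integral>\<^sup>+ t\<in>A. ennreal (norm (f t)) \<partial>lborel)"
proof -
  have "ennreal (norm (\<integral>t. indicator A t *\<^sub>R f t \<partial>lborel)) \<le> (\<integral>\<^sup>+ t. ennreal (norm (indicator A t *\<^sub>R f t)) \<partial>lborel)"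
    by (rule integral_norm_bound_ennreal[OF assms])
  also have "\<dots> = (\<integral>\<^sup>+ t\<in>A. ennreal (norm (f t)) \<partial>lborel)"
    by (intro nn_integral_cong) (auto simp: indicator_def)
  finally show ?thesis .
qed

lemma mollify_difference_quotient:
  assumes D: "open D" and F: "locally_L1 D F" and W: "weak_gradient D F G1 G2"
    and G: "v = 1 \<and> G = G1 \<or> v = \<i> \<and> G = G2"
    and h: "0 < h" and near: "\<And>t. t \<in> {0..h} \<Longrightarrow> cball (z + of_real t * v) (2 / real (Suc m)) \<subseteq> D"
  shows "ennreal (norm ((1 / h) *\<^sub>R (mollify m F (z + of_real h * v) - mollify m F z) - g))
    \<le> ennreal (1 / h) * (\<integral>\<^sup>+ t\<in>{0..h}. ennreal (norm (mollify m G (z + of_real t * v) - g)) \<partial>lborel)"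
proof -
  have c: "Complex (Re z + t * Re v) (Im z + t * Im v) = z + of_real t * v" for t
    by (simp add: complex_eq_iff)
  have E: "Re v *\<^sub>R mollify m G1 w + Im v *\<^sub>R mollify m G2 w = mollify m G w" for w
    using G by auto
  have "integrable lborel (\<lambda>t. indicator {0..h} t *\<^sub>R mollify m G (z + of_real t * v))
    \<and> mollify m F (z + of_real h * v) - mollify m F z = (\<integral>t. indicator {0..h} t *\<^sub>R mollify m G (z + of_real t * v) \<partial>lborel)"
  proof -
    have dx: "((\<lambda>t. Re z + t * Re v) has_real_derivative Re v) (at t)"
      and dy: "((\<lambda>t. Im z + t * Im v) has_real_derivative Im v) (at t)" for t
      by (auto intro!: derivative_eq_intros)
    have near': "cball (Complex (Re z + t * Re v) (Im z + t * Im v)) (2 / real (Suc m)) \<subseteq> D" if "t \<in> {0..h}" for t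
      unfolding c by (rule near[OF that])
    from mollify_curve[OF D F W less_imp_le[OF h] dx dy continuous_on_const continuous_on_const near']
    show ?thesis unfolding c E by simp
  qed
  then have int: "integrable lborel (\<lambda>t. indicator {0..h} t *\<^sub>R mollify m G (z + of_real t * v))"
    and eq: "mollify m F (z + of_real h * v) - mollify m F z = (\<integral>t. indicator {0..h} t *\<^sub>R mollify m G (z + of_real t * v) \<partial>lborel)"
    by auto
  have int0: "integrable lborel (\<lambda>t. indicator {0..h} t *\<^sub>R g)"
    using h by (intro integrable_scaleR_left) auto
  have int1: "integrable lborel (\<lambda>t. indicator {0..h} t *\<^sub>R (mollify m G (z + of_real t * v) - g))"
    unfolding scaleR_diff_right by (intro Bochner_Integration.integrable_diff int int0)
  have "(1 / h) *\<^sub>R (mollify m F (z + of_real h * v) - mollify m F z) - g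
      = (1 / h) *\<^sub>R ((\<integral>t. indicator {0..h} t *\<^sub>R mollify m G (z + of_real t * v) \<partial>lborel) - (\<integral>t. indicator {0..h} t *\<^sub>R g \<partial>lborel))"
    unfolding eq using h by (simp add: scaleR_diff_right)
  also have "\<dots> = (1 / h) *\<^sub>R (\<integral>t. indicator {0..h} t *\<^sub>R (mollify m G (z + of_real t * v) - g) \<partial>lborel)"
    by (simp only: scaleR_diff_right[of "indicator {0..h} _ :: real"] Bochner_Integration.integral_diff[OF int int0])
  finally have "norm ((1 / h) *\<^sub>R (mollify m F (z + of_real h * v) - mollify m F z) - g)
      = 1 / h * norm (\<integral>t. indicator {0..h} t *\<^sub>R (mollify m G (z + of_real t * v) - g) \<partial>lborel)"
    using h by simp
  then have "ennreal (norm ((1 / h) *\<^sub>R (mollify m F (z + of_real h * v) - mollify m F z) - g))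
     = ennreal (1 / h) * ennreal (norm (\<integral>t. indicator {0..h} t *\<^sub>R (mollify m G (z + of_real t * v) - g) \<partial>lborel))"
    using h by (simp only: ennreal_mult' zero_le_divide_1_iff less_imp_le)
  then show ?thesis using norm_integral_le_nn_integral[OF int1] by (auto intro: mult_left_mono)
qed

text \<open>For the mollified map the difference quotient is the average of the mollified derivative over a short
  segment, so it is close to \<open>G\<close> in the mean by \<open>mollify_L1\<close>, uniformly in the mollification parameter. Fatou's
  lemma removes the mollification.\<close>

lemma difference_quotient_L1:
  assumes D: "open D" and F: "locally_L1 D F" and cont: "continuous_on D F" and W: "weak_gradient D F G1 G2"
    and G: "v = 1 \<and> G = G1 \<or> v = \<i> \<and> G = G2" and GL: "locally_L1 D G"
    and K: "compact K" "K \<subseteq> D" and e: "0 < (e::real)"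
  shows "\<forall>\<^sub>F n in sequentially. (\<integral>\<^sup>+ z\<in>K. ennreal (norm (real (Suc n) *\<^sub>R (F (z + of_real (1 / real (Suc n)) * v) - F z) - G z)) \<partial>lborel) \<le> ennreal e"
proof -
  note [measurable] = locally_L1_measurable[OF F] locally_L1_measurable[OF GL]
  have v1: "norm v = 1" using G by auto
  have Km[measurable]: "K \<in> sets borel" using K by (auto intro: borel_compact)
  obtain \<delta> K' where K': "0 < \<delta>" "compact K'" "K \<subseteq> K'" "K' \<subseteq> D" "\<And>x y. x \<in> K \<Longrightarrow> norm (y - x) \<le> \<delta> \<Longrightarrow> y \<in> K'"
    using compact_neighbourhood[OF K(1) D K(2)] by metis
  obtain d where d: "0 < d" "\<And>m s. norm s + 2 / real (Suc m) < d \<Longrightarrow>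
     (\<integral>\<^sup>+ z\<in>K. ennreal (norm (mollify m G (z + s) - G z)) \<partial>lborel) \<le> ennreal e"
    using mollify_L1[OF D GL K e] by blast
  obtain N where N: "inverse (real (Suc N)) < min d \<delta> / 3" using reals_Archimedean[of "min d \<delta> / 3"] d K' by auto
  show ?thesis
  proof (rule eventually_sequentiallyI[of N])
    fix n assume n: "N \<le> n"
    define h where "h = 1 / real (Suc n)"
    have h: "0 < h" "real (Suc n) = 1 / h" by (auto simp: h_def)
    have small: "1 / real (Suc m) < min d \<delta> / 3" if "N \<le> m" for m
    proof -
      have "inverse (real (Suc m)) \<le> inverse (real (Suc N))" using that by simp
      then show ?thesis using N by (simp add: inverse_eq_divide)
    qed
    have hd: "h < min d \<delta> / 3" using small[OF n] by (simp add: h_def)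
    have step: "(\<integral>\<^sup>+ z\<in>K. ennreal (norm ((1 / h) *\<^sub>R (mollify m F (z + of_real h * v) - mollify m F z) - G z)) \<partial>lborel) \<le> ennreal e"
      if m: "N \<le> m" for m
    proof -
      have small2: "norm (of_real t * v) + 2 / real (Suc m) < min d \<delta>" if "t \<in> {0..h}" for t
      proof -
        have "norm (of_real t * v) \<le> h" using that v1 by (simp add: norm_mult)
        then show ?thesis using hd small[OF m] by linarith
      qed
      have "(\<integral>\<^sup>+ z\<in>K. ennreal (norm ((1 / h) *\<^sub>R (mollify m F (z + of_real h * v) - mollify m F z) - G z)) \<partial>lborel)
        \<le> (\<integral>\<^sup>+ z. ennreal (1 / h) * (\<integral>\<^sup>+ t. ennreal (norm (mollify m G (z + of_real t * v) - G z)) * indicator K z * indicator {0..h} t \<partial>lborel) \<partial>lborel)"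
      proof (intro nn_integral_mono)
        fix z
        show "ennreal (norm ((1 / h) *\<^sub>R (mollify m F (z + of_real h * v) - mollify m F z) - G z)) * indicator K z
          \<le> ennreal (1 / h) * (\<integral>\<^sup>+ t. ennreal (norm (mollify m G (z + of_real t * v) - G z)) * indicator K z * indicator {0..h} t \<partial>lborel)"
        proof (cases "z \<in> K")
          case True
          have "cball (z + of_real t * v) (2 / real (Suc m)) \<subseteq> D" if "t \<in> {0..h}" for t
          proof
            fix w assume w: "w \<in> cball (z + of_real t * v) (2 / real (Suc m))"
            have "norm (w - z) = norm (of_real t * v - (z + of_real t * v - w))" by (simp add: algebra_simps)
            also have "\<dots> \<le> norm (of_real t * v) + norm (z + of_real t * v - w)" by (rule norm_triangle_ineq4)
            also have "\<dots> \<le> \<delta>" using w small2[OF that] by (simp add: dist_norm)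
            finally have "w \<in> K'" by (rule K'(5)[OF True])
            then show "w \<in> D" using K'(4) by blast
          qed
          from mollify_difference_quotient[OF D F W G h(1) this, of "G z"] show ?thesis using True by simp
        qed simp
      qed
      also have "\<dots> = ennreal (1 / h) * (\<integral>\<^sup>+ z. \<integral>\<^sup>+ t. ennreal (norm (mollify m G (z + of_real t * v) - G z)) * indicator K z * indicator {0..h} t \<partial>lborel \<partial>lborel)"
        by (rule nn_integral_cmult) measurable
      also have "\<dots> = ennreal (1 / h) * (\<integral>\<^sup>+ t. \<integral>\<^sup>+ z. ennreal (norm (mollify m G (z + of_real t * v) - G z)) * indicator K z * indicator {0..h} t \<partial>lborel \<partial>lborel)"
        by (intro arg_cong[where f = "\<lambda>x. ennreal (1 / h) * x"] lborel_pair.Fubini') measurable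
      also have "\<dots> \<le> ennreal (1 / h) * (\<integral>\<^sup>+ t. ennreal e * indicator {0..h} t \<partial>lborel)"
      proof (intro mult_left_mono nn_integral_mono)
        fix t :: real
        show "(\<integral>\<^sup>+ z. ennreal (norm (mollify m G (z + of_real t * v) - G z)) * indicator K z * indicator {0..h} t \<partial>lborel)
          \<le> ennreal e * indicator {0..h} t"
        proof (cases "t \<in> {0..h}")
          case True
          then show ?thesis using d(2)[of "of_real t * v" m] small2[OF True] by simp
        qed simp
      qed simp
      also have "\<dots> = ennreal e"
        using h e by (simp add: nn_integral_cmult_indicator flip: ennreal_mult)
      finally show ?thesis .
    qed
    have "(\<integral>\<^sup>+ z\<in>K. ennreal (norm (real (Suc n) *\<^sub>R (F (z + of_real (1 / real (Suc n)) * v) - F z) - G z)) \<partial>lborel)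
      = (\<integral>\<^sup>+ z. liminf (\<lambda>m. ennreal (norm ((1 / h) *\<^sub>R (mollify m F (z + of_real h * v) - mollify m F z) - G z)) * indicator K z) \<partial>lborel)"
    proof (intro nn_integral_cong)
      fix z
      show "ennreal (norm (real (Suc n) *\<^sub>R (F (z + of_real (1 / real (Suc n)) * v) - F z) - G z)) * indicator K z
        = liminf (\<lambda>m. ennreal (norm ((1 / h) *\<^sub>R (mollify m F (z + of_real h * v) - mollify m F z) - G z)) * indicator K z)"
      proof (cases "z \<in> K")
        case True
        have "norm (z + of_real h * v - z) \<le> \<delta>" using v1 h hd by (simp add: norm_mult)
        then have "z + of_real h * v \<in> D" using K'(4,5) True by blast
        then have "(\<lambda>m. ennreal (norm ((1 / h) *\<^sub>R (mollify m F (z + of_real h * v) - mollify m F z) - G z)))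
          \<longlonglongrightarrow> ennreal (norm ((1 / h) *\<^sub>R (F (z + of_real h * v) - F z) - G z))"
          using True K(2) by (intro tendsto_ennrealI tendsto_norm tendsto_diff tendsto_scaleR tendsto_const mollify_tendsto[OF D F cont]) auto
        then have "liminf (\<lambda>m. ennreal (norm ((1 / h) *\<^sub>R (mollify m F (z + of_real h * v) - mollify m F z) - G z)))
          = ennreal (norm ((1 / h) *\<^sub>R (F (z + of_real h * v) - F z) - G z))"
          by (intro lim_imp_Liminf) auto
        then show ?thesis using True by (simp add: h(2)[symmetric] h_def[symmetric] del: of_nat_Suc)
      qed (simp add: Liminf_const)
    qed
    also have "\<dots> \<le> liminf (\<lambda>m. \<integral>\<^sup>+ z\<in>K. ennreal (norm ((1 / h) *\<^sub>R (mollify m F (z + of_real h * v) - mollify m F z) - G z)) \<partial>lborel)"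
      by (rule nn_integral_liminf) measurable
    also have "\<dots> \<le> liminf (\<lambda>m::nat. ennreal e)"
      using step by (intro Liminf_mono eventually_sequentiallyI[of N])
    also have "\<dots> = ennreal e" by (simp add: Liminf_const)
    finally show "(\<integral>\<^sup>+ z\<in>K. ennreal (norm (real (Suc n) *\<^sub>R (F (z + of_real (1 / real (Suc n)) * v) - F z) - G z)) \<partial>lborel) \<le> ennreal e" .
  qed
qed

lemma liminf_eq_0_AE:
  fixes u :: "nat \<Rightarrow> 'a \<Rightarrow> ennreal"
  assumes [measurable]: "\<And>n. u n \<in> borel_measurable M"
    and lim: "\<And>e::real. 0 < e \<Longrightarrow> \<forall>\<^sub>F n in sequentially. (\<integral>\<^sup>+ x. u n x \<partial>M) \<le> ennreal e"
  shows "AE x in M. liminf (\<lambda>n. u n x) = 0"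
proof -
  have "(\<integral>\<^sup>+ x. liminf (\<lambda>n. u n x) \<partial>M) \<le> 0"
  proof (rule ennreal_le_epsilon)
    fix e :: real assume e: "0 < e"
    have "(\<integral>\<^sup>+ x. liminf (\<lambda>n. u n x) \<partial>M) \<le> liminf (\<lambda>n. \<integral>\<^sup>+ x. u n x \<partial>M)"
      by (rule nn_integral_liminf) measurable
    also have "\<dots> \<le> liminf (\<lambda>n::nat. ennreal e)"
      by (intro Liminf_mono lim e)
    also have "\<dots> = ennreal e" by (simp add: Liminf_const)
    finally show "(\<integral>\<^sup>+ x. liminf (\<lambda>n. u n x) \<partial>M) \<le> 0 + ennreal e" by simp
  qed
  then have "(\<integral>\<^sup>+ x. liminf (\<lambda>n. u n x) \<partial>M) = 0" by simp
  then show ?thesis by (subst (asm) nn_integral_0_iff_AE) auto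
qed

text \<open>The difference quotients with steps \<open>1 / (n + 1)\<close> converge to the weak derivative in the mean on
  compact sets, hence their distance from it has lower limit 0 almost everywhere; where the classical derivative
  exists, they converge to it.\<close>

theorem partials_eq_weak_AE:
  assumes D: "open D" and F: "locally_L1 D F" and cont: "continuous_on D F" and W: "weak_gradient D F G1 G2"
    and G: "v = 1 \<and> G = G1 \<or> v = \<i> \<and> G = G2" and GL: "locally_L1 D G"
    and fF: "\<And>z. z \<in> D \<Longrightarrow> f z = F z"
  shows "AE z in lborel. z \<in> D \<longrightarrow> has_dir_deriv f v z \<longrightarrow> dir_deriv v f z = G z"
proof -
  note [measurable] = locally_L1_measurable[OF F] locally_L1_measurable[OF GL]
  obtain C :: "nat \<Rightarrow> complex set" where C: "\<And>n. compact (C n)" "\<And>n. C n \<subseteq> D" "\<Union>(range C) = D"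
    using open_Union_compact_subsets[OF D] by metis
  have "AE z in lborel. z \<in> C i \<longrightarrow> has_dir_deriv f v z \<longrightarrow> dir_deriv v f z = G z" for i
  proof -
    define u where "u n z = ennreal (norm (real (Suc n) *\<^sub>R (F (z + of_real (1 / real (Suc n)) * v) - F z) - G z)) * indicator (C i) z" for n z
    have [measurable]: "C i \<in> sets borel" using C by (auto intro: borel_compact)
    have "AE z in lborel. liminf (\<lambda>n. u n z) = 0"
    proof (rule liminf_eq_0_AE)
      show "u n \<in> borel_measurable lborel" for n unfolding u_def by measurable
      show "\<forall>\<^sub>F n in sequentially. (\<integral>\<^sup>+ z. u n z \<partial>lborel) \<le> ennreal e" if "0 < e" for e
        unfolding u_def by (rule difference_quotient_L1[OF D F cont W G GL C(1) C(2) that])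
    qed
    then show ?thesis
    proof eventually_elim
      case (elim z)
      show ?case
      proof (intro impI)
        assume z: "z \<in> C i" and "has_dir_deriv f v z"
        then have "((\<lambda>t::real. f (z + of_real t * v)) has_vector_derivative dir_deriv v f z) (at 0)"
          unfolding has_dir_deriv_def dir_deriv_def using vector_derivative_works by blast
        then have lim: "((\<lambda>t::real. (1 / t) *\<^sub>R (f (z + of_real t * v) - f z)) \<longlongrightarrow> dir_deriv v f z) (at 0)"
        proof -
          define d where "d = dir_deriv v f z"
          have lim0: "(\<lambda>h. norm (f (z + of_real h * v) - f z - h *\<^sub>R d) / \<bar>h\<bar>) \<midarrow>0\<rightarrow> 0"
            using \<open>(_ has_vector_derivative _) _\<close>
            by (simp add: has_vector_derivative_def has_derivative_at d_def)
          have eq: "norm (f (z + of_real h * v) - f z - h *\<^sub>R d) / \<bar>h\<bar>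
              = norm ((1 / h) *\<^sub>R (f (z + of_real h * v) - f z) - d)" if "h \<noteq> 0" for h :: real
          proof -
            have "(1 / h) *\<^sub>R (f (z + of_real h * v) - f z) - d = (1 / h) *\<^sub>R (f (z + of_real h * v) - f z - h *\<^sub>R d)"
              using that by (simp add: scaleR_diff_right)
            then show ?thesis by simp
          qed
          have "\<forall>\<^sub>F h in at (0::real). norm (f (z + of_real h * v) - f z - h *\<^sub>R d) / \<bar>h\<bar>
              = norm ((1 / h) *\<^sub>R (f (z + of_real h * v) - f z) - d)"
            unfolding eventually_at_filter using eq by (intro always_eventually allI impI)
          with lim0 have "(\<lambda>h. norm ((1 / h) *\<^sub>R (f (z + of_real h * v) - f z) - d)) \<midarrow>0\<rightarrow> 0"
            by (rule Lim_transform_eventually)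
          then have "(\<lambda>h. (1 / h) *\<^sub>R (f (z + of_real h * v) - f z) - d) \<midarrow>0\<rightarrow> 0"
            by (rule tendsto_norm_zero_cancel)
          then show ?thesis unfolding d_def[symmetric] by (rule LIM_zero_cancel)
        qed
        have s1: "(\<lambda>n. 1 / real (Suc n)) \<longlonglongrightarrow> 0"
          using LIMSEQ_inverse_real_of_nat by (simp only: inverse_eq_divide)
        then have s0: "filterlim (\<lambda>n. 1 / real (Suc n)) (at 0) sequentially"
          unfolding filterlim_at by simp
        have zD: "z \<in> D" using z C(2) by blast
        have "(\<lambda>n. z + of_real (1 / real (Suc n)) * v) \<longlonglongrightarrow> z + of_real 0 * v"
          by (rule tendsto_add[OF tendsto_const tendsto_mult[OF tendsto_of_real[OF s1] tendsto_const]])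
        then have ev: "\<forall>\<^sub>F n in sequentially. z + of_real (1 / real (Suc n)) * v \<in> D"
          by (rule topological_tendstoD[OF _ D]) (use zD in simp)
        have "(\<lambda>n. (1 / (1 / real (Suc n))) *\<^sub>R (f (z + of_real (1 / real (Suc n)) * v) - f z)) \<longlonglongrightarrow> dir_deriv v f z"
          by (rule filterlim_compose[OF lim s0])
        then have "(\<lambda>n. real (Suc n) *\<^sub>R (F (z + of_real (1 / real (Suc n)) * v) - F z)) \<longlonglongrightarrow> dir_deriv v f z"
          by (rule Lim_transform_eventually) (use ev in eventually_elim, simp add: fF zD del: of_nat_Suc)
        then have "(\<lambda>n. u n z) \<longlonglongrightarrow> ennreal (norm (dir_deriv v f z - G z))"
          unfolding u_def using z
          by (simp del: of_nat_Suc) (rule tendsto_norm[OF tendsto_diff[OF _ tendsto_const]])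
        then have "liminf (\<lambda>n. u n z) = ennreal (norm (dir_deriv v f z - G z))"
          by (intro lim_imp_Liminf) auto
        then show "dir_deriv v f z = G z" using elim by simp
      qed
    qed
  qed
  then have "AE z in lborel. \<forall>i. z \<in> C i \<longrightarrow> has_dir_deriv f v z \<longrightarrow> dir_deriv v f z = G z"
    by (subst AE_all_countable) blast
  then show ?thesis by eventually_elim (use C(3) in blast)
qed

section \<open>Absolute continuity on circles\<close>

text \<open>This is \<open>|f_z| + |f_zbar|\<close>, the operator norm of the differential, when \<open>g1\<close> and \<open>g2\<close> are the partial
  derivatives of \<open>f\<close>.\<close>

definition grad_norm :: "complex \<Rightarrow> complex \<Rightarrow> real" where
  "grad_norm g1 g2 = cmod ((g1 - \<i> * g2) / 2) + cmod ((g1 + \<i> * g2) / 2)"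

lemma grad_norm_nonneg: "0 \<le> grad_norm g1 g2"
  by (simp add: grad_norm_def)

text \<open>The left hand side is the differential applied to the unit tangent vector \<open>\<i> * cis t\<close>.\<close>

lemma tangential_le_grad_norm:
  "norm ((- sin t) *\<^sub>R g1 + cos t *\<^sub>R g2) \<le> grad_norm g1 g2"
proof -
  have "(- sin t) *\<^sub>R g1 + cos t *\<^sub>R g2
    = (\<i> * cis t) * ((g1 - \<i> * g2) / 2) + (- \<i> * cis (- t)) * ((g1 + \<i> * g2) / 2)"
    by (simp add: complex_eq_iff field_simps)
  also have "norm \<dots> \<le> norm ((\<i> * cis t) * ((g1 - \<i> * g2) / 2)) + norm ((- \<i> * cis (- t)) * ((g1 + \<i> * g2) / 2))"
    by (rule norm_triangle_ineq)
  also have "\<dots> = grad_norm g1 g2"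
    by (simp only: norm_mult norm_minus_cancel norm_ii norm_cis mult_1 grad_norm_def)
  finally show ?thesis .
qed

lemma grad_norm_le: "grad_norm g1 g2 \<le> norm g1 + norm g2"
proof -
  have "cmod ((g1 - \<i> * g2) / 2) \<le> (norm g1 + norm g2) / 2" "cmod ((g1 + \<i> * g2) / 2) \<le> (norm g1 + norm g2) / 2"
    using norm_triangle_ineq4[of g1 "\<i> * g2"] norm_triangle_ineq[of g1 "\<i> * g2"]
    by (simp_all add: norm_divide norm_mult)
  then have "grad_norm g1 g2 \<le> (norm g1 + norm g2) / 2 + (norm g1 + norm g2) / 2"
    unfolding grad_norm_def by (rule add_mono)
  then show ?thesis by simp
qed

lemma measurable_grad_norm [measurable (raw)]:
  assumes [measurable]: "G1 \<in> borel_measurable M" "G2 \<in> borel_measurable M"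
  shows "(\<lambda>z. grad_norm (G1 z) (G2 z)) \<in> borel_measurable M"
  unfolding grad_norm_def by measurable

lemma polar_Complex: "polar z\<^sub>0 r t = Complex (Re z\<^sub>0 + r * cos t) (Im z\<^sub>0 + r * sin t)"
  by (simp add: polar_def complex_eq_iff)

lemma continuous_on_polar: "continuous_on S (\<lambda>w. polar z\<^sub>0 (Re w) (Im w))"
  unfolding polar_def by (intro continuous_intros)

text \<open>By Fubini in polar coordinates the error of the mollified gradients, integrated over a circular
  arc, tends to 0 in the mean over the radii, and so it has lower limit 0 for almost every radius. For such a radius
  the bound of \<open>F\<close> by its gradient follows from the one for mollified maps.\<close>

lemma circle_AC_rectangle_AE:
  assumes D: "open D" and F: "locally_L1 D F" and cont: "continuous_on D F" and W: "weak_gradient D F G1 G2"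
    and G1: "locally_L1 D G1" and G2: "locally_L1 D G2"
    and pos: "0 < r1" "0 < t1" "t2 < 2 * pi"
    and sub: "\<And>r t. r \<in> {r1..r2} \<Longrightarrow> t \<in> {t1..t2} \<Longrightarrow> polar z\<^sub>0 r t \<in> D"
  shows "AE r in lborel. r \<in> {r1..r2} \<longrightarrow>
     (\<integral>\<^sup>+ t\<in>{t1..t2}. ennreal (r * grad_norm (G1 (polar z\<^sub>0 r t)) (G2 (polar z\<^sub>0 r t))) \<partial>lborel) < \<infinity> \<and>
     (\<forall>s t. t1 \<le> s \<and> s \<le> t \<and> t \<le> t2 \<longrightarrow>
        ennreal (dist (F (polar z\<^sub>0 r s)) (F (polar z\<^sub>0 r t)))
        \<le> (\<integral>\<^sup>+ \<tau>\<in>{s..t}. ennreal (r * grad_norm (G1 (polar z\<^sub>0 r \<tau>)) (G2 (polar z\<^sub>0 r \<tau>))) \<partial>lborel))"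
proof -
  note [measurable] = locally_L1_measurable[OF F] locally_L1_measurable[OF G1] locally_L1_measurable[OF G2]
  define K where "K = (\<lambda>w. polar z\<^sub>0 (Re w) (Im w)) ` cbox (Complex r1 t1) (Complex r2 t2)"
  have K: "compact K" unfolding K_def by (intro compact_continuous_image continuous_on_polar compact_cbox)
  have memK: "polar z\<^sub>0 r t \<in> K" if "r \<in> {r1..r2}" "t \<in> {t1..t2}" for r t
    unfolding K_def using that by (intro image_eqI[of _ _ "Complex r t"]) (auto simp: in_cbox_complex_iff)
  have KD: "K \<subseteq> D" unfolding K_def using sub by (auto simp: in_cbox_complex_iff)
  have Km[measurable]: "K \<in> sets borel" using K by (rule borel_compact)
  \<comment> \<open>Polar coordinates map the rectangle of radii and angles into \<open>K\<close>.\<close>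
  have slice: "(\<integral>\<^sup>+ r\<in>{r1..r2}. (\<integral>\<^sup>+ t\<in>{t1..t2}. u (polar z\<^sub>0 r t) * ennreal r \<partial>lborel) \<partial>lborel) \<le> (\<integral>\<^sup>+ z\<in>K. u z \<partial>lborel)"
    if [measurable]: "u \<in> borel_measurable borel" for u :: "complex \<Rightarrow> ennreal"
  proof -
    have "(\<integral>\<^sup>+ r\<in>{r1..r2}. (\<integral>\<^sup>+ t\<in>{t1..t2}. u (polar z\<^sub>0 r t) * ennreal r \<partial>lborel) \<partial>lborel)
      \<le> (\<integral>\<^sup>+ r\<in>{0<..}. (\<integral>\<^sup>+ t\<in>{0<..<2*pi}. (u (polar z\<^sub>0 r t) * indicator K (polar z\<^sub>0 r t)) * ennreal r \<partial>lborel) \<partial>lborel)"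
    proof (intro nn_integral_mono)
      fix r :: real
      show "(\<integral>\<^sup>+ t\<in>{t1..t2}. u (polar z\<^sub>0 r t) * ennreal r \<partial>lborel) * indicator {r1..r2} r
        \<le> (\<integral>\<^sup>+ t\<in>{0<..<2*pi}. (u (polar z\<^sub>0 r t) * indicator K (polar z\<^sub>0 r t)) * ennreal r \<partial>lborel) * indicator {0<..} r"
      proof (cases "r \<in> {r1..r2}")
        case True
        then have "(\<integral>\<^sup>+ t\<in>{t1..t2}. u (polar z\<^sub>0 r t) * ennreal r \<partial>lborel)
          \<le> (\<integral>\<^sup>+ t\<in>{0<..<2*pi}. (u (polar z\<^sub>0 r t) * indicator K (polar z\<^sub>0 r t)) * ennreal r \<partial>lborel)"
          using memK pos by (intro nn_integral_mono) (auto simp: indicator_def)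
        then show ?thesis using True pos by simp
      qed simp
    qed
    also have "\<dots> \<le> (\<integral>\<^sup>+ z\<in>K. u z \<partial>lborel)"
      by (rule nn_integral_polar_le) measurable
    finally show ?thesis .
  qed
  have "AE r in lborel. (\<integral>\<^sup>+ t\<in>{t1..t2}. ennreal (grad_norm (G1 (polar z\<^sub>0 r t)) (G2 (polar z\<^sub>0 r t))) * ennreal r \<partial>lborel) * indicator {r1..r2} r \<noteq> \<infinity>"
  proof (rule nn_integral_PInf_AE)
    have "(\<integral>\<^sup>+ r\<in>{r1..r2}. (\<integral>\<^sup>+ t\<in>{t1..t2}. ennreal (grad_norm (G1 (polar z\<^sub>0 r t)) (G2 (polar z\<^sub>0 r t))) * ennreal r \<partial>lborel) \<partial>lborel)
      \<le> (\<integral>\<^sup>+ z\<in>K. ennreal (grad_norm (G1 z) (G2 z)) \<partial>lborel)"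
      by (rule slice) measurable
    also have "\<dots> \<le> (\<integral>\<^sup>+ z. ennreal (norm (G1 z)) * indicator K z + ennreal (norm (G2 z)) * indicator K z \<partial>lborel)"
      using grad_norm_le by (intro nn_integral_mono) (auto simp: indicator_def ennreal_leI simp flip: ennreal_plus)
    also have "\<dots> = (\<integral>\<^sup>+ z\<in>K. ennreal (norm (G1 z)) \<partial>lborel) + (\<integral>\<^sup>+ z\<in>K. ennreal (norm (G2 z)) \<partial>lborel)"
      by (rule nn_integral_add) measurable
    also have "\<dots> < \<infinity>" using locally_L1_finite[OF G1 K KD] locally_L1_finite[OF G2 K KD] by simp
    finally show "(\<integral>\<^sup>+ r\<in>{r1..r2}. (\<integral>\<^sup>+ t\<in>{t1..t2}. ennreal (grad_norm (G1 (polar z\<^sub>0 r t)) (G2 (polar z\<^sub>0 r t))) * ennreal r \<partial>lborel) \<partial>lborel) \<noteq> \<infinity>"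
      by auto
  qed measurable
  moreover
  define err where "err m z = ennreal (norm (mollify m G1 z - G1 z)) + ennreal (norm (mollify m G2 z - G2 z))" for m z
  have [measurable]: "err m \<in> borel_measurable borel" for m unfolding err_def[abs_def] by measurable
  define \<Phi> where "\<Phi> m r = (\<integral>\<^sup>+ t\<in>{t1..t2}. err m (polar z\<^sub>0 r t) * ennreal r \<partial>lborel)" for m r
  have "AE r in lborel. liminf (\<lambda>m. \<Phi> m r * indicator {r1..r2} r) = 0"
  proof (rule liminf_eq_0_AE)
    show "(\<lambda>r. \<Phi> m r * indicator {r1..r2} r) \<in> borel_measurable lborel" for m
      unfolding \<Phi>_def by measurable
    fix e :: real assume e: "0 < e"
    obtain d1 where d1: "0 < d1" "\<And>m s. norm s + 2 / real (Suc m) < d1 \<Longrightarrow>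
     (\<integral>\<^sup>+ z\<in>K. ennreal (norm (mollify m G1 (z + s) - G1 z)) \<partial>lborel) \<le> ennreal (e / 2)"
      using mollify_L1[OF D G1 K KD half_gt_zero[OF e]] by blast
    obtain d2 where d2: "0 < d2" "\<And>m s. norm s + 2 / real (Suc m) < d2 \<Longrightarrow>
     (\<integral>\<^sup>+ z\<in>K. ennreal (norm (mollify m G2 (z + s) - G2 z)) \<partial>lborel) \<le> ennreal (e / 2)"
      using mollify_L1[OF D G2 K KD half_gt_zero[OF e]] by blast
    obtain N where N: "inverse (real (Suc N)) < min d1 d2 / 2" using reals_Archimedean[of "min d1 d2 / 2"] d1 d2 by auto
    show "\<forall>\<^sub>F m in sequentially. (\<integral>\<^sup>+ r\<in>{r1..r2}. \<Phi> m r \<partial>lborel) \<le> ennreal e"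
    proof (rule eventually_sequentiallyI[of N])
      fix m assume "N \<le> m"
      then have "inverse (real (Suc m)) \<le> inverse (real (Suc N))" by simp
      then have small: "2 / real (Suc m) < min d1 d2" using N by (simp add: inverse_eq_divide)
      have "(\<integral>\<^sup>+ r\<in>{r1..r2}. \<Phi> m r \<partial>lborel) \<le> (\<integral>\<^sup>+ z\<in>K. err m z \<partial>lborel)"
        unfolding \<Phi>_def by (rule slice) measurable
      also have "\<dots> = (\<integral>\<^sup>+ z. ennreal (norm (mollify m G1 z - G1 z)) * indicator K z + ennreal (norm (mollify m G2 z - G2 z)) * indicator K z \<partial>lborel)"
        by (intro nn_integral_cong) (auto simp: err_def indicator_def)
      also have "\<dots> = (\<integral>\<^sup>+ z\<in>K. ennreal (norm (mollify m G1 z - G1 z)) \<partial>lborel) + (\<integral>\<^sup>+ z\<in>K. ennreal (norm (mollify m G2 z - G2 z)) \<partial>lborel)"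
        by (rule nn_integral_add) measurable
      also have "\<dots> \<le> ennreal (e / 2) + ennreal (e / 2)"
        using d1(2)[of 0 m] d2(2)[of 0 m] small by (intro add_mono) auto
      also have "\<dots> = ennreal e" using e by (simp flip: ennreal_plus)
      finally show "(\<integral>\<^sup>+ r\<in>{r1..r2}. \<Phi> m r \<partial>lborel) \<le> ennreal e" .
    qed
  qed
  ultimately show ?thesis
  proof eventually_elim
    case (elim r)
    show ?case
    proof (intro impI)
      assume r: "r \<in> {r1..r2}"
      then have r0: "0 < r" using pos by auto
      define H where "H \<tau> = ennreal (r * grad_norm (G1 (polar z\<^sub>0 r \<tau>)) (G2 (polar z\<^sub>0 r \<tau>)))" for \<tau>
      have [measurable]: "H \<in> borel_measurable borel" unfolding H_def by measurable
      have Heq: "ennreal (grad_norm (G1 (polar z\<^sub>0 r t)) (G2 (polar z\<^sub>0 r t))) * ennreal r = H t" for t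
        unfolding H_def using r0 grad_norm_nonneg by (simp add: mult.commute flip: ennreal_mult)
      have fin: "(\<integral>\<^sup>+ t\<in>{t1..t2}. H t \<partial>lborel) < \<infinity>"
        using elim(1) r unfolding Heq by (simp add: less_top)
      have lim0: "liminf (\<lambda>m. \<Phi> m r) = 0" using elim(2) r by simp
      have bound: "ennreal (dist (F (polar z\<^sub>0 r s)) (F (polar z\<^sub>0 r t))) \<le> (\<integral>\<^sup>+ \<tau>\<in>{s..t}. H \<tau> \<partial>lborel)"
        if st: "t1 \<le> s" "s \<le> t" "t \<le> t2" for s t
      proof (rule ennreal_le_epsilon)
        fix e :: real assume e: "0 < e"
        have inD: "polar z\<^sub>0 r \<tau> \<in> D" if "\<tau> \<in> {s..t}" for \<tau> using sub r st that by auto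
        define arc where "arc = (\<lambda>\<tau>. polar z\<^sub>0 r \<tau>) ` {s..t}"
        have "compact arc" unfolding arc_def polar_def
          by (intro compact_continuous_image continuous_intros) auto
        moreover have "arc \<subseteq> D" using inD by (auto simp: arc_def)
        ultimately obtain \<delta> K' where K': "0 < \<delta>" "K' \<subseteq> D" "\<And>x y. x \<in> arc \<Longrightarrow> norm (y - x) \<le> \<delta> \<Longrightarrow> y \<in> K'"
          using compact_neighbourhood[OF _ D] by metis
        obtain N where N: "inverse (real (Suc N)) < \<delta> / 2" using reals_Archimedean[of "\<delta> / 2"] K' by auto
        have ev1: "\<forall>\<^sub>F m in sequentially. 2 / real (Suc m) \<le> \<delta>"
        proof (rule eventually_sequentiallyI[of N])
          fix m assume "N \<le> m"
          then have "inverse (real (Suc m)) \<le> inverse (real (Suc N))" by simp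
          then show "2 / real (Suc m) \<le> \<delta>" using N by (simp add: inverse_eq_divide)
        qed
        have ev2: "\<forall>\<^sub>F m in sequentially. dist (mollify m F (polar z\<^sub>0 r \<tau>)) (F (polar z\<^sub>0 r \<tau>)) < e / 3" if "\<tau> \<in> {s..t}" for \<tau>
          using mollify_tendsto[OF D F cont inD[OF that]] e by (intro tendstoD) auto
        have fr: "\<exists>\<^sub>F m in sequentially. \<Phi> m r < ennreal (e / 3)"
        proof (rule ccontr)
          assume "\<not> (\<exists>\<^sub>F m in sequentially. \<Phi> m r < ennreal (e / 3))"
          then have "\<forall>\<^sub>F m in sequentially. ennreal (e / 3) \<le> \<Phi> m r" by (simp add: not_frequently not_less)
          then have "ennreal (e / 3) \<le> liminf (\<lambda>m. \<Phi> m r)" by (rule Liminf_bounded)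
          then show False using lim0 e by simp
        qed
        have s_in: "s \<in> {s..t}" "t \<in> {s..t}" using st by auto
        have "\<forall>\<^sub>F m in sequentially. 2 / real (Suc m) \<le> \<delta> \<and> dist (mollify m F (polar z\<^sub>0 r s)) (F (polar z\<^sub>0 r s)) < e / 3
            \<and> dist (mollify m F (polar z\<^sub>0 r t)) (F (polar z\<^sub>0 r t)) < e / 3"
          using ev1 ev2[OF s_in(1)] ev2[OF s_in(2)] by eventually_elim auto
        from frequently_eventually_conj[OF fr this] obtain m where
          m: "\<Phi> m r < ennreal (e / 3)" "2 / real (Suc m) \<le> \<delta>"
             "dist (mollify m F (polar z\<^sub>0 r s)) (F (polar z\<^sub>0 r s)) < e / 3"
             "dist (mollify m F (polar z\<^sub>0 r t)) (F (polar z\<^sub>0 r t)) < e / 3"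
          by (auto dest!: frequently_ex simp del: of_nat_Suc)
        have near: "cball (Complex (Re z\<^sub>0 + r * cos \<tau>) (Im z\<^sub>0 + r * sin \<tau>)) (2 / real (Suc m)) \<subseteq> D" if "\<tau> \<in> {s..t}" for \<tau>
        proof
          fix w assume "w \<in> cball (Complex (Re z\<^sub>0 + r * cos \<tau>) (Im z\<^sub>0 + r * sin \<tau>)) (2 / real (Suc m))"
          then have "norm (w - polar z\<^sub>0 r \<tau>) \<le> 2 / real (Suc m)"
            by (simp add: polar_Complex dist_norm norm_minus_commute del: of_nat_Suc)
          also have "\<dots> \<le> \<delta>" by (rule m)
          finally have "w \<in> K'" using that by (intro K'(3)[of "polar z\<^sub>0 r \<tau>"]) (auto simp: arc_def)
          then show "w \<in> D" using K'(2) by blast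
        qed
        have dx: "((\<lambda>\<tau>. Re z\<^sub>0 + r * cos \<tau>) has_real_derivative r * (- sin \<tau>)) (at \<tau>)"
          and dy: "((\<lambda>\<tau>. Im z\<^sub>0 + r * sin \<tau>) has_real_derivative r * cos \<tau>) (at \<tau>)" for \<tau>
          by (auto intro!: derivative_eq_intros)
        have c': "continuous_on UNIV (\<lambda>\<tau>. r * (- sin \<tau>))" "continuous_on UNIV (\<lambda>\<tau>. r * cos \<tau>)"
          by (intro continuous_intros)+
        define L where "L \<tau> = (r * (- sin \<tau>)) *\<^sub>R mollify m G1 (polar z\<^sub>0 r \<tau>) + (r * cos \<tau>) *\<^sub>R mollify m G2 (polar z\<^sub>0 r \<tau>)" for \<tau>
        note curve = mollify_curve[OF D F W st(2) dx dy c' near, folded polar_Complex, folded L_def]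
        have Lpt: "ennreal (norm (L \<tau>)) \<le> H \<tau> + err m (polar z\<^sub>0 r \<tau>) * ennreal r" for \<tau>
        proof -
          let ?P = "polar z\<^sub>0 r \<tau>"
          have split: "L \<tau> = r *\<^sub>R ((- sin \<tau>) *\<^sub>R G1 ?P + cos \<tau> *\<^sub>R G2 ?P)
              + r *\<^sub>R ((- sin \<tau>) *\<^sub>R (mollify m G1 ?P - G1 ?P) + cos \<tau> *\<^sub>R (mollify m G2 ?P - G2 ?P))"
            by (simp add: L_def algebra_simps)
          have a: "norm (r *\<^sub>R ((- sin \<tau>) *\<^sub>R G1 ?P + cos \<tau> *\<^sub>R G2 ?P)) \<le> r * grad_norm (G1 ?P) (G2 ?P)"
            using tangential_le_grad_norm[of \<tau> "G1 ?P" "G2 ?P"] r0 by simp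
          have "norm ((- sin \<tau>) *\<^sub>R (mollify m G1 ?P - G1 ?P) + cos \<tau> *\<^sub>R (mollify m G2 ?P - G2 ?P))
             \<le> norm ((- sin \<tau>) *\<^sub>R (mollify m G1 ?P - G1 ?P)) + norm (cos \<tau> *\<^sub>R (mollify m G2 ?P - G2 ?P))"
            by (rule norm_triangle_ineq)
          also have "\<dots> \<le> norm (mollify m G1 ?P - G1 ?P) + norm (mollify m G2 ?P - G2 ?P)"
            by (intro add_mono) (auto simp: mult_left_le_one_le)
          finally have b: "norm (r *\<^sub>R ((- sin \<tau>) *\<^sub>R (mollify m G1 ?P - G1 ?P) + cos \<tau> *\<^sub>R (mollify m G2 ?P - G2 ?P)))
             \<le> r * (norm (mollify m G1 ?P - G1 ?P) + norm (mollify m G2 ?P - G2 ?P))"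
            using r0 by simp
          have "norm (L \<tau>) \<le> r * grad_norm (G1 ?P) (G2 ?P) + r * (norm (mollify m G1 ?P - G1 ?P) + norm (mollify m G2 ?P - G2 ?P))"
            unfolding split by (rule order_trans[OF norm_triangle_ineq add_mono[OF a b]])
          then have "ennreal (norm (L \<tau>)) \<le> ennreal (r * grad_norm (G1 ?P) (G2 ?P) + r * (norm (mollify m G1 ?P - G1 ?P) + norm (mollify m G2 ?P - G2 ?P)))"
            by (rule ennreal_leI)
          also have "\<dots> = H \<tau> + err m ?P * ennreal r"
            unfolding H_def err_def using r0 grad_norm_nonneg[of "G1 ?P" "G2 ?P"]
            by (simp add: ennreal_plus ennreal_mult mult.commute distrib_left)
          finally show ?thesis .
        qed
        have "ennreal (dist (mollify m F (polar z\<^sub>0 r s)) (mollify m F (polar z\<^sub>0 r t)))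
           \<le> (\<integral>\<^sup>+ \<tau>\<in>{s..t}. ennreal (norm (L \<tau>)) \<partial>lborel)"
          using norm_integral_le_nn_integral[OF curve(1)] curve(2)
          by (simp add: dist_norm norm_minus_commute[of "mollify m F (polar z\<^sub>0 r s)"])
        also have "\<dots> \<le> (\<integral>\<^sup>+ \<tau>. H \<tau> * indicator {s..t} \<tau> + err m (polar z\<^sub>0 r \<tau>) * ennreal r * indicator {t1..t2} \<tau> \<partial>lborel)"
          using Lpt st by (intro nn_integral_mono) (auto simp: indicator_def)
        also have "\<dots> = (\<integral>\<^sup>+ \<tau>\<in>{s..t}. H \<tau> \<partial>lborel) + \<Phi> m r"
          unfolding \<Phi>_def by (rule nn_integral_add) measurable
        finally have mid: "ennreal (dist (mollify m F (polar z\<^sub>0 r s)) (mollify m F (polar z\<^sub>0 r t)))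
           \<le> (\<integral>\<^sup>+ \<tau>\<in>{s..t}. H \<tau> \<partial>lborel) + \<Phi> m r" .
        have "dist (F (polar z\<^sub>0 r s)) (F (polar z\<^sub>0 r t))
          \<le> e / 3 + e / 3 + dist (mollify m F (polar z\<^sub>0 r s)) (mollify m F (polar z\<^sub>0 r t))"
          using m(3,4) dist_triangle[of "F (polar z\<^sub>0 r s)" "F (polar z\<^sub>0 r t)" "mollify m F (polar z\<^sub>0 r s)"]
            dist_triangle[of "mollify m F (polar z\<^sub>0 r s)" "F (polar z\<^sub>0 r t)" "mollify m F (polar z\<^sub>0 r t)"]
          by (simp add: dist_commute)
        then have "ennreal (dist (F (polar z\<^sub>0 r s)) (F (polar z\<^sub>0 r t)))
          \<le> ennreal (e / 3 + e / 3) + ennreal (dist (mollify m F (polar z\<^sub>0 r s)) (mollify m F (polar z\<^sub>0 r t)))"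
          using e by (simp flip: ennreal_plus)
        also have "\<dots> \<le> ennreal (e / 3 + e / 3) + ((\<integral>\<^sup>+ \<tau>\<in>{s..t}. H \<tau> \<partial>lborel) + ennreal (e / 3))"
          using m(1) by (intro add_left_mono order_trans[OF mid]) auto
        also have "\<dots> = (\<integral>\<^sup>+ \<tau>\<in>{s..t}. H \<tau> \<partial>lborel) + (ennreal (e / 3 + e / 3) + ennreal (e / 3))"
          by (simp only: ac_simps)
        also have "ennreal (e / 3 + e / 3) + ennreal (e / 3) = ennreal e"
          using e by (simp flip: ennreal_plus)
        finally show "ennreal (dist (F (polar z\<^sub>0 r s)) (F (polar z\<^sub>0 r t))) \<le> (\<integral>\<^sup>+ \<tau>\<in>{s..t}. H \<tau> \<partial>lborel) + ennreal e" .
      qed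
      show "(\<integral>\<^sup>+ t\<in>{t1..t2}. ennreal (r * grad_norm (G1 (polar z\<^sub>0 r t)) (G2 (polar z\<^sub>0 r t))) \<partial>lborel) < \<infinity> \<and>
         (\<forall>s t. t1 \<le> s \<and> s \<le> t \<and> t \<le> t2 \<longrightarrow>
            ennreal (dist (F (polar z\<^sub>0 r s)) (F (polar z\<^sub>0 r t)))
            \<le> (\<integral>\<^sup>+ \<tau>\<in>{s..t}. ennreal (r * grad_norm (G1 (polar z\<^sub>0 r \<tau>)) (G2 (polar z\<^sub>0 r \<tau>))) \<partial>lborel))"
        using fin bound unfolding H_def by blast
    qed
  qed
qed

text \<open>Every compact arc in the open set \<open>D\<close> that avoids the angle 0 lies in a polar rectangle in \<open>D\<close> with
  rational corners, and there are countably many of these.\<close>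

theorem circle_AC_AE:
  assumes D: "open D" and F: "locally_L1 D F" and cont: "continuous_on D F" and W: "weak_gradient D F G1 G2"
    and G1: "locally_L1 D G1" and G2: "locally_L1 D G2"
  shows "AE r in lborel. 0 < r \<longrightarrow> (\<forall>s t. s \<le> t \<and> {s..t} \<subseteq> {\<tau>. 0 < \<tau> \<and> \<tau> < 2 * pi \<and> polar z\<^sub>0 r \<tau> \<in> D} \<longrightarrow>
     (\<integral>\<^sup>+ \<tau>\<in>{s..t}. ennreal (r * grad_norm (G1 (polar z\<^sub>0 r \<tau>)) (G2 (polar z\<^sub>0 r \<tau>))) \<partial>lborel) < \<infinity> \<and>
     ennreal (dist (F (polar z\<^sub>0 r s)) (F (polar z\<^sub>0 r t)))
        \<le> (\<integral>\<^sup>+ \<tau>\<in>{s..t}. ennreal (r * grad_norm (G1 (polar z\<^sub>0 r \<tau>)) (G2 (polar z\<^sub>0 r \<tau>))) \<partial>lborel))"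
proof -
  define H where "H r \<tau> = ennreal (r * grad_norm (G1 (polar z\<^sub>0 r \<tau>)) (G2 (polar z\<^sub>0 r \<tau>)))" for r \<tau>
  define adm_rect where "adm_rect r1 r2 t1 t2 \<longleftrightarrow> 0 < r1 \<and> 0 < t1 \<and> t2 < 2 * pi \<and> (\<forall>r\<in>{r1..r2}. \<forall>t\<in>{t1..t2}. polar z\<^sub>0 r t \<in> D)" for r1 r2 t1 t2
  define good where "good r r1 r2 t1 t2 \<longleftrightarrow> (r \<in> {r1..r2} \<longrightarrow> (\<integral>\<^sup>+ t\<in>{t1..t2}. H r t \<partial>lborel) < \<infinity> \<and>
     (\<forall>s t. t1 \<le> s \<and> s \<le> t \<and> t \<le> t2 \<longrightarrow>
        ennreal (dist (F (polar z\<^sub>0 r s)) (F (polar z\<^sub>0 r t))) \<le> (\<integral>\<^sup>+ \<tau>\<in>{s..t}. H r \<tau> \<partial>lborel)))" for r r1 r2 t1 t2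
  have "AE r in lborel. adm_rect r1 r2 t1 t2 \<longrightarrow> good r r1 r2 t1 t2" for r1 r2 t1 t2
  proof (cases "adm_rect r1 r2 t1 t2")
    case True
    then have "AE r in lborel. good r r1 r2 t1 t2"
      unfolding good_def H_def adm_rect_def
      by (intro circle_AC_rectangle_AE[OF D F cont W G1 G2]) auto
    then show ?thesis by eventually_elim simp
  qed simp
  then have "AE r in lborel. \<forall>p :: rat \<times> rat \<times> rat \<times> rat. case p of (a, b, c, d) \<Rightarrow>
      adm_rect (of_rat a) (of_rat b) (of_rat c) (of_rat d) \<longrightarrow> good r (of_rat a) (of_rat b) (of_rat c) (of_rat d)"
    by (subst AE_all_countable) auto
  then show ?thesis
  proof eventually_elim
    case (elim r)
    show ?case
    proof (intro impI allI)
      fix s t :: real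
      assume r: "0 < r" and st: "s \<le> t \<and> {s..t} \<subseteq> {\<tau>. 0 < \<tau> \<and> \<tau> < 2 * pi \<and> polar z\<^sub>0 r \<tau> \<in> D}"
      \<comment> \<open>The domain in polar coordinates, cut along the ray of angle 0.\<close>
      define \<Omega> where "\<Omega> = {w. 0 < Re w} \<inter> {w. 0 < Im w} \<inter> {w. Im w < 2 * pi} \<inter> (\<lambda>w. polar z\<^sub>0 (Re w) (Im w)) -` D"
      have "open \<Omega>" unfolding \<Omega>_def
        by (intro open_Int open_halfspace_Re_gt open_halfspace_Im_gt open_halfspace_Im_lt open_vimage D continuous_on_polar)
      moreover have "compact (Complex r ` {s..t})"
        by (intro compact_continuous_image continuous_on_Complex continuous_intros) auto
      moreover have "Complex r ` {s..t} \<subseteq> \<Omega>" using st r by (auto simp: \<Omega>_def)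
      ultimately obtain \<delta> K' where K': "0 < \<delta>" "K' \<subseteq> \<Omega>" "\<And>x y. x \<in> Complex r ` {s..t} \<Longrightarrow> norm (y - x) \<le> \<delta> \<Longrightarrow> y \<in> K'"
        using compact_neighbourhood by metis
      obtain a where a: "r - \<delta> / 2 < of_rat a" "of_rat a < r" using of_rat_dense[of "r - \<delta> / 2" r] K' by auto
      obtain b where b: "r < of_rat b" "of_rat b < r + \<delta> / 2" using of_rat_dense[of r "r + \<delta> / 2"] K' by auto
      obtain c where c: "s - \<delta> / 2 < of_rat c" "of_rat c < s" using of_rat_dense[of "s - \<delta> / 2" s] K' by auto
      obtain d where d: "t < of_rat d" "of_rat d < t + \<delta> / 2" using of_rat_dense[of t "t + \<delta> / 2"] K' by auto
      have in\<Omega>: "Complex \<rho> \<tau> \<in> \<Omega>" if "\<rho> \<in> {of_rat a..of_rat b}" "\<tau> \<in> {of_rat c..of_rat d}" for \<rho> \<tau>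
      proof -
        \<comment> \<open>The point of \<open>{s..t}\<close> nearest to \<open>\<tau>\<close>.\<close>
        define \<tau>' where "\<tau>' = max s (min t \<tau>)"
        have \<tau>': "\<tau>' \<in> {s..t}" "\<bar>\<tau> - \<tau>'\<bar> \<le> \<delta> / 2"
          using st that(2) c d K'(1) unfolding \<tau>'_def max_def min_def atLeastAtMost_iff by (auto split: if_splits)
        have "norm (Complex \<rho> \<tau> - Complex r \<tau>') \<le> \<bar>\<rho> - r\<bar> + \<bar>\<tau> - \<tau>'\<bar>"
          using cmod_le[of "Complex \<rho> \<tau> - Complex r \<tau>'"] by simp
        also have "\<bar>\<rho> - r\<bar> \<le> \<delta> / 2"
          using that(1) a b unfolding abs_le_iff atLeastAtMost_iff by linarith
        also have "\<delta> / 2 + \<bar>\<tau> - \<tau>'\<bar> \<le> \<delta>" using \<tau>'(2) by linarith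
        finally have "norm (Complex \<rho> \<tau> - Complex r \<tau>') \<le> \<delta>" by simp
        then have "Complex \<rho> \<tau> \<in> K'" by (intro K'(3)[of "Complex r \<tau>'"] imageI \<tau>'(1))
        then show ?thesis using K'(2) by blast
      qed
      have "(of_rat a::real) \<le> of_rat b" "(of_rat c::real) \<le> of_rat d" using a b c d st by linarith+
      then have ad: "adm_rect (of_rat a) (of_rat b) (of_rat c) (of_rat d)"
      proof -
        have "Complex (of_rat a) (of_rat c) \<in> \<Omega>" "Complex (of_rat a) (of_rat d) \<in> \<Omega>"
          using \<open>(of_rat a::real) \<le> of_rat b\<close> \<open>(of_rat c::real) \<le> of_rat d\<close> by (intro in\<Omega>; simp)+
        then have "0 < (of_rat a :: real)" "0 < (of_rat c :: real)" "(of_rat d :: real) < 2 * pi"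
          by (simp_all add: \<Omega>_def del: zero_less_of_rat_iff)
        moreover have "polar z\<^sub>0 \<rho> \<tau> \<in> D" if "\<rho> \<in> {of_rat a..of_rat b}" "\<tau> \<in> {of_rat c..of_rat d}" for \<rho> \<tau>
          using in\<Omega>[OF that] by (simp add: \<Omega>_def)
        ultimately show ?thesis unfolding adm_rect_def by blast
      qed
      then have g: "good r (of_rat a) (of_rat b) (of_rat c) (of_rat d)"
        using elim[rule_format, of "(a, b, c, d)"] by simp
      have rab: "r \<in> {of_rat a..of_rat b}" using a b by simp
      have "(\<integral>\<^sup>+ \<tau>\<in>{s..t}. H r \<tau> \<partial>lborel) \<le> (\<integral>\<^sup>+ \<tau>\<in>{of_rat c..of_rat d}. H r \<tau> \<partial>lborel)"
        using c d by (intro nn_integral_mono) (auto simp: indicator_def)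
      also have "\<dots> < \<infinity>" using g rab unfolding good_def by blast
      finally have fin: "(\<integral>\<^sup>+ \<tau>\<in>{s..t}. H r \<tau> \<partial>lborel) < \<infinity>" .
      have "ennreal (dist (F (polar z\<^sub>0 r s)) (F (polar z\<^sub>0 r t))) \<le> (\<integral>\<^sup>+ \<tau>\<in>{s..t}. H r \<tau> \<partial>lborel)"
      proof -
        have "of_rat c \<le> s" "s \<le> t" "t \<le> of_rat d" using c d st by auto
        then show ?thesis using g rab unfolding good_def by blast
      qed
      with fin show "(\<integral>\<^sup>+ \<tau>\<in>{s..t}. ennreal (r * grad_norm (G1 (polar z\<^sub>0 r \<tau>)) (G2 (polar z\<^sub>0 r \<tau>))) \<partial>lborel) < \<infinity> \<and>
         ennreal (dist (F (polar z\<^sub>0 r s)) (F (polar z\<^sub>0 r t)))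
        \<le> (\<integral>\<^sup>+ \<tau>\<in>{s..t}. ennreal (r * grad_norm (G1 (polar z\<^sub>0 r \<tau>)) (G2 (polar z\<^sub>0 r \<tau>))) \<partial>lborel)"
        unfolding H_def by blast
    qed
  qed
qed

section \<open>Differentiability of open mappings\<close>

text \<open>In the direction \<open>v\<close>, at arbitrarily small scales \<open>\<rho>\<close> and within distance \<open>\<rho>\<close> of \<open>z\<close>, the set \<open>A\<close>
  has a gap of length at least \<open>\<epsilon> * \<rho>\<close>.\<close>

definition porous_along :: "complex \<Rightarrow> complex set \<Rightarrow> real \<Rightarrow> complex \<Rightarrow> bool" where
  "porous_along v A \<epsilon> z \<longleftrightarrow> (\<forall>n. \<exists>\<rho> s. 0 < \<rho> \<and> \<rho> < inverse (real (Suc n)) \<and> \<bar>s\<bar> \<le> \<rho> \<and>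
     (\<forall>t\<in>{s..s + \<epsilon> * \<rho>}. z + of_real t * v \<notin> A))"

text \<open>The same property for subsets of the line.\<close>

definition porous_at :: "real set \<Rightarrow> real \<Rightarrow> real \<Rightarrow> bool" where
  "porous_at A \<epsilon> x \<longleftrightarrow> (\<forall>n. \<exists>\<rho> s. 0 < \<rho> \<and> \<rho> < inverse (real (Suc n)) \<and> \<bar>s\<bar> \<le> \<rho> \<and> {x + s..x + s + \<epsilon> * \<rho>} \<inter> A = {})"

text \<open>Lebesgue's differentiation theorem for the indicator function of \<open>A\<close>: to the right of a density point
  the gaps of \<open>A\<close> are short in comparison with their distance from the point.\<close>

lemma right_density:
  fixes A :: "real set"
  assumes A: "closed A"
  obtains N where "negligible N" "\<And>x e. x \<in> A \<Longrightarrow> x \<notin> N \<Longrightarrow> 0 < e \<Longrightarrow>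
    \<exists>d>0. \<forall>h a b. 0 < h \<and> h < d \<and> x \<le> a \<and> a \<le> b \<and> b \<le> x + h \<and> {a..b} \<inter> A = {} \<longrightarrow> b - a \<le> e * h"
proof -
  have Al: "A \<inter> cbox a b \<in> lmeasurable" for a b
    using A by (intro bounded_set_imp_lmeasurable) (auto simp: sets_completionI_sets)
  have int: "(indicat_real A) integrable_on cbox a b" for a b
    using Al by (simp add: integrable_on_indicator)
  obtain N where N: "negligible N" "\<And>x e. x \<notin> N \<Longrightarrow> 0 < e \<Longrightarrow> \<exists>d>0. \<forall>h. 0 < h \<and> h < d \<longrightarrow>
      norm (integral (cbox x (x + h *\<^sub>R One)) (indicat_real A) /\<^sub>R h ^ DIM(real) - indicat_real A x) < e"
    using integrable_ccontinuous_explicit[OF int] by metis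
  show thesis
  proof
    show "negligible N" by fact
    fix x e :: real assume x: "x \<in> A" "x \<notin> N" and e: "0 < e"
    obtain d where d: "0 < d" "\<And>h. 0 < h \<Longrightarrow> h < d \<Longrightarrow>
       norm (integral (cbox x (x + h *\<^sub>R One)) (indicat_real A) /\<^sub>R h ^ DIM(real) - indicat_real A x) < e"
      using N(2)[OF x(2) e] by blast
    show "\<exists>d>0. \<forall>h a b. 0 < h \<and> h < d \<and> x \<le> a \<and> a \<le> b \<and> b \<le> x + h \<and> {a..b} \<inter> A = {} \<longrightarrow> b - a \<le> e * h"
    proof (intro exI[of _ d] conjI allI impI d(1))
      fix h a b assume "0 < h \<and> h < d \<and> x \<le> a \<and> a \<le> b \<and> b \<le> x + h \<and> {a..b} \<inter> A = {}"
      then have h: "0 < h" "h < d" "x \<le> a" "a \<le> b" "b \<le> x + h" "{a..b} \<inter> A = {}" by auto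
      have "norm (integral {x..x + h} (indicat_real A) / h - 1) < e"
        using d(2)[OF h(1,2)] x(1) by (simp add: divide_inverse_commute)
      then have "1 - integral {x..x + h} (indicat_real A) / h < e" by (simp add: abs_less_iff)
      then have 1: "h - integral {x..x + h} (indicat_real A) < e * h" using h(1) by (simp add: field_simps)
      have "integral {x..x + h} (indicat_real A) = measure lebesgue (A \<inter> {x..x + h})"
        using integral_indicator[of A "cbox x (x + h)"] Al by simp
      also have "measure lebesgue (A \<inter> {x..x + h}) + (b - a) \<le> h"
      proof -
        have lm: "A \<inter> {x..x + h} \<in> lmeasurable" using Al[of x "x + h"] by simp
        have lmI: "{a..b} \<in> lmeasurable" using lmeasurable_cbox[of a b] by simp
        have "measure lebesgue (A \<inter> {x..x + h}) + (b - a) = measure lebesgue (A \<inter> {x..x + h}) + measure lebesgue {a..b}"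
          using h(4) by simp
        also have "\<dots> = measure lebesgue ((A \<inter> {x..x + h}) \<union> {a..b})"
          by (rule measure_Union[unfolded infinity_ennreal_def, OF fmeasurableD2[OF lm] fmeasurableD2[OF lmI] fmeasurableD[OF lm] fmeasurableD[OF lmI], symmetric])
             (use h(6) in auto)
        also have "\<dots> \<le> measure lebesgue {x..x + h}"
          by (rule measure_mono_fmeasurable) (use h lm in auto)
        also have "\<dots> = h" using h by simp
        finally show ?thesis .
      qed
      then have "measure lebesgue (A \<inter> {x..x + h}) \<le> h - (b - a)" by simp
      finally have "integral {x..x + h} (indicat_real A) \<le> h - (b - a)" .
      then show "b - a \<le> e * h" using 1 by linarith
    qed
  qed
qed

text \<open>A set is not porous at a point that is a density point from both sides, since at least half of
  each gap lies on one side of it.\<close>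

lemma negligible_porous:
  fixes A :: "real set"
  assumes A: "closed A" and \<epsilon>: "0 < \<epsilon>"
  shows "negligible {x \<in> A. porous_at A \<epsilon> x}"
proof -
  obtain N1 where N1: "negligible N1" "\<And>x e. x \<in> A \<Longrightarrow> x \<notin> N1 \<Longrightarrow> 0 < e \<Longrightarrow>
    \<exists>d>0. \<forall>h a b. 0 < h \<and> h < d \<and> x \<le> a \<and> a \<le> b \<and> b \<le> x + h \<and> {a..b} \<inter> A = {} \<longrightarrow> b - a \<le> e * h"
    using right_density[OF A] by blast
  obtain N2 where N2: "negligible N2" "\<And>x e. x \<in> uminus ` A \<Longrightarrow> x \<notin> N2 \<Longrightarrow> 0 < e \<Longrightarrow>
    \<exists>d>0. \<forall>h a b. 0 < h \<and> h < d \<and> x \<le> a \<and> a \<le> b \<and> b \<le> x + h \<and> {a..b} \<inter> uminus ` A = {} \<longrightarrow> b - a \<le> e * h"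
    using right_density[OF closed_negations[OF A]] by blast
  have "x \<in> N1 \<union> uminus ` N2" if x: "x \<in> A" "porous_at A \<epsilon> x" for x
  proof (rule ccontr)
    assume nx: "x \<notin> N1 \<union> uminus ` N2"
    then have nx2: "- x \<notin> N2" by force
    \<comment> \<open>Chosen so that \<open>e * h\<close>, with \<open>h = (1 + \<epsilon>) * \<rho>\<close> below, is less than half of the gap.\<close>
    define e where "e = \<epsilon> / (4 * (1 + \<epsilon>))"
    have e: "0 < e" using \<epsilon> by (simp add: e_def)
    obtain d1 where d1: "0 < d1" "\<And>h a b. 0 < h \<Longrightarrow> h < d1 \<Longrightarrow> x \<le> a \<Longrightarrow> a \<le> b \<Longrightarrow> b \<le> x + h \<Longrightarrow> {a..b} \<inter> A = {} \<Longrightarrow> b - a \<le> e * h"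
      using N1(2)[OF x(1) _ e] nx by blast
    have "- x \<in> uminus ` A" using x by auto
    then obtain d2 where d2: "0 < d2" "\<And>h a b. 0 < h \<Longrightarrow> h < d2 \<Longrightarrow> - x \<le> a \<Longrightarrow> a \<le> b \<Longrightarrow> b \<le> - x + h \<Longrightarrow> {a..b} \<inter> uminus ` A = {} \<Longrightarrow> b - a \<le> e * h"
      using N2(2)[OF _ nx2 e] by blast
    obtain n where n: "inverse (real (Suc n)) < min d1 d2 / (1 + \<epsilon>)"
      using reals_Archimedean[of "min d1 d2 / (1 + \<epsilon>)"] d1 d2 \<epsilon> by auto
    obtain \<rho> s where \<rho>: "0 < \<rho>" "\<rho> < inverse (real (Suc n))" "\<bar>s\<bar> \<le> \<rho>" "{x + s..x + s + \<epsilon> * \<rho>} \<inter> A = {}"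
      using x(2) unfolding porous_at_def by blast
    define h where "h = (1 + \<epsilon>) * \<rho>"
    have "\<rho> < min d1 d2 / (1 + \<epsilon>)" using \<rho>(2) n by linarith
    then have "\<rho> * (1 + \<epsilon>) < min d1 d2" using \<epsilon> by (simp add: pos_less_divide_eq)
    then have h: "0 < h" "h < d1" "h < d2"
      using \<epsilon> \<rho>(1) by (simp_all add: h_def mult.commute)
    have eh: "e * h = \<epsilon> * \<rho> / 4" using \<epsilon> by (simp add: e_def h_def field_simps)
    have pos: "0 < \<epsilon> * \<rho>" using \<epsilon> \<rho> by simp
    have hx: "h = \<rho> + \<epsilon> * \<rho>" by (simp add: h_def algebra_simps)
    show False
    \<comment> \<open>At least half of the gap lies to the right of \<open>x\<close>, or at least half lies to the left.\<close>
    proof (cases "- (\<epsilon> * \<rho> / 2) \<le> s")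
      case True
      define a where "a = x + max 0 s"
      have ab: "x \<le> a" "a \<le> x + s + \<epsilon> * \<rho>" "x + s + \<epsilon> * \<rho> \<le> x + h" "\<epsilon> * \<rho> / 2 \<le> x + s + \<epsilon> * \<rho> - a"
        using True pos \<rho>(3) hx by (auto simp: a_def max_def)
      have "{a..x + s + \<epsilon> * \<rho>} \<inter> A = {}" 
      proof -
        have "{a..x + s + \<epsilon> * \<rho>} \<subseteq> {x + s..x + s + \<epsilon> * \<rho>}" by (auto simp: a_def)
        then show ?thesis using \<rho>(4) by blast
      qed
      from d1(2)[OF h(1,2) ab(1,2,3) this] ab(4) eh pos show False by linarith
    next
      case False
      define b where "b = x + min 0 (s + \<epsilon> * \<rho>)"
      have ab: "- x \<le> - b" "- b \<le> - (x + s)" "- (x + s) \<le> - x + h" "\<epsilon> * \<rho> / 2 \<le> - (x + s) - (- b)"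
        using False pos \<rho>(3) hx by (auto simp: b_def min_def)
      have "{x + s..b} \<inter> A = {}" 
      proof -
        have "{x + s..b} \<subseteq> {x + s..x + s + \<epsilon> * \<rho>}" by (auto simp: b_def)
        then show ?thesis using \<rho>(4) by blast
      qed
      then have "{- b..- (x + s)} \<inter> uminus ` A = {}" by (auto simp: disjoint_iff) 
      from d2(2)[OF h(1,3) ab(1,2,3) this] ab(4) eh pos show False by linarith
    qed
  qed
  then have "{x \<in> A. porous_at A \<epsilon> x} \<subseteq> N1 \<union> uminus ` N2" by blast
  moreover have "negligible (uminus ` N2)"
    by (rule negligible_differentiable_image_negligible[OF _ N2(1)])
       (auto intro: differentiable_on_minus differentiable_on_ident)
  ultimately show ?thesis using N1(1) by (meson negligible_Un negligible_subset)
qed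

text \<open>By Fubini's theorem, because on each line in the direction \<open>v\<close> the porous points are negligible. They form
  a Borel set, as the condition on a fixed scale and position is open.\<close>

lemma AE_not_porous_along:
  fixes A :: "complex set"
  assumes A: "closed A" and \<epsilon>: "0 < \<epsilon>" and v: "v \<in> {1, \<i>}"
  shows "AE z in lborel. z \<in> A \<longrightarrow> \<not> porous_along v A \<epsilon> z"
proof -
  \<comment> \<open>The points with a gap at some scale below \<open>1 / (n + 1)\<close>.\<close>
  define U where "U n = (\<Union>\<rho>\<in>{0<..<inverse (real (Suc n))}. \<Union>s\<in>{s. \<bar>s\<bar> \<le> \<rho>}. {z. \<forall>t\<in>{s..s + \<epsilon> * \<rho>}. z + of_real t * v \<notin> A})" for n
  have op: "open {z. \<forall>t\<in>{s..s'}. z + of_real t * v \<notin> A}" for s s' :: real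
  proof -
    have "closed (\<Union>x\<in>(\<lambda>t. - (of_real t * v)) ` {s..s'}. \<Union>y\<in>A. {x + y})"
      by (intro compact_closed_sums A compact_continuous_image continuous_intros) auto
    moreover have "(\<Union>x\<in>(\<lambda>t. - (of_real t * v)) ` {s..s'}. \<Union>y\<in>A. {x + y}) = - {z. \<forall>t\<in>{s..s'}. z + of_real t * v \<notin> A}"
    proof (intro equalityI subsetI)
      fix z assume "z \<in> (\<Union>x\<in>(\<lambda>t. - (of_real t * v)) ` {s..s'}. \<Union>y\<in>A. {x + y})"
      then obtain t y where t: "t \<in> {s..s'}" "y \<in> A" "z = - (of_real t * v) + y" by blast
      then have "z + of_real t * v \<in> A" by simp
      then show "z \<in> - {z. \<forall>t\<in>{s..s'}. z + of_real t * v \<notin> A}" using t(1) by blast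
    next
      fix z assume "z \<in> - {z. \<forall>t\<in>{s..s'}. z + of_real t * v \<notin> A}"
      then obtain t where t: "t \<in> {s..s'}" "z + of_real t * v \<in> A" by auto
      have "z = - (of_real t * v) + (z + of_real t * v)" by simp
      then show "z \<in> (\<Union>x\<in>(\<lambda>t. - (of_real t * v)) ` {s..s'}. \<Union>y\<in>A. {x + y})" using t by blast
    qed
    ultimately show ?thesis unfolding open_closed by (simp only:)
  qed
  have Um[measurable]: "U n \<in> sets borel" for n
    unfolding U_def by (intro borel_open open_UN ballI op)
  have Am[measurable]: "A \<in> sets borel" using A by simp
  define B where "B = A \<inter> (\<Inter>n. U n)"
  have B[measurable]: "B \<in> sets borel" unfolding B_def by measurable
  have Biff: "z \<in> B \<longleftrightarrow> z \<in> A \<and> porous_along v A \<epsilon> z" for z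
  proof -
    have "z \<in> U n \<longleftrightarrow> (\<exists>\<rho> s. 0 < \<rho> \<and> \<rho> < inverse (real (Suc n)) \<and> \<bar>s\<bar> \<le> \<rho> \<and>
       (\<forall>t\<in>{s..s + \<epsilon> * \<rho>}. z + of_real t * v \<notin> A))" for n
      unfolding U_def by auto
    then show ?thesis unfolding B_def porous_along_def by blast
  qed
  have null: "(\<integral>\<^sup>+ t. indicator C t \<partial>lborel) = 0" if "negligible C" "C \<in> sets borel" for C :: "real set"
    using that by (simp add: negligible_iff_null_sets null_sets_completion_iff null_sets_def)
  have line: "(\<integral>\<^sup>+ t. indicator B (w + of_real t * v) \<partial>lborel) = 0" for w
  proof -
    let ?A = "{t. w + of_real t * v \<in> A}"
    have c: "continuous_on UNIV (\<lambda>t::real. w + of_real t * v)" by (intro continuous_intros)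
    have clA: "closed ?A" using closed_vimage[OF A c] by (simp add: vimage_def)
    have "porous_along v A \<epsilon> (w + of_real t * v) \<longleftrightarrow> porous_at ?A \<epsilon> t" for t
    proof -
      have *: "(\<forall>\<tau>\<in>{s..s + \<epsilon> * \<rho>}. w + of_real t * v + of_real \<tau> * v \<notin> A) \<longleftrightarrow> {t + s..t + s + \<epsilon> * \<rho>} \<inter> ?A = {}" for s \<rho>
      proof -
        have im: "{t + s..t + s + \<epsilon> * \<rho>} = (\<lambda>\<tau>. t + \<tau>) ` {s..s + \<epsilon> * \<rho>}" by (simp add: add.assoc)
        have sh: "w + of_real t * v + of_real \<tau> * v = w + of_real (t + \<tau>) * v" for \<tau> by (simp add: algebra_simps)
        show ?thesis unfolding im sh by blast
      qed
      show ?thesis unfolding porous_along_def porous_at_def * ..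
    qed
    then have eq: "{t. w + of_real t * v \<in> B} = {t \<in> ?A. porous_at ?A \<epsilon> t}" using Biff by auto
    have "{t. w + of_real t * v \<in> B} \<in> sets borel"
      using measurable_sets[OF borel_measurable_continuous_onI[OF c] B] by (simp add: vimage_def)
    moreover have "negligible {t. w + of_real t * v \<in> B}"
      unfolding eq by (rule negligible_porous[OF clA \<epsilon>])
    ultimately have "(\<integral>\<^sup>+ t. indicator {t. w + of_real t * v \<in> B} t \<partial>lborel) = 0" by (intro null)
    then show ?thesis by (simp add: indicator_def)
  qed
  have "emeasure lborel B = (\<integral>\<^sup>+ z. indicator B z \<partial>lborel)" by simp
  also have "\<dots> = (\<integral>\<^sup>+ x. \<integral>\<^sup>+ y. indicator B (Complex x y) \<partial>lborel \<partial>lborel)"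
    by (rule nn_integral_complex) measurable
  also have "\<dots> = 0"
  proof -
    consider "v = \<i>" | "v = 1" using v by auto
    then show ?thesis
    proof cases
      case 1
      have "Complex x y = of_real x + of_real y * v" for x y by (simp add: 1 complex_eq_iff)
      then show ?thesis by (simp add: line)
    next
      case 2
      have "(\<lambda>p. indicator B (case p of (x, y) \<Rightarrow> Complex x y) :: ennreal) \<in> borel_measurable (lborel \<Otimes>\<^sub>M lborel)" by measurable
      then have "(\<lambda>(x, y). indicator B (Complex x y) :: ennreal) \<in> borel_measurable (lborel \<Otimes>\<^sub>M lborel)"
        by (simp add: case_prod_beta')
      from lborel_pair.Fubini'[OF this]
      have "(\<integral>\<^sup>+ x. \<integral>\<^sup>+ y. indicator B (Complex x y) \<partial>lborel \<partial>lborel)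
          = (\<integral>\<^sup>+ y. \<integral>\<^sup>+ x. (indicator B (Complex x y) :: ennreal) \<partial>lborel \<partial>lborel)" by simp
      moreover have "Complex x y = of_real y * \<i> + of_real x * v" for x y by (simp add: 2 complex_eq_iff)
      then have "(\<integral>\<^sup>+ x. (indicator B (Complex x y) :: ennreal) \<partial>lborel) = 0" for y by (simp add: line)
      ultimately show ?thesis by simp
    qed
  qed
  finally have "B \<in> null_sets lborel" by (intro null_setsI) auto
  then have "AE z in lborel. z \<notin> B" by (rule AE_not_in)
  then show ?thesis by eventually_elim (use Biff in blast)
qed

text \<open>At a point \<open>p\<close> of the interior the distance from \<open>C\<close> is not maximal, since the open image
  contains points beyond \<open>f p\<close> as seen from \<open>C\<close>.\<close>

lemma open_map_max_principle:
  fixes f :: "complex \<Rightarrow> complex"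
  assumes cont: "continuous_on D f" and D: "open D" and op: "open_map (top_of_set D) euclidean f"
    and R: "compact R" "R \<subseteq> D" "w \<in> R"
  obtains p where "p \<in> R" "p \<notin> interior R" "norm (f w - C) \<le> norm (f p - C)"
proof -
  have "continuous_on R (\<lambda>z. norm (f z - C))"
    by (intro continuous_intros continuous_on_subset[OF cont R(2)])
  then obtain p where p: "p \<in> R" "\<And>z. z \<in> R \<Longrightarrow> norm (f z - C) \<le> norm (f p - C)"
    using continuous_attains_sup[OF R(1)] R(3) by blast
  have "p \<notin> interior R"
  proof
    assume pi: "p \<in> interior R"
    have "openin (top_of_set D) (interior R)"
      using R(2) interior_subset[of R] unfolding openin_open by (intro exI[of _ "interior R"]) auto
    then have "open (f ` interior R)"
      using op unfolding open_map_def by auto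
    then obtain r where r: "0 < r" "ball (f p) r \<subseteq> f ` interior R"
      using pi open_contains_ball by blast
    \<comment> \<open>The direction from \<open>C\<close> to \<open>f p\<close>.\<close>
    define u where "u = (if f p = C then 1 else sgn (f p - C))"
    have u: "norm u = 1" by (simp add: u_def norm_sgn)
    have "f p + of_real (r / 2) * u \<in> ball (f p) r" using r u by (simp add: dist_norm norm_mult)
    then have "f p + of_real (r / 2) * u \<in> f ` interior R" by (rule subsetD[OF r(2)])
    then obtain q where q: "q \<in> interior R" "f q = f p + of_real (r / 2) * u" by (metis imageE)
    have "norm (f q - C) = norm (f p - C) + r / 2"
    proof -
      have "f p - C = of_real (norm (f p - C)) * u" by (simp add: u_def sgn_eq)
      then have "f q - C = of_real (norm (f p - C) + r / 2) * u"
        unfolding q(2) by (simp add: algebra_simps)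
      then show ?thesis using u r by (simp add: norm_mult del: of_real_add)
    qed
    then show False using p(2)[of q] q(1) interior_subset[of R] r by auto
  qed
  then show thesis using that p R(3) by blast
qed

text \<open>The points whose difference quotients in the direction \<open>v\<close> are within \<open>\<eta>\<close> of the number \<open>c\<close>, uniformly
  for all steps below \<open>\<delta>\<close>.\<close>

definition uniform_quotient_set :: "(complex \<Rightarrow> complex) \<Rightarrow> complex set \<Rightarrow> complex \<Rightarrow> complex \<Rightarrow> real \<Rightarrow> real \<Rightarrow> complex set" where
  "uniform_quotient_set f D v c \<eta> \<delta> = {z. ball z \<delta> \<subseteq> D \<and>
     (\<forall>t. \<bar>t\<bar> < \<delta> \<longrightarrow> norm (f (z + of_real t * v) - f z - of_real t * c) \<le> \<eta> * \<bar>t\<bar>)}"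

lemma closed_uniform_quotient_set:
  assumes D: "open D" and cont: "continuous_on D f" and v: "norm v = 1" and \<delta>: "0 < \<delta>"
  shows "closed (uniform_quotient_set f D v c \<eta> \<delta>)"
  unfolding closed_sequential_limits
proof (intro allI impI, elim conjE)
  fix x l assume x: "\<forall>n. x n \<in> uniform_quotient_set f D v c \<eta> \<delta>" and lim: "x \<longlonglongrightarrow> l"
  have bl: "ball l \<delta> \<subseteq> D"
  proof
    fix w assume "w \<in> ball l \<delta>"
    then have "\<forall>\<^sub>F n in sequentially. x n \<in> ball w \<delta>"
      by (intro topological_tendstoD[OF lim]) (auto simp: dist_commute)
    then obtain n where "x n \<in> ball w \<delta>" using eventually_happens'[OF sequentially_bot] by blast
    then have "w \<in> ball (x n) \<delta>" by (simp add: dist_commute)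
    then show "w \<in> D" using x unfolding uniform_quotient_set_def by blast
  qed
  have isc: "isCont f z" if "z \<in> D" for z using cont D that by (simp add: continuous_on_eq_continuous_at)
  have "norm (f (l + of_real t * v) - f l - of_real t * c) \<le> \<eta> * \<bar>t\<bar>" if t: "\<bar>t\<bar> < \<delta>" for t
  proof (rule tendsto_upperbound[OF _ _ sequentially_bot])
    have "l + of_real t * v \<in> D" "l \<in> D" using bl t v \<delta> by (auto simp: subset_iff dist_norm norm_mult)
    then show "(\<lambda>n. norm (f (x n + of_real t * v) - f (x n) - of_real t * c)) \<longlonglongrightarrow> norm (f (l + of_real t * v) - f l - of_real t * c)"
      by (intro tendsto_norm tendsto_diff tendsto_const isCont_tendsto_compose[OF isc] tendsto_add lim)
    show "\<forall>\<^sub>F n in sequentially. norm (f (x n + of_real t * v) - f (x n) - of_real t * c) \<le> \<eta> * \<bar>t\<bar>"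
      using x t by (intro always_eventually) (auto simp: uniform_quotient_set_def)
  qed
  then show "l \<in> uniform_quotient_set f D v c \<eta> \<delta>" using bl by (auto simp: uniform_quotient_set_def)
qed

text \<open>Let \<open>y\<close> be close to \<open>z\<close>. As the sets of uniform quotients are not porous at
  \<open>z\<close> along the axes, \<open>y\<close> lies in a small rectangle whose horizontal sides pass through points of the vertical axis
  with uniform horizontal quotients, and likewise for the vertical sides. A point of the boundary is
  reached from \<open>z\<close> by one step along an axis and one step along a side, and both increments of \<open>f\<close> are almost linear.
  So \<open>f\<close> is almost affine on the boundary, and the maximum principle carries the bound to \<open>y\<close>.\<close>

lemma has_derivative_of_uniform_quotients:
  fixes f :: "complex \<Rightarrow> complex"
  assumes cont: "continuous_on D f" and D: "open D" and op: "open_map (top_of_set D) euclidean f" and z: "z \<in> D"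
    and H1: "\<And>\<eta>. 0 < \<eta> \<Longrightarrow> \<exists>c \<delta>. 0 < \<delta> \<and> norm (c - a) \<le> \<eta> \<and> z \<in> uniform_quotient_set f D 1 c \<eta> \<delta> \<and>
        (\<forall>j. \<not> porous_along \<i> (uniform_quotient_set f D 1 c \<eta> \<delta>) (inverse (real (Suc j))) z)"
    and H2: "\<And>\<eta>. 0 < \<eta> \<Longrightarrow> \<exists>c \<delta>. 0 < \<delta> \<and> norm (c - b) \<le> \<eta> \<and> z \<in> uniform_quotient_set f D \<i> c \<eta> \<delta> \<and>
        (\<forall>j. \<not> porous_along 1 (uniform_quotient_set f D \<i> c \<eta> \<delta>) (inverse (real (Suc j))) z)"
  shows "(f has_derivative (\<lambda>h. of_real (Re h) * a + of_real (Im h) * b)) (at z)"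
  unfolding has_derivative_at_alt
proof (intro conjI allI impI)
  show "bounded_linear (\<lambda>h. of_real (Re h) * a + of_real (Im h) * b)"
    by (intro bounded_linear_add bounded_linear_mult_left[THEN bounded_linear_compose, unfolded o_def]
        bounded_linear_compose[OF bounded_linear_of_real] bounded_linear_Re bounded_linear_Im
        bounded_linear_mult_const)
  fix e :: real assume e: "0 < e"
  \<comment> \<open>Four errors of at most \<open>2 * \<eta> * \<rho>\<close> and two whose sum is at most \<open>2 * \<epsilon> * \<rho> * M\<close> have to add up to \<open>e * \<rho>\<close>.\<close>
  define \<eta> where "\<eta> = e / 16"
  have \<eta>: "0 < \<eta>" using e by (simp add: \<eta>_def)
  define M where "M = norm a + norm b + 1"
  have M: "0 < M" by (simp add: M_def add_nonneg_pos)
  obtain j where j: "inverse (real (Suc j)) < min (1 / 2) (e / (4 * M))"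
    using reals_Archimedean[of "min (1 / 2) (e / (4 * M))"] e M by auto
  define \<epsilon> where "\<epsilon> = inverse (real (Suc j))"
  have \<epsilon>: "0 < \<epsilon>" "\<epsilon> \<le> 1 / 2" "\<epsilon> < e / (4 * M)" using j by (auto simp: \<epsilon>_def)
  have \<epsilon>M: "2 * \<epsilon> * M \<le> e / 2"
  proof -
    have "\<epsilon> * (4 * M) < e" using \<epsilon>(3) M by (simp add: pos_less_divide_eq)
    then show ?thesis by simp
  qed
  obtain c \<delta> where c: "0 < \<delta>" "norm (c - a) \<le> \<eta>" "z \<in> uniform_quotient_set f D 1 c \<eta> \<delta>"
    "\<not> porous_along \<i> (uniform_quotient_set f D 1 c \<eta> \<delta>) \<epsilon> z" using H1[OF \<eta>] unfolding \<epsilon>_def by blast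
  obtain c' \<delta>' where c': "0 < \<delta>'" "norm (c' - b) \<le> \<eta>" "z \<in> uniform_quotient_set f D \<i> c' \<eta> \<delta>'"
    "\<not> porous_along 1 (uniform_quotient_set f D \<i> c' \<eta> \<delta>') \<epsilon> z" using H2[OF \<eta>] unfolding \<epsilon>_def by blast
  define A where "A = uniform_quotient_set f D 1 c \<eta> \<delta>"
  define A' where "A' = uniform_quotient_set f D \<i> c' \<eta> \<delta>'"
  obtain n where n: "\<And>\<rho> s. 0 < \<rho> \<Longrightarrow> \<rho> < inverse (real (Suc n)) \<Longrightarrow> \<bar>s\<bar> \<le> \<rho> \<Longrightarrow> \<exists>t\<in>{s..s + \<epsilon> * \<rho>}. z + of_real t * \<i> \<in> A"
    using c(4) unfolding porous_along_def A_def by blast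
  obtain n' where n': "\<And>\<rho> s. 0 < \<rho> \<Longrightarrow> \<rho> < inverse (real (Suc n')) \<Longrightarrow> \<bar>s\<bar> \<le> \<rho> \<Longrightarrow> \<exists>t\<in>{s..s + \<epsilon> * \<rho>}. z + of_real t * 1 \<in> A'"
    using c'(4) unfolding porous_along_def A'_def by blast
  obtain dD where dD: "0 < dD" "cball z dD \<subseteq> D" using D z open_contains_cball by blast
  have qA: "norm (f (q + of_real \<sigma>) - f q - of_real \<sigma> * c) \<le> \<eta> * \<bar>\<sigma>\<bar>" if "q \<in> A" "\<bar>\<sigma>\<bar> < \<delta>" for q \<sigma>
    using that by (auto simp: A_def uniform_quotient_set_def)
  have qA': "norm (f (q + of_real \<tau> * \<i>) - f q - of_real \<tau> * c') \<le> \<eta> * \<bar>\<tau>\<bar>" if "q \<in> A'" "\<bar>\<tau>\<bar> < \<delta>'" for q \<tau>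
    using that by (auto simp: A'_def uniform_quotient_set_def)
  define d where "d = min (min (inverse (real (Suc n))) (inverse (real (Suc n')))) (min (min \<delta> \<delta>') dD) / 4"
  have d: "0 < d" using c c' dD by (simp add: d_def)
  show "\<exists>d>0. \<forall>y. norm (y - z) < d \<longrightarrow> norm (f y - f z - (of_real (Re (y - z)) * a + of_real (Im (y - z)) * b)) \<le> e * norm (y - z)"
  proof (intro exI[of _ d] conjI allI impI d)
    fix y assume y: "norm (y - z) < d"
    define \<rho> where "\<rho> = norm (y - z)"
    show "norm (f y - f z - (of_real (Re (y - z)) * a + of_real (Im (y - z)) * b)) \<le> e * norm (y - z)"
    proof (cases "\<rho> = 0")
      case False
      then have \<rho>: "0 < \<rho>" by (simp add: \<rho>_def)
      have "4 * \<rho> < min (min (inverse (real (Suc n))) (inverse (real (Suc n')))) (min (min \<delta> \<delta>') dD)"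
        using y unfolding d_def \<rho>_def by linarith
      then have small: "4 * \<rho> < inverse (real (Suc n))" "4 * \<rho> < inverse (real (Suc n'))" "4 * \<rho> < \<delta>" "4 * \<rho> < \<delta>'" "4 * \<rho> < dD"
        by (simp_all del: of_nat_Suc)
      define s where "s = Re (y - z)"
      define t where "t = Im (y - z)"
      have st: "\<bar>s\<bar> \<le> \<rho>" "\<bar>t\<bar> \<le> \<rho>" unfolding s_def t_def \<rho>_def by (rule abs_Re_le_cmod abs_Im_le_cmod)+
      have \<epsilon>\<rho>: "0 \<le> \<epsilon> * (2 * \<rho>)" "\<epsilon> * (2 * \<rho>) \<le> \<rho>"
        using \<epsilon> \<rho> mult_right_mono[OF \<epsilon>(2), of "2 * \<rho>"] by auto
      have r2: "0 < 2 * \<rho>" "2 * \<rho> < inverse (real (Suc n))" "2 * \<rho> < inverse (real (Suc n'))" using \<rho> small by linarith+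
      have b1: "\<bar>t - \<epsilon> * (2 * \<rho>)\<bar> \<le> 2 * \<rho>" "\<bar>t\<bar> \<le> 2 * \<rho>" "\<bar>s - \<epsilon> * (2 * \<rho>)\<bar> \<le> 2 * \<rho>" "\<bar>s\<bar> \<le> 2 * \<rho>"
        using st \<epsilon>\<rho> \<rho> by linarith+
      \<comment> \<open>Sides of the rectangle just below, above, left and right of \<open>y\<close>.\<close>
      obtain y1 where y1: "t - \<epsilon> * (2 * \<rho>) \<le> y1" "y1 \<le> t" "z + of_real y1 * \<i> \<in> A"
        using n[OF r2(1,2) b1(1)] by auto
      obtain y2 where y2: "t \<le> y2" "y2 \<le> t + \<epsilon> * (2 * \<rho>)" "z + of_real y2 * \<i> \<in> A"
        using n[OF r2(1,2) b1(2)] by auto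
      obtain x1 where x1: "s - \<epsilon> * (2 * \<rho>) \<le> x1" "x1 \<le> s" "z + of_real x1 \<in> A'"
        using n'[OF r2(1,3) b1(3)] by auto
      obtain x2 where x2: "s \<le> x2" "x2 \<le> s + \<epsilon> * (2 * \<rho>)" "z + of_real x2 \<in> A'"
        using n'[OF r2(1,3) b1(4)] by auto
      define R where "R = cbox (z + Complex x1 y1) (z + Complex x2 y2)"
      have Rmem: "p \<in> R \<longleftrightarrow> x1 \<le> Re (p - z) \<and> Re (p - z) \<le> x2 \<and> y1 \<le> Im (p - z) \<and> Im (p - z) \<le> y2" for p
        unfolding R_def in_cbox_complex_iff by auto
      have Rint: "p \<in> interior R \<longleftrightarrow> x1 < Re (p - z) \<and> Re (p - z) < x2 \<and> y1 < Im (p - z) \<and> Im (p - z) < y2" for p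
        unfolding R_def interior_cbox in_box_complex_iff by auto
      have RD: "R \<subseteq> D"
      proof
        fix p assume "p \<in> R"
        then have "\<bar>Re (p - z)\<bar> \<le> 2 * \<rho>" "\<bar>Im (p - z)\<bar> \<le> 2 * \<rho>"
          unfolding Rmem using x1 x2 y1 y2 st \<epsilon>\<rho> by linarith+
        then have "norm (p - z) \<le> dD" using cmod_le[of "p - z"] small(5) by linarith
        then show "p \<in> D" using dD by (auto simp: dist_norm norm_minus_commute)
      qed
      have yR: "y \<in> R" unfolding Rmem using x1 x2 y1 y2 by (simp add: s_def t_def)
      define C where "C = f z + (of_real s * a + of_real t * b)"
      obtain p where p: "p \<in> R" "p \<notin> interior R" "norm (f y - C) \<le> norm (f p - C)"
        using open_map_max_principle[OF cont D op _ RD yR, where C = C] by (metis R_def compact_cbox)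
      define \<sigma> where "\<sigma> = Re (p - z)"
      define \<tau> where "\<tau> = Im (p - z)"
      have pe: "p = z + of_real \<sigma> + of_real \<tau> * \<i>" by (simp add: \<sigma>_def \<tau>_def complex_eq_iff)
      have box: "x1 \<le> \<sigma>" "\<sigma> \<le> x2" "y1 \<le> \<tau>" "\<tau> \<le> y2" using p(1) unfolding Rmem \<sigma>_def \<tau>_def by auto
      have bd: "\<bar>\<sigma>\<bar> \<le> 2 * \<rho>" "\<bar>\<tau>\<bar> \<le> 2 * \<rho>" "\<bar>\<sigma> - s\<bar> \<le> \<epsilon> * (2 * \<rho>)" "\<bar>\<tau> - t\<bar> \<le> \<epsilon> * (2 * \<rho>)"
        using box x1 x2 y1 y2 st \<epsilon>\<rho> by linarith+
      have fin: "norm (u1 + u2 + of_real \<sigma> * (c - a) + of_real (\<sigma> - s) * a + of_real \<tau> * (c' - b) + of_real (\<tau> - t) * b) \<le> e * \<rho>"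
        if u: "norm u1 \<le> \<eta> * (2 * \<rho>)" "norm u2 \<le> \<eta> * (2 * \<rho>)" for u1 u2
      proof -
        have 1: "norm (of_real \<sigma> * (c - a)) \<le> 2 * \<rho> * \<eta>" "norm (of_real \<tau> * (c' - b)) \<le> 2 * \<rho> * \<eta>"
          using bd c(2) c'(2) \<rho> by (auto simp: norm_mult intro!: mult_mono)
        have 2: "norm (of_real (\<sigma> - s) * a) \<le> \<epsilon> * (2 * \<rho>) * norm a" "norm (of_real (\<tau> - t) * b) \<le> \<epsilon> * (2 * \<rho>) * norm b"
          using bd unfolding norm_mult norm_of_real by (auto intro!: mult_right_mono)
        have "norm (u1 + u2 + of_real \<sigma> * (c - a) + of_real (\<sigma> - s) * a + of_real \<tau> * (c' - b) + of_real (\<tau> - t) * b)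
          \<le> norm u1 + norm u2 + norm (of_real \<sigma> * (c - a)) + norm (of_real (\<sigma> - s) * a) + norm (of_real \<tau> * (c' - b)) + norm (of_real (\<tau> - t) * b)"
          by (intro order_trans[OF norm_triangle_ineq] add_mono order_refl)
        also have "\<dots> \<le> \<eta> * (2 * \<rho>) + \<eta> * (2 * \<rho>) + 2 * \<rho> * \<eta> + \<epsilon> * (2 * \<rho>) * norm a + 2 * \<rho> * \<eta> + \<epsilon> * (2 * \<rho>) * norm b"
          by (intro add_mono u 1 2)
        also have "\<dots> = \<rho> * (8 * \<eta> + 2 * \<epsilon> * (norm a + norm b))" by (simp add: algebra_simps)
        also have "\<dots> \<le> \<rho> * (e / 2 + 2 * \<epsilon> * M)"
          using \<rho> \<epsilon> by (intro mult_left_mono add_mono) (auto simp: \<eta>_def M_def)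
        also have "\<dots> \<le> \<rho> * (e / 2 + e / 2)" using \<rho> \<epsilon>M by (intro mult_left_mono add_mono) auto
        finally show ?thesis by (simp add: mult.commute)
      qed
      have side: "\<sigma> = x1 \<or> \<sigma> = x2 \<or> \<tau> = y1 \<or> \<tau> = y2"
        using p(2) box unfolding Rint \<sigma>_def[symmetric] \<tau>_def[symmetric] by linarith
      have "norm (f p - C) \<le> e * \<rho>"
      proof (cases "\<tau> = y1 \<or> \<tau> = y2")
        case True
        \<comment> \<open>On a horizontal side: from \<open>z\<close> up the axis to \<open>q\<close>, then along the side to \<open>p\<close>.\<close>
        define q where "q = z + of_real \<tau> * \<i>"
        have qA_mem: "q \<in> A" using True y1 y2 by (auto simp: q_def)
        have pq: "p = q + of_real \<sigma>" by (simp add: pe q_def)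
        have "\<bar>\<sigma>\<bar> < \<delta>" "\<bar>\<tau>\<bar> < \<delta>'" using bd small \<rho> by linarith+
        then have "norm (f p - f q - of_real \<sigma> * c) \<le> \<eta> * \<bar>\<sigma>\<bar>" "norm (f q - f z - of_real \<tau> * c') \<le> \<eta> * \<bar>\<tau>\<bar>"
          using qA[OF qA_mem] qA'[of z] c'(3) unfolding pq q_def A'_def by auto
        then have "norm (f p - f q - of_real \<sigma> * c) \<le> \<eta> * (2 * \<rho>)" "norm (f q - f z - of_real \<tau> * c') \<le> \<eta> * (2 * \<rho>)"
          using bd(1,2) \<eta> by (meson mult_left_mono order_trans less_imp_le)+
        from fin[OF this] show ?thesis by (simp add: C_def algebra_simps)
      next
        case False
        then have sd: "\<sigma> = x1 \<or> \<sigma> = x2" using side by blast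
        \<comment> \<open>On a vertical side: from \<open>z\<close> along the axis to \<open>q\<close>, then up the side to \<open>p\<close>.\<close>
        define q where "q = z + of_real \<sigma>"
        have qA_mem: "q \<in> A'" using sd x1 x2 by (auto simp: q_def)
        have pq: "p = q + of_real \<tau> * \<i>" by (simp add: pe q_def)
        have "\<bar>\<sigma>\<bar> < \<delta>" "\<bar>\<tau>\<bar> < \<delta>'" using bd small \<rho> by linarith+
        then have "norm (f p - f q - of_real \<tau> * c') \<le> \<eta> * \<bar>\<tau>\<bar>" "norm (f q - f z - of_real \<sigma> * c) \<le> \<eta> * \<bar>\<sigma>\<bar>"
          using qA'[OF qA_mem] qA[of z] c(3) unfolding pq q_def A_def by auto
        then have "norm (f p - f q - of_real \<tau> * c') \<le> \<eta> * (2 * \<rho>)" "norm (f q - f z - of_real \<sigma> * c) \<le> \<eta> * (2 * \<rho>)"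
          using bd(1,2) \<eta> by (meson mult_left_mono order_trans less_imp_le)+
        from fin[OF this] show ?thesis by (simp add: C_def algebra_simps)
      qed
      then have "norm (f y - C) \<le> e * \<rho>" using p(3) by linarith
      then show ?thesis unfolding C_def s_def t_def \<rho>_def by (simp add: diff_diff_add)
    qed (simp add: \<rho>_def)
  qed
qed

text \<open>Rational values of \<open>c\<close> and reciprocal values of \<open>\<delta>\<close> suffice; hence countably many of these closed
  sets cover the points with partial derivatives.\<close>

lemma uniform_quotient_set_of_partial:
  assumes D: "open D" and z: "z \<in> D" and v: "norm v = 1" and "has_dir_deriv f v z" and \<eta>: "0 < \<eta>"
  obtains p q :: rat and m where "norm (Complex (of_rat p) (of_rat q) - dir_deriv v f z) \<le> \<eta>"
    "z \<in> uniform_quotient_set f D v (Complex (of_rat p) (of_rat q)) \<eta> (inverse (real (Suc m)))"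
proof -
  define a where "a = dir_deriv v f z"
  have "((\<lambda>t::real. f (z + of_real t * v)) has_vector_derivative a) (at 0)"
    using assms(4) unfolding has_dir_deriv_def dir_deriv_def a_def using vector_derivative_works by blast
  then obtain d where d: "0 < d" "\<And>t. \<bar>t\<bar> < d \<Longrightarrow> norm (f (z + of_real t * v) - f z - t *\<^sub>R a) \<le> \<eta> / 2 * \<bar>t\<bar>"
  proof -
    have "\<exists>d>0. \<forall>y. norm (y - 0) < d \<longrightarrow> norm (f (z + of_real y * v) - f (z + of_real 0 * v) - (y - 0) *\<^sub>R a) \<le> \<eta> / 2 * norm (y - 0)"
      using \<open>(_ has_vector_derivative _) _\<close> half_gt_zero[OF \<eta>]
      unfolding has_vector_derivative_def has_derivative_at_alt by blast
    then show thesis using that by auto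
  qed
  obtain e where e: "0 < e" "ball z e \<subseteq> D" using D z open_contains_ball by blast
  obtain m where m: "inverse (real (Suc m)) < min d e" using reals_Archimedean[of "min d e"] d e by auto
  obtain p where p: "Re a - \<eta> / 4 < of_rat p" "of_rat p < Re a" using of_rat_dense[of "Re a - \<eta> / 4" "Re a"] \<eta> by auto
  obtain q where q: "Im a - \<eta> / 4 < of_rat q" "of_rat q < Im a" using of_rat_dense[of "Im a - \<eta> / 4" "Im a"] \<eta> by auto
  define c where "c = Complex (of_rat p) (of_rat q)"
  have ca: "norm (c - a) \<le> \<eta> / 2"
    using cmod_le[of "c - a"] p q by (simp add: c_def)
  have "z \<in> uniform_quotient_set f D v c \<eta> (inverse (real (Suc m)))"
    unfolding uniform_quotient_set_def
  proof (intro CollectI conjI allI impI)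
    show "ball z (inverse (real (Suc m))) \<subseteq> D" using e m by (auto simp: subset_iff)
    fix t :: real assume "\<bar>t\<bar> < inverse (real (Suc m))"
    then have t: "\<bar>t\<bar> < d" using m by linarith
    have "norm (f (z + of_real t * v) - f z - of_real t * c)
      = norm ((f (z + of_real t * v) - f z - t *\<^sub>R a) - of_real t * (c - a))"
      by (simp add: scaleR_conv_of_real algebra_simps)
    also have "\<dots> \<le> norm (f (z + of_real t * v) - f z - t *\<^sub>R a) + norm (of_real t * (c - a))"
      by (rule norm_triangle_ineq4)
    also have "\<dots> \<le> \<eta> / 2 * \<bar>t\<bar> + \<bar>t\<bar> * (\<eta> / 2)"
      unfolding norm_mult norm_of_real by (intro add_mono d t mult_left_mono ca) auto
    finally show "norm (f (z + of_real t * v) - f z - of_real t * c) \<le> \<eta> * \<bar>t\<bar>" by (simp add: mult.commute)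
  qed
  moreover have "norm (c - a) \<le> \<eta>" using ca \<eta> by linarith
  ultimately show thesis using that unfolding c_def a_def by blast
qed

text \<open>The theorem of Gehring and Lehto: the points to be excluded are those at which one of countably many
  closed sets of uniform quotients is porous along an axis.\<close>

theorem Gehring_Lehto:
  fixes f :: "complex \<Rightarrow> complex"
  assumes cont: "continuous_on D f" and D: "open D" and op: "open_map (top_of_set D) euclidean f"
    and pd: "has_partials_ae D f"
  shows "AE z in lborel. z \<in> D \<longrightarrow> has_dir_deriv f 1 z \<and> has_dir_deriv f \<i> z \<and>
    (f has_derivative (\<lambda>h. of_real (Re h) * dir_deriv 1 f z + of_real (Im h) * dir_deriv \<i> f z)) (at z)"
proof -
  define S where "S v p q k m = uniform_quotient_set f D v (Complex (of_rat p) (of_rat q)) (inverse (real (Suc k))) (inverse (real (Suc m)))"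
    for v and p q :: rat and k m :: nat
  have S: "closed (S v p q k m)" if "v \<in> {1, \<i>}" for v p q k m
    unfolding S_def using that by (intro closed_uniform_quotient_set D cont) auto
  have "AE z in lborel. \<forall>x :: rat \<times> rat \<times> nat \<times> nat \<times> nat. case x of (p, q, k, m, j) \<Rightarrow>
     z \<in> S v p q k m \<longrightarrow> \<not> porous_along w (S v p q k m) (inverse (real (Suc j))) z"
    if "v \<in> {1, \<i>}" "w \<in> {1, \<i>}" for v w
  proof (subst AE_all_countable, intro allI)
    fix x :: "rat \<times> rat \<times> nat \<times> nat \<times> nat"
    obtain p q k m j where x: "x = (p, q, k, m, j)" by (metis prod_cases5)
    show "AE z in lborel. case x of (p, q, k, m, j) \<Rightarrow>
       z \<in> S v p q k m \<longrightarrow> \<not> porous_along w (S v p q k m) (inverse (real (Suc j))) z"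
      unfolding x prod.case by (rule AE_not_porous_along[OF S[OF that(1)] _ that(2)]) simp
  qed
  from this[of 1 \<i>] this[of \<i> 1] have
    h1: "AE z in lborel. \<forall>x :: rat \<times> rat \<times> nat \<times> nat \<times> nat. case x of (p, q, k, m, j) \<Rightarrow>
     z \<in> S 1 p q k m \<longrightarrow> \<not> porous_along \<i> (S 1 p q k m) (inverse (real (Suc j))) z" and
    h2: "AE z in lborel. \<forall>x :: rat \<times> rat \<times> nat \<times> nat \<times> nat. case x of (p, q, k, m, j) \<Rightarrow>
     z \<in> S \<i> p q k m \<longrightarrow> \<not> porous_along 1 (S \<i> p q k m) (inverse (real (Suc j))) z"
    by auto
  have h3: "AE z in lborel. z \<in> D \<longrightarrow> has_dir_deriv f 1 z \<and> has_dir_deriv f \<i> z"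
    using pd unfolding has_partials_ae_def AE_completion_iff .
  from h1 h2 h3 show ?thesis
  proof eventually_elim
    case (elim z)
    show ?case
    proof (intro impI conjI)
      assume z: "z \<in> D"
      then show pdz: "has_dir_deriv f 1 z" "has_dir_deriv f \<i> z" using elim(3) by auto
      have hyp: "\<exists>c \<delta>. 0 < \<delta> \<and> norm (c - dir_deriv v f z) \<le> \<eta> \<and> z \<in> uniform_quotient_set f D v c \<eta> \<delta> \<and>
        (\<forall>j. \<not> porous_along w (uniform_quotient_set f D v c \<eta> \<delta>) (inverse (real (Suc j))) z)"
        if \<eta>: "0 < \<eta>" and v: "norm v = 1" "has_dir_deriv f v z"
          and nh: "\<And>p q k m j. z \<in> S v p q k m \<Longrightarrow> \<not> porous_along w (S v p q k m) (inverse (real (Suc j))) z" for v w \<eta>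
      proof -
        obtain k where k: "inverse (real (Suc k)) < \<eta>" using reals_Archimedean[OF \<eta>] by blast
        obtain p q m where pqm: "norm (Complex (of_rat p) (of_rat q) - dir_deriv v f z) \<le> inverse (real (Suc k))" "z \<in> S v p q k m"
          using uniform_quotient_set_of_partial[OF D z v, of "inverse (real (Suc k))"] unfolding S_def by auto
        have mono: "S v p q k m \<subseteq> uniform_quotient_set f D v (Complex (of_rat p) (of_rat q)) \<eta> (inverse (real (Suc m)))"
          unfolding S_def uniform_quotient_set_def using k
          by (auto intro: order_trans[OF _ mult_right_mono[OF less_imp_le[OF k]]])
        have "\<not> porous_along w (uniform_quotient_set f D v (Complex (of_rat p) (of_rat q)) \<eta> (inverse (real (Suc m)))) (inverse (real (Suc j))) z" for j
          using nh[OF pqm(2), of j] mono unfolding porous_along_def by blast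
        then show ?thesis
          using pqm mono k by (intro exI[of _ "Complex (of_rat p) (of_rat q)"] exI[of _ "inverse (real (Suc m))"]) auto
      qed
      have nh1: "\<not> porous_along \<i> (S 1 p q k m) (inverse (real (Suc j))) z" if "z \<in> S 1 p q k m" for p q k m j
        using elim(1)[rule_format, of "(p, q, k, m, j)"] that by simp
      have nh2: "\<not> porous_along 1 (S \<i> p q k m) (inverse (real (Suc j))) z" if "z \<in> S \<i> p q k m" for p q k m j
        using elim(2)[rule_format, of "(p, q, k, m, j)"] that by simp
      show "(f has_derivative (\<lambda>h. of_real (Re h) * dir_deriv 1 f z + of_real (Im h) * dir_deriv \<i> f z)) (at z)"
      proof (rule has_derivative_of_uniform_quotients[OF cont D op z])
        fix \<eta> :: real assume "0 < \<eta>"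
        then show "\<exists>c \<delta>. 0 < \<delta> \<and> norm (c - dir_deriv 1 f z) \<le> \<eta> \<and> z \<in> uniform_quotient_set f D 1 c \<eta> \<delta> \<and>
          (\<forall>j. \<not> porous_along \<i> (uniform_quotient_set f D 1 c \<eta> \<delta>) (inverse (real (Suc j))) z)"
          by (rule hyp[OF _ _ pdz(1) nh1]) simp
      next
        fix \<eta> :: real assume "0 < \<eta>"
        then show "\<exists>c \<delta>. 0 < \<delta> \<and> norm (c - dir_deriv \<i> f z) \<le> \<eta> \<and> z \<in> uniform_quotient_set f D \<i> c \<eta> \<delta> \<and>
          (\<forall>j. \<not> porous_along 1 (uniform_quotient_set f D \<i> c \<eta> \<delta>) (inverse (real (Suc j))) z)"
          by (rule hyp[OF _ _ pdz(2) nh2]) simp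
      qed
    qed
  qed
qed

section \<open>The area inequality for the Jacobian\<close>

lemma det_complex_partials:
  "det_complex (\<lambda>h. of_real (Re h) * a + of_real (Im h) * b) = (cmod ((a - \<i> * b) / 2))\<^sup>2 - (cmod ((a + \<i> * b) / 2))\<^sup>2"
  unfolding det_complex_def cmod_power2 by (simp add: power2_eq_square field_simps)

text \<open>In the coordinates of Wirtinger the map is \<open>h \<mapsto> f_z * h + f_zbar * cnj h\<close>.\<close>

lemma partials_lower_bound:
  "(cmod ((a - \<i> * b) / 2) - cmod ((a + \<i> * b) / 2)) * cmod h \<le> cmod (of_real (Re h) * a + of_real (Im h) * b)"
proof -
  have "of_real (Re h) * a + of_real (Im h) * b = ((a - \<i> * b) / 2) * h + ((a + \<i> * b) / 2) * cnj h"
    by (simp add: complex_eq_iff field_simps)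
  also have "cmod (((a - \<i> * b) / 2) * h) - cmod (((a + \<i> * b) / 2) * cnj h) \<le> cmod \<dots>"
    by (rule norm_diff_ineq)
  finally show ?thesis by (simp only: norm_mult complex_mod_cnj left_diff_distrib)
qed

text \<open>This is \<open>|f_z|\<^sup>2 - |f_zbar|\<^sup>2\<close>, the Jacobian, when \<open>a\<close> and \<open>b\<close> are the partial derivatives of \<open>f\<close>.\<close>

definition grad_jacobian :: "complex \<Rightarrow> complex \<Rightarrow> real" where
  "grad_jacobian a b = (cmod ((a - \<i> * b) / 2))\<^sup>2 - (cmod ((a + \<i> * b) / 2))\<^sup>2"

lemma measurable_grad_jacobian [measurable (raw)]:
  assumes [measurable]: "a \<in> borel_measurable M" "b \<in> borel_measurable M"
  shows "(\<lambda>z. grad_jacobian (a z) (b z)) \<in> borel_measurable M"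
  unfolding grad_jacobian_def by measurable

lemma suminf_indicator_image_le_multiplicity:
  assumes P: "disjoint_family P" "\<And>n::nat. P n \<subseteq> D"
  shows "(\<Sum>n. indicator (f ` P n) y) \<le> multiplicity_at y f D"
proof (cases "finite {x \<in> D. f x = y}")
  case True
  show ?thesis
  proof (rule suminf_le_const)
    fix m
    define I where "I = {n. n < m \<and> y \<in> f ` P n}"
    have "\<forall>n\<in>I. \<exists>x. x \<in> P n \<and> f x = y" by (auto simp: I_def)
    then obtain g where g: "\<And>n. n \<in> I \<Longrightarrow> g n \<in> P n \<and> f (g n) = y" by metis
    have "inj_on g I"
    proof (rule inj_onI)
      fix i j assume "i \<in> I" "j \<in> I" "g i = g j"
      then have "g i \<in> P i \<inter> P j" using g by force
      then show "i = j" using P(1) by (auto simp: disjoint_family_on_def)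
    qed
    moreover have "g ` I \<subseteq> {x \<in> D. f x = y}" using g P(2) by blast
    ultimately have "card I \<le> card {x \<in> D. f x = y}" using True by (rule card_inj_on_le)
    moreover have "(\<Sum>n<m. indicator (f ` P n) y :: ennreal) = (\<Sum>n\<in>I. 1)"
      by (rule sum.mono_neutral_cong_right) (auto simp: I_def)
    ultimately show "(\<Sum>n<m. indicator (f ` P n) y) \<le> multiplicity_at y f D"
      using True by (simp add: multiplicity_at_def)
  qed auto
qed (simp add: multiplicity_at_def)

text \<open>Where the Jacobian is positive, the differential is bounded below by
  \<open>|f_z| - |f_zbar| > 0\<close>. So each such point lies in one of the sets \<open>T m\<close>, at whose points \<open>f\<close> expands distances below
  \<open>1 / (m + 1)\<close> at least by the factor \<open>1 / (m + 1)\<close>. Intersected with the squares of a grid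
  finer than that scale, these sets become pieces on which \<open>f\<close> is injective. Change of variables on disjoint
  pieces counts every value at most as often as it is taken.\<close>

theorem jacobian_area_inequality:
  fixes f :: "complex \<Rightarrow> complex" and G1 G2 :: "complex \<Rightarrow> complex"
  assumes D: "open D" and cont: "continuous_on D f" and u[measurable]: "u \<in> borel_measurable borel"
    and G1[measurable]: "G1 \<in> borel_measurable borel" and G2[measurable]: "G2 \<in> borel_measurable borel"
    and der: "AE z in lborel. z \<in> D \<longrightarrow> (f has_derivative (\<lambda>h. of_real (Re h) * G1 z + of_real (Im h) * G2 z)) (at z)"
  shows "(\<integral>\<^sup>+ z\<in>D. u (f z) * ennreal (grad_jacobian (G1 z) (G2 z)) \<partial>lborel) \<le> (\<integral>\<^sup>+ y. u y * multiplicity_at y f D \<partial>lborel)"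
proof -
  define J where "J z = grad_jacobian (G1 z) (G2 z)" for z
  have J[measurable]: "J \<in> borel_measurable borel" unfolding J_def[abs_def] by measurable
  \<comment> \<open>Outside \<open>D\<close> the map is continued by 0, which makes it Borel measurable.\<close>
  define F where "F z = indicator D z *\<^sub>R f z" for z
  have Dm[measurable]: "D \<in> sets borel" using D by simp
  have Fm[measurable]: "F \<in> borel_measurable borel"
    unfolding F_def[abs_def] by (rule borel_measurable_continuous_on_indicator[OF _ cont]) (use D in auto)
  obtain N where N: "N \<in> null_sets lborel"
    "{z. \<not> (z \<in> D \<longrightarrow> (f has_derivative (\<lambda>h. of_real (Re h) * G1 z + of_real (Im h) * G2 z)) (at z))} \<subseteq> N"
    using AE_E[OF der] by (auto simp: null_sets_def)
  have Nm[measurable]: "N \<in> sets borel" using N(1) by auto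
  define S where "S = (D \<inter> {z. 0 < J z}) - N"
  have Sm[measurable]: "S \<in> sets borel" unfolding S_def by measurable
  have derS: "(f has_derivative (\<lambda>h. of_real (Re h) * G1 z + of_real (Im h) * G2 z)) (at z)" if "z \<in> S" for z
    using that N(2) by (auto simp: S_def)
  define T where "T m = {z \<in> D. \<forall>w\<in>D. dist w z < inverse (real (Suc m)) \<longrightarrow> inverse (real (Suc m)) * dist w z \<le> dist (f w) (f z)}" for m
  have T[measurable]: "T m \<in> sets borel" for m
  proof -
    let ?\<delta> = "inverse (real (Suc m))"
    have eq: "T m = D - (\<Union>w\<in>D. D \<inter> ((\<lambda>z. (dist w z, ?\<delta> * dist w z - dist (f w) (f z))) -` ({..<?\<delta>} \<times> {0<..})))"
    proof (intro set_eqI iffI)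
      fix z assume "z \<in> T m"
      then have "z \<in> D" and z: "\<And>w. w \<in> D \<Longrightarrow> dist w z < ?\<delta> \<Longrightarrow> ?\<delta> * dist w z \<le> dist (f w) (f z)"
        unfolding T_def by blast+
      have "\<not> (dist w z < ?\<delta> \<and> 0 < ?\<delta> * dist w z - dist (f w) (f z))" if "w \<in> D" for w
        using z[OF that] by linarith
      then show "z \<in> D - (\<Union>w\<in>D. D \<inter> ((\<lambda>z. (dist w z, ?\<delta> * dist w z - dist (f w) (f z))) -` ({..<?\<delta>} \<times> {0<..})))"
        using \<open>z \<in> D\<close> by (simp add: vimage_def)
    next
      fix z assume "z \<in> D - (\<Union>w\<in>D. D \<inter> ((\<lambda>z. (dist w z, ?\<delta> * dist w z - dist (f w) (f z))) -` ({..<?\<delta>} \<times> {0<..})))"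
      then have "z \<in> D" and z: "\<And>w. w \<in> D \<Longrightarrow> \<not> (dist w z < ?\<delta> \<and> 0 < ?\<delta> * dist w z - dist (f w) (f z))"
        by (simp_all add: vimage_def)
      have "?\<delta> * dist w z \<le> dist (f w) (f z)" if "w \<in> D" "dist w z < ?\<delta>" for w
        using z[OF that(1)] that(2) by linarith
      then show "z \<in> T m" using \<open>z \<in> D\<close> unfolding T_def by blast
    qed
    have "open (D \<inter> ((\<lambda>z. (dist w z, ?\<delta> * dist w z - dist (f w) (f z))) -` ({..<?\<delta>} \<times> {0<..})))" for w
      by (intro continuous_open_preimage D continuous_on_Pair continuous_intros cont open_Times open_lessThan open_greaterThan)
    then show ?thesis unfolding eq by (intro sets.Diff[OF Dm borel_open] open_UN ballI)
  qed
  have coverT: "\<exists>m. z \<in> T m" if z: "z \<in> S" for z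
  proof -
    define c where "c = cmod ((G1 z - \<i> * G2 z) / 2) - cmod ((G1 z + \<i> * G2 z) / 2)"
    have "0 < c * (cmod ((G1 z - \<i> * G2 z) / 2) + cmod ((G1 z + \<i> * G2 z) / 2))"
      using z by (simp add: S_def J_def grad_jacobian_def c_def power2_eq_square algebra_simps)
    have c: "0 < c"
    proof (rule ccontr)
      assume "\<not> 0 < c"
      then have "c * (cmod ((G1 z - \<i> * G2 z) / 2) + cmod ((G1 z + \<i> * G2 z) / 2)) \<le> 0"
        by (intro mult_nonpos_nonneg add_nonneg_nonneg norm_ge_zero) simp
      then show False using \<open>0 < c * _\<close> by linarith
    qed
    obtain d where d: "0 < d" "\<And>w. norm (w - z) < d \<Longrightarrow>
       norm (f w - f z - (of_real (Re (w - z)) * G1 z + of_real (Im (w - z)) * G2 z)) \<le> c / 2 * norm (w - z)"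
      using derS[OF z] half_gt_zero[OF c] unfolding has_derivative_at_alt by blast
    obtain m where m: "inverse (real (Suc m)) < min d (c / 2)" using reals_Archimedean[of "min d (c / 2)"] d c by auto
    have "inverse (real (Suc m)) * dist w z \<le> dist (f w) (f z)" if "dist w z < inverse (real (Suc m))" for w
    proof -
      have "norm (w - z) < d" using that m by (simp add: dist_norm)
      from d(2)[OF this]
      have 1: "norm (f w - f z - (of_real (Re (w - z)) * G1 z + of_real (Im (w - z)) * G2 z)) \<le> c / 2 * norm (w - z)" .
      have 2: "c * norm (w - z) \<le> norm (of_real (Re (w - z)) * G1 z + of_real (Im (w - z)) * G2 z)"
        unfolding c_def by (rule partials_lower_bound)
      have 3: "norm (of_real (Re (w - z)) * G1 z + of_real (Im (w - z)) * G2 z)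
        \<le> norm (f w - f z) + norm (f w - f z - (of_real (Re (w - z)) * G1 z + of_real (Im (w - z)) * G2 z))"
        using norm_triangle_ineq4[of "f w - f z" "f w - f z - (of_real (Re (w - z)) * G1 z + of_real (Im (w - z)) * G2 z)"]
        by simp
      have "inverse (real (Suc m)) * norm (w - z) \<le> c / 2 * norm (w - z)"
        using m by (intro mult_right_mono) auto
      also have "\<dots> \<le> norm (f w - f z)" using 1 2 3 by (simp add: field_simps) 
      finally show ?thesis by (simp add: dist_norm)
    qed
    then show ?thesis using z by (auto simp: T_def S_def intro!: exI[of _ m])
  qed
  \<comment> \<open>Squares with sides a quarter of \<open>1 / (m + 1)\<close>, whose diameter is below that scale.\<close>
  define cell where "cell m i j = {z. \<lfloor>Re z * (4 * real (Suc m))\<rfloor> = i \<and> \<lfloor>Im z * (4 * real (Suc m))\<rfloor> = j}" for m :: nat and i j :: int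
  have cellm[measurable]: "cell m i j \<in> sets borel" for m i j unfolding cell_def by measurable
  define X where "X n = (case from_nat n :: nat \<times> int \<times> int of (m, i, j) \<Rightarrow> S \<inter> T m \<inter> cell m i j)" for n :: nat
  have X[measurable]: "X n \<in> sets borel" for n unfolding X_def by (auto split: prod.split)
  have inj: "inj_on f (X n)" for n
  proof (rule inj_onI)
    fix w z assume wz: "w \<in> X n" "z \<in> X n" "f w = f z"
    obtain m i j where n: "from_nat n = (m :: nat, i :: int, j :: int)" by (metis prod_cases3)
    have w: "w \<in> T m" "w \<in> cell m i j" and z: "z \<in> T m" "z \<in> cell m i j" and wD: "w \<in> D"
      using wz by (auto simp: X_def n S_def)
    have a: "\<bar>Re w * (4 * real (Suc m)) - Re z * (4 * real (Suc m))\<bar> < 1" "\<bar>Im w * (4 * real (Suc m)) - Im z * (4 * real (Suc m))\<bar> < 1"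
      using w(2) z(2) unfolding cell_def by (auto simp del: of_nat_Suc) linarith+
    have "\<bar>Re (w - z)\<bar> * (4 * real (Suc m)) < 1" "\<bar>Im (w - z)\<bar> * (4 * real (Suc m)) < 1"
      using a by (simp_all only: left_diff_distrib[symmetric] abs_mult minus_complex.sel abs_of_nat abs_numeral)
    then have "\<bar>Re (w - z)\<bar> < 1 / (4 * real (Suc m))" "\<bar>Im (w - z)\<bar> < 1 / (4 * real (Suc m))"
      by (simp_all add: pos_less_divide_eq del: of_nat_Suc)
    then have "norm (w - z) < 1 / (4 * real (Suc m)) + 1 / (4 * real (Suc m))" using cmod_le[of "w - z"] by linarith
    also have "\<dots> \<le> inverse (real (Suc m))" by (simp add: field_simps)
    finally have "dist w z < inverse (real (Suc m))" by (simp add: dist_norm)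
    then have "inverse (real (Suc m)) * dist w z \<le> dist (f w) (f z)" using z(1) wD by (auto simp: T_def)
    then show "w = z" using wz(3) by (simp add: mult_le_0_iff del: of_nat_Suc)
  qed
  have UX: "(\<Union>n. X n) = S"
  proof
    show "(\<Union>n. X n) \<subseteq> S" by (auto simp: X_def split: prod.splits)
    show "S \<subseteq> (\<Union>n. X n)"
    proof
      fix z assume z: "z \<in> S"
      then obtain m where "z \<in> T m" using coverT by blast
      then have "z \<in> X (to_nat (m, \<lfloor>Re z * (4 * real (Suc m))\<rfloor>, \<lfloor>Im z * (4 * real (Suc m))\<rfloor>))"
        using z by (simp add: X_def cell_def)
      then show "z \<in> (\<Union>n. X n)" by blast
    qed
  qed
  define P where "P = disjointed X"
  have PX: "P n \<subseteq> X n" for n unfolding P_def by (rule disjointed_subset)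
  have UP: "(\<Union>n. P n) = S" unfolding P_def UN_disjointed_eq UX ..
  have PS: "P n \<subseteq> S" for n using UP by blast
  have Pm[measurable]: "P n \<in> sets borel" for n unfolding P_def disjointed_def by measurable
  have Pd: "disjoint_family P" unfolding P_def by (rule disjoint_family_disjointed)
  have derP: "(f has_derivative (\<lambda>h. of_real (Re h) * G1 z + of_real (Im h) * G2 z)) (at z within P n)" if "z \<in> P n" for z n
    using derS that PS by (blast intro: has_derivative_at_withinI)
  have injP: "inj_on f (P n)" for n using inj PX by (rule inj_on_subset)
  have piece: "(\<integral>\<^sup>+ z\<in>P n. u (f z) * ennreal (J z) \<partial>lborel) \<le> (\<integral>\<^sup>+ y\<in>f ` P n. u y \<partial>lborel)" for n
  proof (rule change_of_variables_le[OF Pm derP injP J _ u])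
    fix z assume "z \<in> P n"
    then have "0 < J z" using PS by (auto simp: S_def)
    then show "J z = \<bar>det_complex (\<lambda>h. of_real (Re h) * G1 z + of_real (Im h) * G2 z)\<bar>"
      unfolding det_complex_partials J_def grad_jacobian_def by simp
  qed
  have imP: "f ` P n \<in> sets lebesgue" for n
  proof (rule differentiable_image_in_sets_lebesgue)
    show "f differentiable_on P n" using derP by (auto simp: differentiable_on_def differentiable_def)
  qed (use Pm[of n] in \<open>auto simp: sets_completionI_sets\<close>)
  have "(\<integral>\<^sup>+ z\<in>D. u (f z) * ennreal (J z) \<partial>lborel) = (\<integral>\<^sup>+ z\<in>S. u (F z) * ennreal (J z) \<partial>lborel)"
  proof (rule nn_integral_cong_AE)
    show "AE z in lborel. u (f z) * ennreal (J z) * indicator D z = u (F z) * ennreal (J z) * indicator S z"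
      using AE_not_in[OF N(1)] by eventually_elim (auto simp: S_def F_def indicator_def ennreal_neg not_less)
  qed
  also have "\<dots> = (\<integral>\<^sup>+ z\<in>(\<Union>n. P n). u (F z) * ennreal (J z) \<partial>lborel)" unfolding UP ..
  also have "\<dots> = (\<Sum>n. \<integral>\<^sup>+ z\<in>P n. u (F z) * ennreal (J z) \<partial>lborel)"
    by (rule nn_integral_disjoint_family[OF _ _ Pd]) measurable
  also have "\<dots> = (\<Sum>n. \<integral>\<^sup>+ z\<in>P n. u (f z) * ennreal (J z) \<partial>lborel)"
    using PS by (intro suminf_cong nn_integral_cong) (auto simp: indicator_def F_def S_def)
  also have "\<dots> \<le> (\<Sum>n. \<integral>\<^sup>+ y\<in>f ` P n. u y \<partial>lborel)" by (intro suminf_le piece) auto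
  also have "\<dots> = (\<Sum>n. \<integral>\<^sup>+ y\<in>f ` P n. u y \<partial>lebesgue)" by (simp add: nn_integral_completion)
  also have "\<dots> = (\<integral>\<^sup>+ y. (\<Sum>n. u y * indicator (f ` P n) y) \<partial>lebesgue)"
  proof (rule nn_integral_suminf[symmetric])
    fix n
    have "u \<in> borel_measurable lebesgue" by (rule measurable_completion) simp
    then show "(\<lambda>y. u y * indicator (f ` P n) y) \<in> borel_measurable lebesgue"
      using imP[of n] by (intro borel_measurable_times_ennreal borel_measurable_indicator) auto
  qed
  also have "\<dots> \<le> (\<integral>\<^sup>+ y. u y * multiplicity_at y f D \<partial>lebesgue)"
  proof -
    have "P n \<subseteq> D" for n using PS by (auto simp: S_def)
    from suminf_indicator_image_le_multiplicity[OF Pd this, of f] show ?thesis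
      by (intro nn_integral_mono) (simp add: mult_left_mono)
  qed
  also have "\<dots> = (\<integral>\<^sup>+ y. u y * multiplicity_at y f D \<partial>lborel)" by (rule nn_integral_completion)
  finally show ?thesis unfolding J_def .
qed

section \<open>The pointwise dilatation inequality\<close>

text \<open>Where the Jacobian is positive this is an equality: with \<open>A = |f_z|\<close> and \<open>B = |f_zbar|\<close>, the numerator
  \<open>(A + B) powr p\<close> divided by \<open>J powr (p - 1) / (A - B) powr p\<close> is \<open>J\<close>, because \<open>J = (A - B) * (A + B)\<close>. Elsewhere finite
  distortion makes the left hand side vanish.\<close>

lemma dilatation_pointwise:
  fixes x N :: ennreal and p \<alpha> :: real
  assumes p: "1 < p" and \<alpha>: "\<alpha> = p / (p - 1)" and N: "N \<noteq> 0" "N < \<infinity>"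
    and K: "K < \<infinity>" "ennreal ((deriv_norm f z)\<^sup>2) \<le> K * ennreal (jacobian f z)"
  shows "ennpowr (x * ennreal (deriv_norm f z)) p / (N * ennpowr (inner_dilatation \<alpha> f z) (p - 1))
     \<le> ennpowr x p * ennreal (jacobian f z) / N"
proof (cases "0 < jacobian f z")
  case False
  then have "ennreal (jacobian f z) = 0" by (simp add: ennreal_neg)
  then have "ennreal ((deriv_norm f z)\<^sup>2) = 0" using K by simp
  then have "deriv_norm f z = 0" by (simp add: ennreal_eq_0_iff)
  then show ?thesis using p by (simp add: ennpowr_def)
next
  case True
  define A where "A = cmod (f_z f z)"
  define B where "B = cmod (f_zbar f z)"
  define J where "J = jacobian f z"
  have J: "J = (A - B) * (A + B)" "0 < J" using True by (simp_all add: J_def jacobian_def A_def B_def power2_eq_square algebra_simps)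
  have AB: "0 \<le> A" "0 \<le> B" by (simp_all add: A_def B_def)
  have l: "0 < A - B" using J AB by (auto simp: zero_less_mult_iff)
  have k: "deriv_norm f z = A + B" by (simp add: deriv_norm_def A_def B_def)
  have kpos: "0 < A + B" using l AB by linarith
  have inner: "inner_dilatation \<alpha> f z = ennreal (J / (A - B) powr \<alpha>)"
  proof -
    have "jacobian f z \<noteq> 0" using True by simp
    then have "inner_dilatation \<alpha> f z = ennreal ((A\<^sup>2 - B\<^sup>2) / (A - B) powr \<alpha>)"
      unfolding inner_dilatation_def by (simp only: A_def B_def simp_thms if_True)
    moreover have "A\<^sup>2 - B\<^sup>2 = J" by (simp add: J_def jacobian_def A_def B_def)
    ultimately show ?thesis by simp
  qed
  have quot: "0 < J / (A - B) powr \<alpha>" using J l by simp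
  have ap: "\<alpha> * (p - 1) = p" using p \<alpha> by simp
  have "(J / (A - B) powr \<alpha>) powr (p - 1) = J powr (p - 1) / (A - B) powr p"
    using J l by (simp add: powr_divide powr_powr ap)
  then have Q: "ennpowr (inner_dilatation \<alpha> f z) (p - 1) = ennreal (J powr (p - 1) / (A - B) powr p)"
    unfolding inner using quot by (simp add: ennpowr_def)
  define q where "q = J powr (p - 1) / (A - B) powr p"
  have q: "0 < q" unfolding q_def using J(2) l by (intro divide_pos_pos) auto
  obtain n where n: "N = ennreal n" "0 < n"
    using N by (cases N) (auto simp: order_less_le)
  show ?thesis
  proof (cases x)
    case (real t)
    have xk: "ennpowr (x * ennreal (A + B)) p = ennreal ((t * (A + B)) powr p)"
      using real kpos by (simp add: ennpowr_def flip: ennreal_mult)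
    have xp: "ennpowr x p = ennreal (t powr p)" using real by (simp add: ennpowr_def)
    have "(t * (A + B)) powr p / (n * q) = t powr p * J / n"
    proof -
      have "J powr p = (A - B) powr p * (A + B) powr p" unfolding J(1) using l kpos by (simp add: powr_mult)
      moreover have "J powr p = J * J powr (p - 1)"
        using J(2) by (simp add: powr_mult_base)
      moreover have "(t * (A + B)) powr p = t powr p * (A + B) powr p" using real kpos by (simp add: powr_mult)
      moreover have "0 < (A - B) powr p" "0 < J powr (p - 1)" using l J by auto
      ultimately show ?thesis using n(2) by (simp add: q_def field_simps)
    qed
    moreover have "ennpowr (x * ennreal (A + B)) p / (N * ennreal q) = ennreal ((t * (A + B)) powr p / (n * q))"
      unfolding xk n using n(2) q by (simp add: divide_ennreal flip: ennreal_mult)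
    moreover have "ennpowr x p * ennreal J / N = ennreal (t powr p * J / n)"
      unfolding xp n using n(2) J(2) by (simp add: divide_ennreal flip: ennreal_mult)
    ultimately show ?thesis unfolding k Q q_def[symmetric] J_def[symmetric] by simp
  next
    case top
    have "ennpowr x p * ennreal J / N = top"
      using top J(2) n by (simp add: ennpowr_def ennreal_top_mult ennreal_top_divide)
    then show ?thesis unfolding J_def by simp
  qed
qed

section \<open>Circles in a domain and exceptional radii\<close>

lemma hausdorff1_singleton: "{a} \<in> null_sets hausdorff1"
proof -
  have "hausdorff1_delta \<delta> {a} \<le> 0" if "0 < \<delta>" for \<delta>
  proof -
    have "hausdorff1_delta \<delta> {a} \<le> (\<Sum>i::nat. ennreal (diameter ((\<lambda>_. {a}) i)))"
      unfolding hausdorff1_delta_def using that by (intro INF_lower) auto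
    then show ?thesis by simp
  qed
  then have "hausdorff1_outer {a} = 0"
    unfolding hausdorff1_outer_def by (auto intro!: SUP_eqI)
  then show ?thesis
    using emeasure_hausdorff1[of "{a}"] borel_sets_hausdorff1[of "{a}"] by (intro null_setsI) auto
qed

text \<open>The distances from \<open>z\<^sub>0\<close> to the points of the connected set \<open>D\<close> form an interval, with arbitrarily small
  members and with members beyond \<open>r\<^sub>0\<close>.\<close>

lemma circle_meets_domain:
  assumes D: "open D" "connected D" and z0: "z\<^sub>0 \<in> closure D" and r: "0 < r" "r < r\<^sub>0"
    and r0: "ereal r\<^sub>0 < (SUP z\<in>D. ereal (cmod (z - z\<^sub>0)))"
  obtains z where "z \<in> D" "cmod (z - z\<^sub>0) = r"
proof -
  obtain w where w: "w \<in> D" "r\<^sub>0 < cmod (w - z\<^sub>0)" using r0 by (auto simp: less_SUP_iff)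
  obtain v where v: "v \<in> D" "dist v z\<^sub>0 < r" using z0 r(1) by (auto simp: closure_approachable)
  have "connected ((\<lambda>z. cmod (z - z\<^sub>0)) ` D)"
    by (intro connected_continuous_image continuous_intros D)
  then have "r \<in> (\<lambda>z. cmod (z - z\<^sub>0)) ` D"
    by (rule connectedD_interval[of _ "cmod (v - z\<^sub>0)" "cmod (w - z\<^sub>0)"])
       (use v w r in \<open>auto simp: dist_norm\<close>)
  then show thesis using that by auto
qed

text \<open>The angle 0 is left out, which makes the parametrization injective on an open set.\<close>

definition arc_params :: "complex set \<Rightarrow> complex \<Rightarrow> real \<Rightarrow> real set" where
  "arc_params D z\<^sub>0 r = {t. 0 < t \<and> t < 2 * pi \<and> polar z\<^sub>0 r t \<in> D}"

lemma continuous_polar_arg: "continuous_on S (polar z\<^sub>0 r)"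
  unfolding polar_def by (intro continuous_intros)

lemma open_arc_params:
  assumes "open D" shows "open (arc_params D z\<^sub>0 r)"
proof -
  have "arc_params D z\<^sub>0 r = {0<..<2 * pi} \<inter> polar z\<^sub>0 r -` D" by (auto simp: arc_params_def)
  then show ?thesis using open_vimage[OF assms continuous_polar_arg] by (simp add: open_Int)
qed

lemma polar_surj:
  assumes "cmod (z - z\<^sub>0) = r"
  obtains t where "0 \<le> t" "t < 2 * pi" "z = polar z\<^sub>0 r t"
proof
  show "0 \<le> Arg2pi (z - z\<^sub>0)" "Arg2pi (z - z\<^sub>0) < 2 * pi" by (auto simp: Arg2pi_ge_0 Arg2pi_lt_2pi)
  show "z = polar z\<^sub>0 r (Arg2pi (z - z\<^sub>0))"
    using Arg2pi_eq[of "z - z\<^sub>0"] assms by (simp add: polar_def cis_conv_exp)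
qed

lemma arc_params_nonempty:
  assumes D: "open D" and z: "z \<in> D" "cmod (z - z\<^sub>0) = r"
  shows "arc_params D z\<^sub>0 r \<noteq> {}"
proof -
  obtain t where t: "0 \<le> t" "t < 2 * pi" "z = polar z\<^sub>0 r t" using polar_surj[OF z(2)] by blast
  have "open (polar z\<^sub>0 r -` D)" by (rule open_vimage[OF D continuous_polar_arg])
  then obtain e where e: "0 < e" "ball t e \<subseteq> polar z\<^sub>0 r -` D"
    using t z open_contains_ball by (metis vimageI)
  obtain a where a: "0 < a" "a < e" "a < 2 * pi - t" using field_lbound_gt_zero[OF e(1), of "2 * pi - t"] t(2) by auto
  define s where "s = t + a"
  have "\<bar>s - t\<bar> < e" "0 < s" "s < 2 * pi" using a t(1) by (simp_all add: s_def)
  then have "s \<in> ball t e" "0 < s" "s < 2 * pi" by (auto simp: dist_real_def abs_minus_commute)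
  then show ?thesis using e(2) by (auto simp: arc_params_def)
qed

lemma inj_on_polar_arg: "0 < r \<Longrightarrow> inj_on (polar z\<^sub>0 r) {0<..<2 * pi}"
proof (rule inj_onI)
  fix s t assume "0 < r" "s \<in> {0<..<2 * pi}" "t \<in> {0<..<2 * pi}" "polar z\<^sub>0 r s = polar z\<^sub>0 r t"
  then have "Complex r s = Complex r t" using inj_on_polar[of z\<^sub>0] by (auto dest!: inj_onD[where x = "Complex r s" and y = "Complex r t"])
  then show "s = t" by simp
qed

text \<open>Only the point of angle 0 is lost in the parametrization; its image is one point, which is null for
  Hausdorff measure.\<close>

lemma multiplicity_circle:
  assumes r: "0 < r" and y: "y \<noteq> f (polar z\<^sub>0 r 0)" and F: "\<And>z. z \<in> D \<Longrightarrow> F z = f z"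
  shows "multiplicity_at y f (sphere z\<^sub>0 r \<inter> D) = multiplicity_at y (\<lambda>t. F (polar z\<^sub>0 r t)) (arc_params D z\<^sub>0 r)"
proof -
  let ?A = "{t \<in> arc_params D z\<^sub>0 r. F (polar z\<^sub>0 r t) = y}"
  have eq: "{x \<in> sphere z\<^sub>0 r \<inter> D. f x = y} = polar z\<^sub>0 r ` ?A"
  proof (intro equalityI subsetI)
    fix x assume x: "x \<in> {x \<in> sphere z\<^sub>0 r \<inter> D. f x = y}"
    then have "cmod (x - z\<^sub>0) = r" by (simp add: dist_norm norm_minus_commute)
    then obtain t where t: "0 \<le> t" "t < 2 * pi" "x = polar z\<^sub>0 r t" using polar_surj by blast
    have "t \<noteq> 0" using x y t by auto
    then have "t \<in> ?A" using x t F by (auto simp: arc_params_def)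
    then show "x \<in> polar z\<^sub>0 r ` ?A" using t by blast
  next
    fix x assume "x \<in> polar z\<^sub>0 r ` ?A"
    then show "x \<in> {x \<in> sphere z\<^sub>0 r \<inter> D. f x = y}"
      using F r by (auto simp: arc_params_def polar_def dist_norm norm_mult)
  qed
  have "inj_on (polar z\<^sub>0 r) ?A"
    by (rule inj_on_subset[OF inj_on_polar_arg[OF r]]) (auto simp: arc_params_def)
  then show ?thesis unfolding multiplicity_at_def eq by (simp add: finite_image_iff card_image)
qed

text \<open>The density that is infinite on the union of the circles costs nothing, since this union is a null set of
  the plane. It is admissible because every circle meets the open set \<open>D\<close> in a set of positive length; for a
  circle that misses \<open>D\<close> there would be no admissible density at all.\<close>

lemma modulus_null_radii:
  assumes D: "open D" and N: "N \<in> null_sets lborel" "N \<subseteq> {0<..}" and p: "1 < p"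
    and meets: "\<And>r. r \<in> N \<Longrightarrow> \<exists>z\<in>D. cmod (z - z\<^sub>0) = r"
  shows "modulus p (circle_surface D z\<^sub>0 ` N) = 0"
proof -
  have [measurable]: "N \<in> sets borel" "D \<in> sets borel" using N D by auto
  let ?B = "{z. cmod (z - z\<^sub>0) \<in> N}"
  define \<rho> :: "complex \<Rightarrow> ennreal" where "\<rho> z = \<infinity> * indicator ?B z" for z
  have B: "?B \<in> null_sets lborel" by (rule null_set_radial[OF N])
  have [measurable]: "\<rho> \<in> borel_measurable borel" unfolding \<rho>_def[abs_def] by measurable
  have adm: "\<rho> \<in> adm (circle_surface D z\<^sub>0 ` N)"
    unfolding adm_def
  proof (intro CollectI conjI ballI)
    fix S assume "S \<in> circle_surface D z\<^sub>0 ` N"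
    then obtain r where r: "r \<in> N" "S = circle_surface D z\<^sub>0 r" by auto
    have r0: "0 < r" using r N by auto
    have V: "open (arc_params D z\<^sub>0 r)" by (rule open_arc_params[OF D])
    obtain z where "z \<in> D" "cmod (z - z\<^sub>0) = r" using meets[OF r(1)] by auto
    then have "arc_params D z\<^sub>0 r \<noteq> {}" by (rule arc_params_nonempty[OF D])
    then have "\<not> negligible (arc_params D z\<^sub>0 r)" using V open_not_negligible by blast
    then have em: "emeasure lborel (arc_params D z\<^sub>0 r) \<noteq> 0"
      using V by (auto simp: negligible_iff_null_sets null_sets_completion_iff null_sets_def)
    have "\<infinity> = \<infinity> * emeasure lborel (arc_params D z\<^sub>0 r)" using em by (simp add: ennreal_top_mult)
    also have "\<dots> = (\<integral>\<^sup>+ t\<in>arc_params D z\<^sub>0 r. \<infinity> \<partial>lborel)"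
      using V by (subst nn_integral_cmult_indicator) auto
    also have "\<dots> \<le> (\<integral>\<^sup>+ t\<in>{0<..<2*pi}. (\<rho> (z\<^sub>0 + of_real r * cis t) * indicator D (z\<^sub>0 + of_real r * cis t)) * ennreal r \<partial>lborel)"
      using r r0 by (intro nn_integral_mono)
        (auto simp: indicator_def arc_params_def \<rho>_def polar_def norm_mult ennreal_top_mult)
    also have "\<dots> \<le> (\<integral>\<^sup>+ y\<in>sphere z\<^sub>0 r. \<rho> y * indicator D y \<partial>hausdorff1)"
      by (rule circle_length_le_hausdorff1[OF r0]) measurable
    also have "\<dots> = surface_integral S \<rho>"
      unfolding surface_integral_def r(2) surface_mult_circle
      by (intro nn_integral_cong) (auto simp: indicator_def)
    finally show "1 \<le> surface_integral S \<rho>" by (simp add: top_unique)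
  qed measurable
  have "modulus p (circle_surface D z\<^sub>0 ` N) \<le> (\<integral>\<^sup>+ z. ennpowr (\<rho> z) p \<partial>lborel)"
    unfolding modulus_def by (rule INF_lower[OF adm])
  also have "\<dots> = (\<integral>\<^sup>+ z. 0 \<partial>(lborel :: complex measure))"
    using AE_not_in[OF B] p by (intro nn_integral_cong_AE) (auto simp: \<rho>_def ennpowr_def)
  finally show ?thesis by simp
qed

section \<open>The modulus inequality\<close>

lemma measurable_ennpowr [measurable (raw)]:
  assumes [measurable]: "f \<in> borel_measurable M"
  shows "(\<lambda>x. ennpowr (f x) p) \<in> borel_measurable M"
  unfolding ennpowr_def by measurable

lemma max_multiplicity_ge: "multiplicity_at y f D \<le> max_multiplicity f D"
  unfolding max_multiplicity_def by (rule SUP_upper) simp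

text \<open>The multiplicity may be cancelled in the final estimate only if it is not zero.\<close>

lemma max_multiplicity_nonzero:
  assumes "D \<noteq> {}" shows "max_multiplicity f D \<noteq> 0"
proof -
  obtain x where x: "x \<in> D" using assms by auto
  have "multiplicity_at (f x) f D \<noteq> 0"
    using x by (auto simp: multiplicity_at_def card_eq_0_iff)
  then show ?thesis using max_multiplicity_ge[of "f x" f D] by auto
qed

theorem theorem2p1:
  fixes D :: "complex set" and f :: "complex \<Rightarrow> complex" and p \<alpha> :: real
    and Q :: "complex \<Rightarrow> ennreal" and z\<^sub>0 :: complex and r\<^sub>0 \<epsilon> :: real
  assumes domain: "open D" "connected D" "D \<noteq> {}"
    and p: "p > 1"
    and \<alpha>: "\<alpha> = p / (p - 1)"
    and standing: "continuous_on D f" "sense_preserving D f" "has_partials_ae D f"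
    and f_open: "open_map (top_of_set D) euclidean f"
    and f_discrete: "\<And>y. discrete {z \<in> D. f z = y}"
    and f_dist: "finite_distortion D f"
    and mult: "max_multiplicity f D < \<infinity>"
    and Q: "Q = (\<lambda>z. max_multiplicity f D * ennpowr (inner_dilatation \<alpha> f z) (p - 1))"
    and z0: "z\<^sub>0 \<in> closure D"
    and r0: "0 < r\<^sub>0" "ereal r\<^sub>0 < (SUP z\<in>D. ereal (cmod (z - z\<^sub>0)))"
    and eps: "0 < \<epsilon>" "\<epsilon> < r\<^sub>0"
  shows "modulus p (surface_image f ` circle_family D z\<^sub>0 \<epsilon> r\<^sub>0) \<ge>
           (INF \<rho>\<in>ext_adm p (circle_family D z\<^sub>0 \<epsilon> r\<^sub>0).
              \<integral>\<^sup>+ z\<in>D \<inter> annulus z\<^sub>0 \<epsilon> r\<^sub>0. (ennpowr (\<rho> z) p / Q z) \<partial>lebesgue)"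
proof -
  note D = domain(1) and cont = standing(1)
  have Dm[measurable]: "D \<in> sets borel" using D by simp
  \<comment> \<open>Outside \<open>D\<close> the map is continued by 0, which makes it Borel measurable.\<close>
  define F where "F z = indicator D z *\<^sub>R f z" for z
  have Ff: "F z = f z" if "z \<in> D" for z using that by (simp add: F_def)
  have contF: "continuous_on D F" using cont by (simp add: Ff cong: continuous_on_cong)
  have W: "W11_loc D f" using f_dist by (simp add: finite_distortion_def)
  obtain G1 G2 where FL: "locally_L1 D F" and G: "locally_L1 D G1" "locally_L1 D G2" and wg: "weak_gradient D F G1 G2"
    using W11_representatives[OF D cont W] unfolding F_def[abs_def, symmetric] by blast
  note [measurable] = locally_L1_measurable[OF FL] locally_L1_measurable[OF G(1)] locally_L1_measurable[OF G(2)]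
  have w1: "AE z in lborel. z \<in> D \<longrightarrow> has_dir_deriv f 1 z \<longrightarrow> dir_deriv 1 f z = G1 z"
    by (rule partials_eq_weak_AE[OF D FL contF wg _ G(1)]) (auto simp: Ff)
  have w2: "AE z in lborel. z \<in> D \<longrightarrow> has_dir_deriv f \<i> z \<longrightarrow> dir_deriv \<i> f z = G2 z"
    by (rule partials_eq_weak_AE[OF D FL contF wg _ G(2)]) (auto simp: Ff)
  have GL: "AE z in lborel. z \<in> D \<longrightarrow> dir_deriv 1 f z = G1 z \<and> dir_deriv \<i> f z = G2 z \<and>
      (f has_derivative (\<lambda>h. of_real (Re h) * G1 z + of_real (Im h) * G2 z)) (at z)"
    using Gehring_Lehto[OF cont D f_open standing(3)] w1 w2 by eventually_elim auto
  obtain K where K: "AE z in lborel. z \<in> D \<longrightarrow> K z < \<infinity>"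
    "AE z in lborel. z \<in> D \<longrightarrow> ennreal ((deriv_norm f z)\<^sup>2) \<le> K z * ennreal (jacobian f z)"
    using f_dist unfolding finite_distortion_def AE_completion_iff by blast
  define N where "N = max_multiplicity f D"
  have N: "N \<noteq> 0" "N < \<infinity>" using max_multiplicity_nonzero[OF domain(3)] mult by (simp_all add: N_def)
  define k where "k z = grad_norm (G1 z) (G2 z)" for z
  have km[measurable]: "k \<in> borel_measurable borel" unfolding k_def[abs_def] by measurable
  define AC_circle where "AC_circle r \<longleftrightarrow> (\<forall>s t. s \<le> t \<and> {s..t} \<subseteq> arc_params D z\<^sub>0 r \<longrightarrow>
     (\<integral>\<^sup>+ \<tau>\<in>{s..t}. ennreal (r * k (polar z\<^sub>0 r \<tau>)) \<partial>lborel) < \<infinity> \<and>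
     ennreal (dist (F (polar z\<^sub>0 r s)) (F (polar z\<^sub>0 r t))) \<le> (\<integral>\<^sup>+ \<tau>\<in>{s..t}. ennreal (r * k (polar z\<^sub>0 r \<tau>)) \<partial>lborel))" for r
  have AC: "AE r in lborel. 0 < r \<longrightarrow> AC_circle r"
    unfolding AC_circle_def arc_params_def k_def by (rule circle_AC_AE[OF D FL contF wg G])
  obtain E where E: "\<And>r. r \<in> space lborel - E \<Longrightarrow> 0 < r \<longrightarrow> AC_circle r" "E \<in> null_sets lborel"
    using AE_E3[OF AC] by metis
  \<comment> \<open>Cut down to the given range of radii, where every circle meets \<open>D\<close>.\<close>
  define E0 where "E0 = E \<inter> {\<epsilon><..<r\<^sub>0}"
  have E0: "E0 \<in> null_sets lborel" unfolding E0_def using E(2) by (rule null_set_Int2) simp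
  have null: "modulus p (circle_surface D z\<^sub>0 ` E0) = 0"
  proof (rule modulus_null_radii[OF D E0 _ p])
    show "E0 \<subseteq> {0<..}" using eps by (auto simp: E0_def)
    fix r assume "r \<in> E0"
    then have "0 < r" "r < r\<^sub>0" using eps by (auto simp: E0_def)
    then show "\<exists>z\<in>D. cmod (z - z\<^sub>0) = r"
      using circle_meets_domain[OF D domain(2) z0 _ _ r0(2)] by metis
  qed
  show ?thesis
    unfolding modulus_def[of p "surface_image f ` circle_family D z\<^sub>0 \<epsilon> r\<^sub>0"]
  proof (rule INF_greatest)
    fix \<rho>' assume "\<rho>' \<in> adm (surface_image f ` circle_family D z\<^sub>0 \<epsilon> r\<^sub>0)"
    then have \<rho>'[measurable]: "\<rho>' \<in> borel_measurable borel"
      and adm': "\<And>r. r \<in> {\<epsilon><..<r\<^sub>0} \<Longrightarrow> 1 \<le> surface_integral (surface_image f (circle_surface D z\<^sub>0 r)) \<rho>'"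
      by (auto simp: adm_def circle_family_def)
    define \<rho> where "\<rho> z = \<rho>' (F z) * ennreal (k z) * indicator D z" for z
    have \<rho>m[measurable]: "\<rho> \<in> borel_measurable borel" unfolding \<rho>_def[abs_def] by measurable
    have good: "1 \<le> surface_integral (circle_surface D z\<^sub>0 r) \<rho>" if r: "r \<in> {\<epsilon><..<r\<^sub>0}" "r \<notin> E0" for r
    proof -
      have rpos: "0 < r" using r eps by auto
      have "r \<notin> E" using r by (auto simp: E0_def)
      then have AC_circle: "AC_circle r" using E(1) rpos by simp
      let ?V = "arc_params D z\<^sub>0 r" and ?\<gamma> = "\<lambda>t. F (polar z\<^sub>0 r t)" and ?h = "\<lambda>t. ennreal (r * k (polar z\<^sub>0 r t))"
      have ac: "(\<integral>\<^sup>+ \<tau>\<in>{s..t}. ?h \<tau> \<partial>lborel) < \<infinity>"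
        "ennreal (dist (?\<gamma> s) (?\<gamma> t)) \<le> (\<integral>\<^sup>+ \<tau>\<in>{s..t}. ?h \<tau> \<partial>lborel)"
        if "s \<le> t" "{s..t} \<subseteq> ?V" for s t
        using AC_circle[unfolded AC_circle_def, rule_format, of s t] that by simp_all
      have "1 \<le> surface_integral (surface_image f (circle_surface D z\<^sub>0 r)) \<rho>'" by (rule adm'[OF r(1)])
      also have "\<dots> = (\<integral>\<^sup>+ y. \<rho>' y * multiplicity_at y f (sphere z\<^sub>0 r \<inter> D) \<partial>hausdorff1)"
        unfolding surface_integral_def surface_mult_image_circle ..
      also have "\<dots> = (\<integral>\<^sup>+ y. \<rho>' y * multiplicity_at y ?\<gamma> ?V \<partial>hausdorff1)"
        using AE_not_in[OF hausdorff1_singleton[of "f (polar z\<^sub>0 r 0)"]]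
        by (intro nn_integral_cong_AE) (auto elim!: eventually_mono simp: multiplicity_circle[OF rpos _ Ff])
      also have "\<dots> \<le> (\<integral>\<^sup>+ t\<in>?V. \<rho>' (?\<gamma> t) * ?h t \<partial>lborel)"
      proof (rule curve_area_inequality[OF open_arc_params[OF D]])
        show "continuous_on ?V ?\<gamma>"
          by (rule continuous_on_compose2[OF contF continuous_polar_arg]) (auto simp: arc_params_def)
        show "?h \<in> borel_measurable borel" by measurable
      qed (use ac in auto)
      also have "\<dots> \<le> (\<integral>\<^sup>+ t\<in>{0<..<2*pi}. \<rho> (z\<^sub>0 + of_real r * cis t) * ennreal r \<partial>lborel)"
      proof (intro nn_integral_mono)
        fix t
        show "\<rho>' (?\<gamma> t) * ?h t * indicator ?V t \<le> \<rho> (z\<^sub>0 + of_real r * cis t) * ennreal r * indicator {0<..<2*pi} t"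
        proof (cases "t \<in> ?V")
          case True
          then show ?thesis
            using rpos unfolding polar_def[symmetric]
            by (simp add: arc_params_def \<rho>_def k_def ennreal_mult' mult_ac)
        qed simp
      qed
      also have "\<dots> \<le> (\<integral>\<^sup>+ y\<in>sphere z\<^sub>0 r. \<rho> y \<partial>hausdorff1)"
        by (rule circle_length_le_hausdorff1[OF rpos \<rho>m])
      also have "\<dots> = surface_integral (circle_surface D z\<^sub>0 r) \<rho>"
        unfolding surface_integral_def surface_mult_circle
        by (intro nn_integral_cong) (auto simp: indicator_def \<rho>_def)
      finally show ?thesis .
    qed
    have ext: "\<rho> \<in> ext_adm p (circle_family D z\<^sub>0 \<epsilon> r\<^sub>0)"
      unfolding ext_adm_def almost_all_surfaces_def
    proof (intro CollectI conjI exI[of _ "circle_surface D z\<^sub>0 ` E0"] ballI null)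
      show "\<rho> \<in> borel_measurable lebesgue" by (rule measurable_completion) simp
      show "circle_surface D z\<^sub>0 ` E0 \<subseteq> circle_family D z\<^sub>0 \<epsilon> r\<^sub>0" by (auto simp: circle_family_def E0_def)
      fix S assume "S \<in> circle_family D z\<^sub>0 \<epsilon> r\<^sub>0 - circle_surface D z\<^sub>0 ` E0"
      then obtain r where r: "r \<in> {\<epsilon><..<r\<^sub>0}" "S = circle_surface D z\<^sub>0 r" "S \<notin> circle_surface D z\<^sub>0 ` E0"
        unfolding circle_family_def by blast
      then have "r \<notin> E0" by blast
      then show "1 \<le> surface_integral S \<rho>" using good r by simp
    qed
    have "(\<integral>\<^sup>+ z\<in>D \<inter> annulus z\<^sub>0 \<epsilon> r\<^sub>0. (ennpowr (\<rho> z) p / Q z) \<partial>lebesgue)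
        = (\<integral>\<^sup>+ z\<in>D \<inter> annulus z\<^sub>0 \<epsilon> r\<^sub>0. (ennpowr (\<rho> z) p / Q z) \<partial>lborel)"
      by (rule nn_integral_completion)
    also have "\<dots> \<le> (\<integral>\<^sup>+ z. (ennpowr (\<rho>' (F z)) p * ennreal (grad_jacobian (G1 z) (G2 z)) * indicator D z) * (1 / N) \<partial>lborel)"
    proof (rule nn_integral_mono_AE)
      show "AE z in lborel. ennpowr (\<rho> z) p / Q z * indicator (D \<inter> annulus z\<^sub>0 \<epsilon> r\<^sub>0) z
        \<le> (ennpowr (\<rho>' (F z)) p * ennreal (grad_jacobian (G1 z) (G2 z)) * indicator D z) * (1 / N)"
        using GL K
      proof eventually_elim
        case (elim z)
        show ?case
        proof (cases "z \<in> D \<inter> annulus z\<^sub>0 \<epsilon> r\<^sub>0")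
          case True
          then have zD: "z \<in> D" by simp
          have kz: "k z = deriv_norm f z" and jz: "grad_jacobian (G1 z) (G2 z) = jacobian f z"
            using elim(1) zD by (simp_all add: k_def grad_norm_def deriv_norm_def grad_jacobian_def jacobian_def f_z_def f_zbar_def)
          have "K z < \<infinity>" "ennreal ((deriv_norm f z)\<^sup>2) \<le> K z * ennreal (jacobian f z)" using elim zD by auto
          from dilatation_pointwise[OF p \<alpha> N this, of "\<rho>' (F z)"]
          show ?thesis using True zD by (simp add: \<rho>_def kz jz Q N_def divide_ennreal_def)
        qed simp
      qed
    qed
    also have "\<dots> = (\<integral>\<^sup>+ z. (ennpowr (\<rho>' (F z)) p * ennreal (grad_jacobian (G1 z) (G2 z)) * indicator D z) \<partial>lborel) * (1 / N)"
      by (rule nn_integral_multc) measurable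
    also have "(\<integral>\<^sup>+ z. (ennpowr (\<rho>' (F z)) p * ennreal (grad_jacobian (G1 z) (G2 z)) * indicator D z) \<partial>lborel)
       = (\<integral>\<^sup>+ z\<in>D. ennpowr (\<rho>' (f z)) p * ennreal (grad_jacobian (G1 z) (G2 z)) \<partial>lborel)"
      by (intro nn_integral_cong) (auto simp: indicator_def Ff)
    also have "\<dots> \<le> (\<integral>\<^sup>+ y. ennpowr (\<rho>' y) p * multiplicity_at y f D \<partial>lborel)"
    proof (rule jacobian_area_inequality[OF D cont, where u = "\<lambda>y. ennpowr (\<rho>' y) p"])
      show "AE z in lborel. z \<in> D \<longrightarrow> (f has_derivative (\<lambda>h. of_real (Re h) * G1 z + of_real (Im h) * G2 z)) (at z)"
        using GL by eventually_elim blast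
    qed measurable
    also have "\<dots> \<le> (\<integral>\<^sup>+ y. ennpowr (\<rho>' y) p * N \<partial>lborel)"
      unfolding N_def by (intro nn_integral_mono mult_left_mono max_multiplicity_ge) simp
    also have "\<dots> = (\<integral>\<^sup>+ y. ennpowr (\<rho>' y) p \<partial>lborel) * N" by (rule nn_integral_multc) measurable
    finally have "(\<integral>\<^sup>+ z\<in>D \<inter> annulus z\<^sub>0 \<epsilon> r\<^sub>0. (ennpowr (\<rho> z) p / Q z) \<partial>lebesgue)
       \<le> (\<integral>\<^sup>+ y. ennpowr (\<rho>' y) p \<partial>lborel) * N * (1 / N)"
      by (simp add: mult_right_mono)
    also have "\<dots> = (\<integral>\<^sup>+ y. ennpowr (\<rho>' y) p \<partial>lborel)"
    proof -
      have "N * (1 / N) = 1" using N by (simp add: ennreal_times_divide ennreal_divide_self less_top)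
      then show ?thesis by (simp add: mult.assoc)
    qed
    finally show "(INF \<rho>\<in>ext_adm p (circle_family D z\<^sub>0 \<epsilon> r\<^sub>0).
        \<integral>\<^sup>+ z\<in>D \<inter> annulus z\<^sub>0 \<epsilon> r\<^sub>0. (ennpowr (\<rho> z) p / Q z) \<partial>lebesgue)
      \<le> (\<integral>\<^sup>+ y. ennpowr (\<rho>' y) p \<partial>lborel)"
      by (rule INF_lower2[OF ext])
  qed
qed

end
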